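(* All SCSs below (semi-cosimplicial sets with injective coface maps) are assumed to be saturated. (a) Let $\mathbb S$ be an SCS with a single root element $\underline y$, of normal rank $|\hat\chi(\underline y)|=k$. Then $\mathbb S$ is isomorphic as an SCS to the sub-SCS $\hat\chi(\underline y)^{\le}:=\{v\in\Lambda_k: \hat\chi(\underline y)\le v\}$ of $\Lambda_k$. Two such SCSs $\mathbb S,\mathbb S'$ with single root elements $\underline y$, $\underline y'$ of normal rank $k$ are isomorphic as SCSs if and only if $\hat\chi(\underline y)=\hat\chi(\underline y')$. $\mathbb S$ is normal if and only if $\hat\chi(\underline y)=(1,\dots,1,0,0,\dots)$, i.e. $\hat\chi(\underline y)$ is the root $\{0,\dots,k-1\}$ of $\Lambda_k$; in other words, $\mathbb S$ is normal if and only if it is isomorphic to $\Lambda_k$ as an SCS. As a poset, every such $\mathbb S$ is isomorphic to $\Lambda_k$. (b) A normal SCS $\mathbb S$ is a disjoint union of normal SCSs with single root elements (called the layers of $\mathbb S$). A complete invariant for normal SCSs up to isomorphism is given by the multiplicities, for $k\in\mathbb N_0$, of layers of the form $\Lambda_k$ (i.e. isomorphic to $\Lambda_k$) within $\mathbb S$. (c) Any SCS has an extension to a normal SCS (i.e. is a sub-SCS of a normal SCS). There is a minimal normal extension, which is unique up to isomorphism. (d) A complete invariant for SCSs up to isomorphism is given by the invariant described in (b) applied to the minimal normal extension, together with, for each layer (isomorphic to $\Lambda_k$) of the minimal normal extension, a nonempty finite set of labels (of rank $k$), none of them dominating any of the others. These labels are the normal labels of the root elements of the SCS lying in that layer.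
   Context: SCS: a sequence $(Y_k)_{k\ge-1}$ of sets with injective maps $\delta_i:Y_{n-1}\to Y_n$ (for $n\in\mathbb N_0=\{0,1,\dots\}$, $i=0,\dots,n$) satisfying $\delta_j\delta_i=\delta_i\delta_{j-1}$ for $0\le i<j\le n$. Regarding $\delta_n:Y_{n-1}\to Y_n$ (top index) as inclusions gives a tower $Y_{-1}\subset Y_0\subset\cdots$, $Y_\infty:=\bigcup_kY_k$, and injective maps (partial shifts) $\alpha_n:Y_\infty\to Y_\infty$ determined by $\alpha_n|_{Y_k}=\delta_n:Y_k\to Y_{k+1}$ for $k\ge n-1$; they satisfy $\alpha_j\alpha_i=\alpha_i\alpha_{j-1}$ for $i<j$. Elements of the SCS are elements of $Y_\infty$. The SCS is saturated if $Y_{n-1}=\{y\in Y_\infty:\alpha_n(y)=y\}$ for all $n\in\mathbb N_0$. A sub-SCS consists of subsets $\check Y_k\subset Y_k$ with the restricted coface maps; an extension of an SCS is an SCS containing it as a sub-SCS. An isomorphism of SCSs is a family of bijections $U_k:Y_k\to Y_k'$ intertwining all coface maps. A disjoint union of SCSs is formed levelwise. Root elements: with innovation sets $D_{-1}=Y_{-1}$, $D_k=Y_k\setminus Y_{k-1}$, a root element is a $y\in D_k$ (some $k\ge-1$) with $y\notin\delta_i(Y_{k-1})$ for all $i=0,\dots,k$ (every element of $Y_{-1}$ is a root element). The order on an SCS as a poset: $y\le y'$ iff $y'=\alpha_{i_t}\cdots\alpha_{i_1}(y)$ for some $t\ge0$ and indices $i_1,\dots,i_t$. Labels: $\Lambda_S^0$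 is the set of finite subsets of $\mathbb N_0$, identified with characteristic functions $\chi:\mathbb N_0\to\{0,1\}$ (labels). Rank $|\chi|$: number of ones; level $\ell(\chi)$: largest $i$ with $\chi_i=1$, or $-1$ if there is none. $\epsilon_i$ acts on labels by inserting a $0$ at position $i$: $\epsilon_i(\chi)_j=\chi_j$ for $j<i$, $0$ for $j=i$, $\chi_{j-1}$ for $j>i$. Order on $\Lambda^0_S$: $u\le v$ ($v$ dominates $u$) iff $v=f(u)$ for some strictly increasing $f:\mathbb N_0\to\mathbb N_0$. $\Lambda_k$ denotes the set of labels of rank $k$, regarded as a poset with this order and as a (saturated) SCS with $(\Lambda_k)_m:=\{v\in\Lambda_k:\ell(v)\le m\}$ and $\delta_i:=\epsilon_i$. Normal label: for $y\in Y_\infty$, $\hat\chi(y)\in\Lambda_S^0$ is defined by $\hat\chi(y)_n=0$ if $\alpha_n(y)=\alpha_{n+1}(y)$ and $\hat\chi(y)_n=1$ otherwise ($n\in\mathbb N_0$). The normal rank of $y$ is $|\hat\chi(y)|$. Normal SCS: let $\mathcal H_k=\ell^2(Y_k)$ with $\delta_i:\mathcal H_{n-1}\to\mathcal H_n$ the isometries extending the coface maps on the canonical bases. The SCS is normal if $\delta_{j-1}\delta_i^*=\delta_i^*\delta_j:\mathcal H_k\to\mathcal H_k$ for all $k\ge0$, $0\le i<j\le k+1$. A minimal normal extension of an SCS is a normal extension that embeds, compatibly with the inclusion of the given SCS, as a sub-SCS into every normal extension. In (d), completeness of the invariant means: two SCSs are isomorphic if and only if there is a bijection between the layers of their minimal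 normal extensions which preserves the rank $k$ of the layer and the associated set of labels. *)

theory Defs
  imports "HOL-Analysis.Analysis" "HOL-Library.Equipollence"
begin

section \<open>Semi-cosimplicial sets with injective coface maps\<close>

text \<open>
  The levels are shifted by one in order to be indexed by natural numbers: \<open>lev S n\<close> is
  $Y_{n-1}$, and \<open>cof S n i\<close> is the coface map $\delta_i : Y_{n-1} \to Y_n$ (for $i \le n$), i.e.
  a map from \<open>lev S n\<close> to \<open>lev S (Suc n)\<close>.  Its values outside this range are irrelevant.
\<close>

record 'a scs =
  lev :: "nat \<Rightarrow> 'a set"
  cof :: "nat \<Rightarrow> nat \<Rightarrow> 'a \<Rightarrow> 'a"

definition is_scs :: "'a scs \<Rightarrow> bool" where
  "is_scs S \<longleftrightarrow>
     (\<forall>n i. i \<le> n \<longrightarrow> cof S n i ` lev S n \<subseteq> lev S (Suc n) \<and> inj_on (cof S n i) (lev S n)) \<and>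
     (\<forall>n i j x. i < j \<and> j \<le> Suc n \<and> x \<in> lev S n \<longrightarrow>
        cof S (Suc n) j (cof S n i x) = cof S (Suc n) i (cof S n (j - 1) x))"

subsection \<open>The union of the tower and the partial shifts\<close>

text \<open>
  The top coface maps are not assumed to be literal inclusions.  Regarding them as inclusions
  and taking the union of the tower means passing to the direct limit along them.
  \<open>push S n d\<close> is the composition of the top coface maps from \<open>lev S n\<close> to \<open>lev S (n + d)\<close>.
\<close>

primrec push :: "'a scs \<Rightarrow> nat \<Rightarrow> nat \<Rightarrow> 'a \<Rightarrow> 'a" where
  "push S n 0 x = x"
| "push S n (Suc d) x = cof S (n + d) (n + d) (push S n d x)"

definition lim_rel :: "'a scs \<Rightarrow> ((nat \<times> 'a) \<times> (nat \<times> 'a)) set" where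
  "lim_rel S = {((n, x), (m, z)). x \<in> lev S n \<and> z \<in> lev S m \<and>
     (\<exists>d e. n + d = m + e \<and> push S n d x = push S m e z)}"

definition germ :: "'a scs \<Rightarrow> nat \<Rightarrow> 'a \<Rightarrow> (nat \<times> 'a) set" where
  "germ S n x = lim_rel S `` {(n, x)}"

text \<open>\<open>tower S n\<close> is $Y_{n-1}$ as a subset of $Y_\infty$.\<close>

definition tower :: "'a scs \<Rightarrow> nat \<Rightarrow> (nat \<times> 'a) set set" where
  "tower S n = germ S n ` lev S n"

definition Yinf :: "'a scs \<Rightarrow> (nat \<times> 'a) set set" where
  "Yinf S = (\<Union>n. tower S n)"

definition pshift :: "'a scs \<Rightarrow> nat \<Rightarrow> (nat \<times> 'a) set \<Rightarrow> (nat \<times> 'a) set" where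
  "pshift S n y = (THE z. \<exists>m\<ge>n. \<exists>x\<in>lev S m. y = germ S m x \<and> z = germ S (Suc m) (cof S m n x))"

definition scs_saturated :: "'a scs \<Rightarrow> bool" where
  "scs_saturated S \<longleftrightarrow> (\<forall>n. tower S n = {y \<in> Yinf S. pshift S n y = y})"

subsection \<open>Sub-SCSs, isomorphisms, embeddings\<close>

text \<open>
  A sub-SCS is represented with the same coface functions on the ambient type, so that it is
  determined by its levels and sub-SCSs can be counted.
\<close>

definition sub_scs :: "'a scs \<Rightarrow> 'a scs \<Rightarrow> bool" where
  "sub_scs T S \<longleftrightarrow> is_scs T \<and> (\<forall>n. lev T n \<subseteq> lev S n) \<and> cof T = cof S"

definition is_scs_iso :: "(nat \<Rightarrow> 'a \<Rightarrow> 'b) \<Rightarrow> 'a scs \<Rightarrow> 'b scs \<Rightarrow> bool" where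
  "is_scs_iso U S S' \<longleftrightarrow>
     (\<forall>n. bij_betw (U n) (lev S n) (lev S' n)) \<and>
     (\<forall>n i x. i \<le> n \<and> x \<in> lev S n \<longrightarrow> U (Suc n) (cof S n i x) = cof S' n i (U n x))"

definition scs_isomorphic :: "'a scs \<Rightarrow> 'b scs \<Rightarrow> bool" where
  "scs_isomorphic S S' \<longleftrightarrow> (\<exists>U. is_scs_iso U S S')"

definition scs_embedding :: "(nat \<Rightarrow> 'a \<Rightarrow> 'b) \<Rightarrow> 'a scs \<Rightarrow> 'b scs \<Rightarrow> bool" where
  "scs_embedding U S S' \<longleftrightarrow> (\<exists>T. sub_scs T S' \<and> is_scs_iso U S T)"

subsection \<open>Roots and order\<close>

definition innovation :: "'a scs \<Rightarrow> nat \<Rightarrow> (nat \<times> 'a) set set" where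
  "innovation S n = (case n of 0 \<Rightarrow> tower S 0 | Suc m \<Rightarrow> tower S (Suc m) - tower S m)"

definition is_root :: "'a scs \<Rightarrow> (nat \<times> 'a) set \<Rightarrow> bool" where
  "is_root S y \<longleftrightarrow> (\<exists>n. y \<in> innovation S n \<and>
     (\<forall>m i. n = Suc m \<and> i \<le> m \<longrightarrow> y \<notin> pshift S i ` tower S m))"

definition roots :: "'a scs \<Rightarrow> (nat \<times> 'a) set set" where
  "roots S = {y. is_root S y}"

definition scs_le :: "'a scs \<Rightarrow> (nat \<times> 'a) set \<Rightarrow> (nat \<times> 'a) set \<Rightarrow> bool" where
  "scs_le S y y' \<longleftrightarrow> (\<exists>is. y' = fold (pshift S) is y)"

section \<open>Labels\<close>

text \<open>Labels are the finite sets of natural numbers, i.e. the sets of positions of ones.\<close>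

definition label_level :: "nat set \<Rightarrow> int" where
  "label_level v = (if v = {} then -1 else int (Max v))"

definition label_shift :: "nat \<Rightarrow> nat set \<Rightarrow> nat set" where
  "label_shift i v = {j. (j < i \<and> j \<in> v) \<or> (j > i \<and> j - 1 \<in> v)}"

definition label_le :: "nat set \<Rightarrow> nat set \<Rightarrow> bool" where
  "label_le u v \<longleftrightarrow> (\<exists>f :: nat \<Rightarrow> nat. strict_mono f \<and> v = f ` u)"

definition rank_labels :: "nat \<Rightarrow> nat set set" where
  "rank_labels k = {v. finite v \<and> card v = k}"

definition Lambda :: "nat \<Rightarrow> nat set scs" where
  "Lambda k = \<lparr>lev = (\<lambda>n. {v \<in> rank_labels k. label_level v \<le> int n - 1}),
               cof = (\<lambda>n i. label_shift i)\<rparr>"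

definition Lambda_above :: "nat \<Rightarrow> nat set \<Rightarrow> nat set scs" where
  "Lambda_above k u = (Lambda k)\<lparr>lev := (\<lambda>n. {v \<in> lev (Lambda k) n. label_le u v})\<rparr>"

definition normal_label :: "'a scs \<Rightarrow> (nat \<times> 'a) set \<Rightarrow> nat set" where
  "normal_label S y = {n. pshift S n y \<noteq> pshift S (Suc n) y}"

definition normal_rank :: "'a scs \<Rightarrow> (nat \<times> 'a) set \<Rightarrow> nat" where
  "normal_rank S y = card (normal_label S y)"

section \<open>Normality\<close>

text \<open>$\ell^2(A)$ is realised by complex functions on the ambient type vanishing outside \<open>A\<close>.\<close>

definition ell2 :: "'a set \<Rightarrow> ('a \<Rightarrow> complex) set" where
  "ell2 A = {f. (\<forall>x. x \<notin> A \<longrightarrow> f x = 0) \<and> (\<lambda>x. (cmod (f x))\<^sup>2) summable_on A}"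

definition ell2_inner :: "'a set \<Rightarrow> ('a \<Rightarrow> complex) \<Rightarrow> ('a \<Rightarrow> complex) \<Rightarrow> complex" where
  "ell2_inner A f g = (\<Sum>\<^sub>\<infinity>x\<in>A. cnj (f x) * g x)"

text \<open>
  The isometry extending an injective map \<open>d\<close> of the canonical bases, that is,
  $\sum_x f(x) e_x \mapsto \sum_x f(x) e_{d(x)}$.  The sum below has at most one summand.
\<close>

definition ell2_map :: "'a set \<Rightarrow> ('a \<Rightarrow> 'b) \<Rightarrow> ('a \<Rightarrow> complex) \<Rightarrow> ('b \<Rightarrow> complex)" where
  "ell2_map A d f = (\<lambda>z. \<Sum>x\<in>{x \<in> A. d x = z}. f x)"

definition ell2_adjoint ::
  "'a set \<Rightarrow> 'b set \<Rightarrow> (('a \<Rightarrow> complex) \<Rightarrow> ('b \<Rightarrow> complex)) \<Rightarrow> ('b \<Rightarrow> complex) \<Rightarrow> ('a \<Rightarrow> complex)" where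
  "ell2_adjoint A B V g =
     (THE h. h \<in> ell2 A \<and> (\<forall>f\<in>ell2 A. ell2_inner B (V f) g = ell2_inner A f h))"

definition hcof :: "'a scs \<Rightarrow> nat \<Rightarrow> nat \<Rightarrow> ('a \<Rightarrow> complex) \<Rightarrow> ('a \<Rightarrow> complex)" where
  "hcof S n i = ell2_map (lev S n) (cof S n i)"

definition hcof_adj :: "'a scs \<Rightarrow> nat \<Rightarrow> nat \<Rightarrow> ('a \<Rightarrow> complex) \<Rightarrow> ('a \<Rightarrow> complex)" where
  "hcof_adj S n i = ell2_adjoint (lev S n) (lev S (Suc n)) (hcof S n i)"

text \<open>With the index shift, \<open>lev S (Suc k)\<close> is $Y_k$, so both sides are maps on $\ell^2(Y_k)$.\<close>

definition scs_normal :: "'a scs \<Rightarrow> bool" where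
  "scs_normal S \<longleftrightarrow> (\<forall>k i j. i < j \<and> j \<le> Suc k \<longrightarrow>
     (\<forall>f\<in>ell2 (lev S (Suc k)).
        hcof S k (j - 1) (hcof_adj S k i f) = hcof_adj S (Suc k) i (hcof S (Suc k) j f)))"

section \<open>Layers\<close>

definition layer_decomposition :: "'a scs \<Rightarrow> 'a scs set \<Rightarrow> bool" where
  "layer_decomposition S \<L> \<longleftrightarrow>
     (\<forall>L\<in>\<L>. sub_scs L S \<and> scs_saturated L \<and> scs_normal L \<and> (\<exists>y. roots L = {y})) \<and>
     (\<forall>n. lev S n = (\<Union>L\<in>\<L>. lev L n)) \<and>
     (\<forall>n. \<forall>L\<in>\<L>. \<forall>L'\<in>\<L>. L \<noteq> L' \<longrightarrow> lev L n \<inter> lev L' n = {})"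

definition layers :: "'a scs \<Rightarrow> 'a scs set" where
  "layers S = (THE \<L>. layer_decomposition S \<L>)"

section \<open>Normal extensions\<close>

text \<open>Extensions may live on a different type, hence the inclusion is an embedding \<open>\<iota>\<close>.\<close>

definition normal_extension :: "'a scs \<Rightarrow> 'b scs \<Rightarrow> (nat \<Rightarrow> 'a \<Rightarrow> 'b) \<Rightarrow> bool" where
  "normal_extension S N \<iota> \<longleftrightarrow>
     is_scs N \<and> scs_saturated N \<and> scs_normal N \<and> scs_embedding \<iota> S N"

text \<open>
  HOL cannot quantify over types inside a formula.  In the definition of minimality, the
  competing extensions therefore range over a fixed type, which depends only on the type of
  elements of the given SCS.  It has room for a copy of some $\Lambda_k$ for each element of
  the SCS (the first component indexes the copies), hence for a copy of the union of those
  layers of an arbitrary normal extension which meet the SCS.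
\<close>

type_synonym 'a ext_elem = "(nat \<times> 'a) \<times> nat set"

definition minimal_normal_extension :: "'a scs \<Rightarrow> 'b scs \<Rightarrow> (nat \<Rightarrow> 'a \<Rightarrow> 'b) \<Rightarrow> bool" where
  "minimal_normal_extension S N \<iota> \<longleftrightarrow> normal_extension S N \<iota> \<and>
     (\<forall>(N' :: 'a ext_elem scs) \<iota>'. normal_extension S N' \<iota>' \<longrightarrow>
        (\<exists>g. scs_embedding g N N' \<and> (\<forall>n. \<forall>x\<in>lev S n. g n (\<iota> n x) = \<iota>' n x)))"

definition layer_labels :: "'a scs \<Rightarrow> (nat \<Rightarrow> 'a \<Rightarrow> 'b) \<Rightarrow> 'b scs \<Rightarrow> nat set set" where
  "layer_labels S \<iota> L =
     {normal_label S y |y. y \<in> roots S \<and> (\<exists>n. \<exists>x\<in>lev S n. y = germ S n x \<and> \<iota> n x \<in> lev L n)}"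

end

theory Submission
  imports Defs "HOL-Library.Multiset"
begin

text \<open>
  Everything is read off from the union \<open>Y\<close> of the tower with its partial shifts, for which
  saturation says that the \<open>n\<close>-th level consists of the elements whose normal label is contained in
  \<open>{..<n}\<close>.  A partial shift acts on an element only through the number \<open>j\<close> of ones of the label that
  precede the inserted zero.  The resulting operators \<open>ins j\<close> commute and are injective, and together
  with the label, which records how often each of them has been applied, they show that two elements
  with a common descendant and with the same label are equal.  So each class of elements with common
  descendants embeds into some \<open>Lambda k\<close> by its labels.

  Normality means that an element whose label vanishes at \<open>n\<close> is an \<open>n\<close>-th shift, and then every class
  exhausts its \<open>Lambda k\<close>.  The minimal normal extension fills up each class.  Finiteness of
  the sets of root labels is Dickson's lemma, and an SCS is recovered from its root labels since
  \<open>label_le\<close> between labels of one class is reachability by partial shifts.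
\<close>

section \<open>Labels and their gaps\<close>

text \<open>Words of partial shifts are hard to cancel in: a word is far from determined by its
  effect, and two positions may act alike on one element and differently on another. Counting ones
  instead of positions turns the action on elements of rank k into an action of the additive monoid
  of multisets over \<open>{..<k}\<close>, that is N^k, and \<open>gaps\<close> of the label is an
  N^k-valued coordinate that moves by exactly the multiset applied. So the action is free,
  confluence is commutativity of addition, \<open>Lambda k\<close> is N^k with its product order,
  and roots are the minimal points of a class.

  Three claims rest on one construction, \<open>pshifts_glue\<close>: the invariant of normal SCSs,
  the embedding of a minimal normal extension into any other one, and the final invariant. They
  differ only in how classes are paired and why the labels needed are available.

  A further obstacle is that minimality compares only extensions over one fixed type. It is
  therefore traded for \<open>tight_extension\<close>, which mentions no competitor and so yields
  statements about extensions over arbitrary types.\<close>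

definition skip :: "nat \<Rightarrow> nat \<Rightarrow> nat" where
  "skip i p = (if p < i then p else Suc p)"

lemma strict_mono_skip: "strict_mono (skip i)"
  by (auto simp: strict_mono_def skip_def)

lemma inj_skip: "inj (skip i)"
  by (simp add: strict_mono_skip strict_mono_imp_inj_on)

lemma label_shift_eq_image: "label_shift i v = skip i ` v"
proof -
  have "x \<in> skip i ` v" if "x \<in> label_shift i v" for x
  proof (cases "x < i")
    case True
    then show ?thesis using that by (auto simp: label_shift_def skip_def image_iff intro!: bexI[of _ x])
  next
    case False
    then have "x > i" "x - 1 \<in> v" using that by (auto simp: label_shift_def)
    then show ?thesis by (auto simp: skip_def image_iff intro!: bexI[of _ "x - 1"])
  qed
  then show ?thesis by (auto simp: label_shift_def skip_def)
qed

lemma not_in_label_shift: "i \<notin> label_shift i v"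
  by (auto simp: label_shift_def)

lemma skip_in_label_shift: "skip i p \<in> label_shift i v \<longleftrightarrow> p \<in> v"
  by (simp add: label_shift_eq_image inj_image_mem_iff inj_skip)

lemma skip_surj: "p \<noteq> i \<Longrightarrow> \<exists>q. p = skip i q"
  by (rule exI[of _ "if p < i then p else p - 1"]) (auto simp: skip_def)

lemma finite_label_shift [simp]: "finite (label_shift i v) \<longleftrightarrow> finite v"
  by (simp add: label_shift_eq_image finite_image_iff inj_on_subset[OF inj_skip])

lemma card_label_shift [simp]: "card (label_shift i v) = card v"
  by (simp add: label_shift_eq_image card_image inj_on_subset[OF inj_skip])

lemma inj_label_shift: "inj (label_shift i)"
  by (rule injI) (metis inj_image_eq_iff inj_skip label_shift_eq_image)

lemma skip_skip: "i < j \<Longrightarrow> skip j (skip i p) = skip i (skip (j - 1) p)"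
  by (auto simp: skip_def)

lemma label_shift_label_shift:
  "i < j \<Longrightarrow> label_shift j (label_shift i v) = label_shift i (label_shift (j - 1) v)"
  by (simp add: label_shift_eq_image image_image skip_skip)

text \<open>A one at or after position \<open>n\<close> would push the maximum of the label up by
  one; this is where finiteness enters.\<close>

lemma label_shift_fixed_iff: "finite v \<Longrightarrow> label_shift n v = v \<longleftrightarrow> v \<subseteq> {..<n}"
proof
  assume f: "finite v" and e: "label_shift n v = v"
  show "v \<subseteq> {..<n}"
  proof (rule ccontr)
    assume "\<not> v \<subseteq> {..<n}"
    then obtain p where p: "p \<in> v" "n \<le> p" by (meson lessThan_iff not_le subsetI)
    then have "n \<le> Max v" and m: "Max v \<in> v" using f by (auto intro: Max_in order_trans[OF p(2)] Max_ge)
    then have "Suc (Max v) \<in> label_shift n v" by (auto simp: label_shift_def)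
    then show False using e f Max_ge by (metis Suc_n_not_le_n)
  qed
next
  assume "v \<subseteq> {..<n}"
  then show "label_shift n v = v" by (force simp: label_shift_eq_image skip_def image_iff)
qed

text \<open>Inserting a zero just before or just after entry \<open>n\<close> gives the same result
  precisely when this entry is itself a zero. It makes every label its own normal label.\<close>

lemma label_shift_Suc_eq_iff: "label_shift n v = label_shift (Suc n) v \<longleftrightarrow> n \<notin> v"
proof
  show "label_shift n v = label_shift (Suc n) v \<Longrightarrow> n \<notin> v"
    by (auto simp: label_shift_def set_eq_iff)
next
  assume n: "n \<notin> v"
  have "skip n p = skip (Suc n) p" if "p \<in> v" for p
    using that n by (cases "p = n") (auto simp: skip_def)
  then show "label_shift n v = label_shift (Suc n) v"
    by (simp add: label_shift_eq_image cong: image_cong)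
qed

lemma label_shift_surj: "i \<notin> v \<Longrightarrow> \<exists>w. v = label_shift i w"
\<comment> \<open>The witness is the label with the entry at \<open>i\<close> deleted.\<close>
proof (rule exI[of _ "{p. skip i p \<in> v}"], rule set_eqI)
  fix p assume i: "i \<notin> v"
  show "p \<in> v \<longleftrightarrow> p \<in> label_shift i {p. skip i p \<in> v}"
  proof (cases "p = i")
    case False
    then obtain q where "p = skip i q" using skip_surj by blast
    then show ?thesis by (simp add: skip_in_label_shift)
  qed (simp add: i not_in_label_shift)
qed

definition ones_below :: "nat set \<Rightarrow> nat \<Rightarrow> nat" where
  "ones_below v i = card (v \<inter> {..<i})"

lemma ones_below_mono: "i \<le> j \<Longrightarrow> ones_below v i \<le> ones_below v j"
  unfolding ones_below_def by (rule card_mono) auto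

lemma ones_below_eqD:
  assumes "i \<le> j" "ones_below v i = ones_below v j"
  shows "v \<inter> {i..<j} = {}"
proof -
  have "v \<inter> {..<i} = v \<inter> {..<j}"
    using assms unfolding ones_below_def by (intro card_subset_eq) auto
  moreover have "v \<inter> {i..<j} \<subseteq> v \<inter> {..<j} - v \<inter> {..<i}" by auto
  ultimately show ?thesis by blast
qed

lemma ones_below_Suc: "ones_below v (Suc i) = ones_below v i + (if i \<in> v then 1 else 0)"
proof -
  have "v \<inter> {..<Suc i} = (if i \<in> v then insert i (v \<inter> {..<i}) else v \<inter> {..<i})"
    by (auto simp: less_Suc_eq)
  then show ?thesis unfolding ones_below_def by simp
qed

lemma ones_below_less_card_iff: "finite v \<Longrightarrow> ones_below v i < card v \<longleftrightarrow> (\<exists>q\<in>v. i \<le> q)"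
proof
  assume f: "finite v" and "ones_below v i < card v"
  then have "\<not> v \<subseteq> {..<i}" by (auto simp: ones_below_def Int_absorb2)
  then show "\<exists>q\<in>v. i \<le> q" by (meson lessThan_iff not_le subsetI)
next
  assume f: "finite v" and "\<exists>q\<in>v. i \<le> q"
  then obtain q where "q \<in> v" "q \<notin> v \<inter> {..<i}" by force
  then have "v \<inter> {..<i} \<subset> v" by blast
  then show "ones_below v i < card v" unfolding ones_below_def using f by (rule psubset_card_mono[rotated])
qed

lemma ones_below_label_shift_le: "j \<le> i \<Longrightarrow> ones_below (label_shift i v) j = ones_below v j"
  unfolding ones_below_def by (rule arg_cong[of _ _ card]) (auto simp: label_shift_def)

text \<open>Entry \<open>j\<close> moves to \<open>skip i j\<close>, and the inserted zero adds no
  one to the count.\<close>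

lemma ones_below_label_shift_skip: "ones_below (label_shift i v) (skip i j) = ones_below v j"
proof (cases "j < i")
  case True
  then show ?thesis by (simp add: skip_def ones_below_label_shift_le)
next
  case False
  have "label_shift i v \<inter> {..<Suc j} = skip i ` (v \<inter> {..<j})"
    using False by (auto simp: label_shift_eq_image skip_def split: if_splits)
  then have "card (label_shift i v \<inter> {..<Suc j}) = card (v \<inter> {..<j})"
    by (simp only: card_image inj_on_subset[OF inj_skip subset_UNIV])
  then show ?thesis using False by (simp add: skip_def ones_below_def)
qed

text \<open>The count starts at 0 and never jumps by more than one: the induction step moves just
  behind the next one of the label.\<close>

lemma ex_ones_below:
  assumes "finite v" "j \<le> card v"
  shows "\<exists>i. ones_below v i = j"
  using assms(2)
proof (induction j)
  case 0
  show ?case by (rule exI[of _ 0]) (simp add: ones_below_def)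
next
  case (Suc j)
  then obtain i where i: "ones_below v i = j" by auto
  then have "\<exists>q. q \<in> v \<and> i \<le> q" using Suc.prems ones_below_less_card_iff[OF assms(1), of i] by auto
  then obtain p where p: "p \<in> v" "i \<le> p" and least: "\<And>q. q \<in> v \<Longrightarrow> i \<le> q \<Longrightarrow> p \<le> q"
    using exists_least_iff[of "\<lambda>q. q \<in> v \<and> i \<le> q"] by (meson not_le)
  have "v \<inter> {..<p} = v \<inter> {..<i}"
  proof (intro equalityI subsetI)
    fix q assume "q \<in> v \<inter> {..<p}"
    then show "q \<in> v \<inter> {..<i}" using least[of q] by (cases "i \<le> q") auto
  qed (use p in auto)
  then have "ones_below v (Suc p) = Suc j" using i p by (simp add: ones_below_Suc, simp add: ones_below_def)
  then show ?case by blast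
qed

text \<open>A label is encoded by its rank together with the multiset of its inner zeros, each of them
  recorded by the number of ones below it.\<close>

definition gaps :: "nat set \<Rightarrow> nat multiset" where
  "gaps v = image_mset (ones_below v) (mset_set {p. p \<notin> v \<and> (\<exists>q\<in>v. p < q)})"

text \<open>The inner zeros of the new label are the inserted one, inner because a one still follows
  it, and the shifted old ones, whose numbers of preceding ones are unchanged. The hypothesis
  excludes a zero behind all ones, which would leave the label as it is.\<close>

lemma gaps_label_shift:
  assumes f: "finite v" and i: "ones_below v i < card v"
  shows "gaps (label_shift i v) = add_mset (ones_below v i) (gaps v)"
proof -
  define Z where "Z v = {p. p \<notin> v \<and> (\<exists>q\<in>v. p < q)}" for v :: "nat set"
  have fin: "finite (Z w)" if "finite w" for w
    by (rule finite_subset[of _ "{..Max w}"]) (use that in \<open>auto simp: Z_def intro: order.trans[OF less_imp_le] Max_ge\<close>)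
  obtain q where q: "q \<in> v" "i \<le> q" using i ones_below_less_card_iff[OF f] by auto
  have "Z (label_shift i v) = insert i (skip i ` Z v)"
  proof (intro set_eqI iffI)
    fix p assume p: "p \<in> Z (label_shift i v)"
    show "p \<in> insert i (skip i ` Z v)"
    proof (cases "p = i")
      case False
      then obtain p' where p': "p = skip i p'" using skip_surj by blast
      then have "p' \<in> Z v" using p
        by (auto simp: Z_def skip_in_label_shift) (auto simp: label_shift_eq_image strict_mono_less[OF strict_mono_skip])
      then show ?thesis using p' by auto
    qed simp
  next
    fix p assume "p \<in> insert i (skip i ` Z v)"
    then consider "p = i" | p' where "p' \<in> Z v" "p = skip i p'" by auto
    then show "p \<in> Z (label_shift i v)"
    proof cases
      case 1
      have "skip i q \<in> label_shift i v" using q by (simp add: skip_in_label_shift)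
      moreover have "i < skip i q" using q by (simp add: skip_def)
      ultimately show ?thesis using 1 by (auto simp: Z_def not_in_label_shift)
    next
      case 2
      then obtain q where "q \<in> v" "p' < q" by (auto simp: Z_def)
      then have "skip i q \<in> label_shift i v" "skip i p' < skip i q"
        by (auto simp: skip_in_label_shift strict_mono_less[OF strict_mono_skip])
      then show ?thesis using 2 by (auto simp: Z_def skip_in_label_shift)
    qed
  qed
  moreover have "i \<notin> skip i ` Z v" by (auto simp: skip_def split: if_splits)
  ultimately have "mset_set (Z (label_shift i v)) = add_mset i (image_mset (skip i) (mset_set (Z v)))"
    using fin[OF f] by (simp add: image_mset_mset_set inj_on_subset[OF inj_skip])
  then show ?thesis
    by (simp add: gaps_def Z_def[symmetric] ones_below_label_shift_le ones_below_label_shift_skip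
        multiset.map_comp o_def)
qed

lemma label_le_refl: "label_le u u"
  unfolding label_le_def by (rule exI[of _ id]) (simp add: strict_mono_def)

lemma label_le_trans: "label_le u v \<Longrightarrow> label_le v w \<Longrightarrow> label_le u w"
  unfolding label_le_def by (metis image_comp strict_mono_o)

lemma label_le_label_shift: "label_le v (label_shift i v)"
  unfolding label_le_def label_shift_eq_image using strict_mono_skip by blast

lemma label_le_fold_label_shift: "label_le v (fold label_shift is v)"
proof (induction "is" arbitrary: v)
  case Nil
  show ?case by (simp add: label_le_refl)
next
  case (Cons i "is")
  show ?case using label_le_trans[OF label_le_label_shift Cons.IH] by simp
qed

text \<open>Dominance is reachability by insertions of zeros. If \<open>p\<close> is the first point
  moved by \<open>f\<close>, then \<open>f\<close> factors through \<open>skip p\<close>, and the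
  remaining factor displaces the ones by a smaller total amount; this total is the induction
  measure.\<close>

lemma label_le_obtain_shifts:
  assumes "finite u" "label_le u v"
  obtains "is" where "v = fold label_shift is u"
proof -
  obtain f where f: "strict_mono f" "v = f ` u" using assms(2) by (auto simp: label_le_def)
  have "\<exists>is. f ` u = fold label_shift is u" if "finite u" "strict_mono f" for u f
    using that
  proof (induction "\<Sum>q\<in>u. f q - q" arbitrary: u f rule: less_induct)
    case less
    show ?case
    proof (cases "\<forall>q\<in>u. f q = q")
      case True
      then show ?thesis by (intro exI[of _ "[]"]) simp
    next
      case False
      have ge: "q \<le> f q" for q using less.prems(2) by (simp add: strict_mono_imp_increasing)
      define p where "p = (LEAST p. f p \<noteq> p)"
      obtain q where q: "q \<in> u" "f q \<noteq> q" using False by auto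
      have p: "f p \<noteq> p" unfolding p_def using q(2) by (rule LeastI)
      have pq: "p \<le> q" unfolding p_def using q(2) by (rule Least_le)
      have below: "f r = r" if "r < p" for r using not_less_Least that unfolding p_def by blast
      have above: "Suc r \<le> f r" if "p \<le> r" for r
        using that
      proof (induction rule: dec_induct)
        case base then show ?case using p ge[of p] by simp
      next
        case (step r) then show ?case using less.prems(2) by (meson Suc_leI le_less_trans lessI strict_mono_def)
      qed
      \<comment> \<open>\<open>f\<close> fixes everything below \<open>p\<close> and misses the
        value \<open>p\<close>, so it factors through \<open>skip p\<close>; the argument
        \<open>p\<close>, which \<open>skip p\<close> omits, may be sent to
        \<open>p\<close>.\<close>
      define g where "g r = (if r \<le> p then r else f (r - 1))" for r
      have g_skip: "g (skip p r) = f r" for r by (auto simp: g_def skip_def below)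
      have g: "strict_mono g"
      proof (rule strict_monoI)
        fix r s :: nat assume rs: "r < s"
        show "g r < g s"
        proof (cases "s \<le> p")
          case False
          then have "s \<le> f (s - 1)" using above[of "s - 1"] by simp
          moreover have "f (r - 1) < f (s - 1)" if "p < r"
            using less.prems(2) that rs by (simp add: strict_mono_less)
          ultimately show ?thesis using False rs by (auto simp: g_def)
        qed (use rs in \<open>auto simp: g_def\<close>)
      qed
      have img: "g ` label_shift p u = f ` u" by (simp add: label_shift_eq_image image_image g_skip)
      have "(\<Sum>q\<in>label_shift p u. g q - q) = (\<Sum>q\<in>u. f q - skip p q)"
        by (simp add: label_shift_eq_image sum.reindex inj_on_subset[OF inj_skip] g_skip)
      also have "\<dots> < (\<Sum>q\<in>u. f q - q)"
      proof (rule sum_strict_mono_ex1)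
        show "\<forall>x\<in>u. f x - skip p x \<le> f x - x" by (auto simp: skip_def)
        show "\<exists>x\<in>u. f x - skip p x < f x - x"
          using q pq ge[of q] by (intro bexI[of _ q]) (auto simp: skip_def)
      qed (use less.prems in auto)
      finally obtain "is" where "g ` label_shift p u = fold label_shift is (label_shift p u)"
        using less.hyps[OF _ _ g] less.prems(1) by (metis finite_label_shift)
      then show ?thesis using img by (intro exI[of _ "p # is"]) simp
    qed
  qed
  then show ?thesis using that f assms(1) by metis
qed

section \<open>Partial shifts\<close>

text \<open>Abstracts \<open>Yinf S\<close> with \<open>pshift S\<close>; the last axiom reflects
  that every element lies in some level. Sets of labels and the filled-up classes of an SCS are
  further instances.\<close>

locale pshifts =
  fixes Y :: "'y set" and \<alpha> :: "nat \<Rightarrow> 'y \<Rightarrow> 'y"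
  assumes closed: "y \<in> Y \<Longrightarrow> \<alpha> n y \<in> Y"
    and inj: "inj_on (\<alpha> n) Y"
    and rel: "i < j \<Longrightarrow> y \<in> Y \<Longrightarrow> \<alpha> j (\<alpha> i y) = \<alpha> i (\<alpha> (j - 1) y)"
    and fin: "y \<in> Y \<Longrightarrow> \<exists>n. \<alpha> n y = y"
begin

definition lab :: "'y \<Rightarrow> nat set" where
  "lab y = {n. \<alpha> n y \<noteq> \<alpha> (Suc n) y}"

lemma alpha_eq_iff: "y \<in> Y \<Longrightarrow> z \<in> Y \<Longrightarrow> \<alpha> n y = \<alpha> n z \<longleftrightarrow> y = z"
  using inj by (meson inj_onD)

text \<open>If \<open>\<alpha> m y = y\<close>, then \<open>\<alpha> (Suc m) y = \<alpha> (Suc m)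
  (\<alpha> m y) = \<alpha> m (\<alpha> m y) = y\<close>.\<close>

lemma fixed_ge:
  assumes "y \<in> Y" "\<alpha> n y = y" "n \<le> m"
  shows "\<alpha> m y = y"
  using assms(3)
proof (induction rule: dec_induct)
  case (step m)
  then show ?case using rel[of m "Suc m" y] assms(1) by simp
qed (use assms in simp)

lemma alpha_eq:
  assumes "i \<le> j" "lab y \<inter> {i..<j} = {}"
  shows "\<alpha> i y = \<alpha> j y"
  using assms
proof (induction rule: dec_induct)
  case (step j)
  then have "j \<notin> lab y" "lab y \<inter> {i..<j} = {}" by auto
  then show ?case using step.IH by (simp add: lab_def)
qed simp

text \<open>Behind the last one of the label all shifts agree on \<open>y\<close>, and by the last
  axiom some of them fixes it.\<close>

lemma fixed_iff:
  assumes "y \<in> Y"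
  shows "\<alpha> n y = y \<longleftrightarrow> lab y \<subseteq> {..<n}"
proof
  assume "\<alpha> n y = y"
  then have "\<alpha> m y = y" if "n \<le> m" for m using fixed_ge[OF assms] that by blast
  then show "lab y \<subseteq> {..<n}" by (auto simp: lab_def) (metis le_Suc_eq not_le)
next
  assume l: "lab y \<subseteq> {..<n}"
  obtain m where m: "\<alpha> m y = y" using fin[OF assms] by blast
  have "\<alpha> n y = \<alpha> (max n m) y" by (rule alpha_eq) (use l in auto)
  also have "\<dots> = y" using fixed_ge[OF assms m] by simp
  finally show "\<alpha> n y = y" .
qed

lemma finite_lab: "y \<in> Y \<Longrightarrow> finite (lab y)"
  using fin fixed_iff by (meson finite_lessThan finite_subset)

text \<open>The relations move the shifts \<open>n\<close> and \<open>Suc n\<close> past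
  \<open>\<alpha> i\<close>, so that comparing them on \<open>\<alpha> i y\<close> becomes comparing
  at \<open>n\<close> or at \<open>n - 1\<close> on \<open>y\<close>. For \<open>n = i\<close> they
  force equality, which is the inserted zero.\<close>

lemma lab_alpha:
  assumes "y \<in> Y"
  shows "lab (\<alpha> i y) = label_shift i (lab y)"
proof (rule set_eqI)
  fix n
  consider "n < i" | "n = i" | "i < n" by linarith
  then show "n \<in> lab (\<alpha> i y) \<longleftrightarrow> n \<in> label_shift i (lab y)"
  proof cases
    case 1
    have "\<alpha> n (\<alpha> i y) = \<alpha> (Suc i) (\<alpha> n y)" "\<alpha> (Suc n) (\<alpha> i y) = \<alpha> (Suc i) (\<alpha> (Suc n) y)"
      using rel[of n "Suc i" y] rel[of "Suc n" "Suc i" y] 1 assms by auto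
    then show ?thesis using 1 assms by (auto simp: lab_def label_shift_def alpha_eq_iff closed)
  next
    case 2
    then show ?thesis using rel[of i "Suc i" y] assms by (auto simp: lab_def label_shift_def)
  next
    case 3
    have "\<alpha> n (\<alpha> i y) = \<alpha> i (\<alpha> (n - 1) y)" "\<alpha> (Suc n) (\<alpha> i y) = \<alpha> i (\<alpha> n y)"
      using rel[of i n y] rel[of i "Suc n" y] 3 assms by auto
    then show ?thesis using 3 assms by (auto simp: lab_def label_shift_def alpha_eq_iff closed)
  qed
qed

abbreviation rank :: "'y \<Rightarrow> nat" where "rank y \<equiv> card (lab y)"

lemma rank_alpha: "y \<in> Y \<Longrightarrow> rank (\<alpha> i y) = rank y"
  by (simp add: lab_alpha)

lemma fold_closed: "y \<in> Y \<Longrightarrow> fold \<alpha> is y \<in> Y"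
  by (induction "is" arbitrary: y) (auto simp: closed)

lemma lab_fold: "y \<in> Y \<Longrightarrow> lab (fold \<alpha> is y) = fold label_shift is (lab y)"
  by (induction "is" arbitrary: y) (auto simp: closed lab_alpha)

text \<open>Inserting a zero anywhere between two consecutive ones of the label has the same effect, so
  that the partial shifts reduce to the operators below, which are indexed by the number of ones
  preceding the inserted zero.  In contrast to the partial shifts they commute.\<close>

definition ins :: "nat \<Rightarrow> 'y \<Rightarrow> 'y" where
  "ins j y = (if y \<in> Y \<and> (\<exists>i. ones_below (lab y) i = j)
     then \<alpha> (SOME i. ones_below (lab y) i = j) y else y)"

lemma alpha_eq_ins:
  assumes "y \<in> Y"
  shows "\<alpha> i y = ins (ones_below (lab y) i) y"
proof -
  define i' where "i' = (SOME i'. ones_below (lab y) i' = ones_below (lab y) i)"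
  have "ones_below (lab y) i' = ones_below (lab y) i" unfolding i'_def by (rule someI) simp
  then have "\<alpha> i y = \<alpha> i' y"
    using alpha_eq[of i i' y] alpha_eq[of i' i y] ones_below_eqD by (metis nle_le)
  then show ?thesis using assms by (auto simp: ins_def i'_def)
qed

text \<open>For \<open>j\<close> equal to the rank the zero goes behind all ones, where shifts fix
  the element; a larger \<open>j\<close> is attained at no position.\<close>

lemma ins_trivial:
  assumes "rank y \<le> j"
  shows "ins j y = y"
proof (cases "y \<in> Y \<and> (\<exists>i. ones_below (lab y) i = j)")
  case True
  then obtain i where i: "ones_below (lab y) i = j" by auto
  have "\<not> ones_below (lab y) i < rank y" using i assms by simp
  then have "lab y \<subseteq> {..<i}" using ones_below_less_card_iff[of "lab y" i] finite_lab True by (auto simp: not_le)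
  then have "\<alpha> i y = y" using fixed_iff True by blast
  then show ?thesis using alpha_eq_ins[of y i] i True by metis
qed (simp only: ins_def if_False)

lemma obtain_ins:
  assumes "y \<in> Y" "j < rank y"
  obtains i where "ones_below (lab y) i = j" "ins j y = \<alpha> i y"
  using ex_ones_below[OF finite_lab[OF assms(1)], of j] alpha_eq_ins assms by (metis less_imp_le)

lemma ins_closed: "y \<in> Y \<Longrightarrow> ins j y \<in> Y"
  by (simp add: ins_def closed)

lemma rank_ins: "y \<in> Y \<Longrightarrow> rank (ins j y) = rank y"
  by (simp add: ins_def rank_alpha)

lemma gaps_ins:
  assumes "y \<in> Y" "j < rank y"
  shows "gaps (lab (ins j y)) = add_mset j (gaps (lab y))"
proof -
  obtain i where "ones_below (lab y) i = j" "ins j y = \<alpha> i y" using obtain_ins[OF assms] .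
  then show ?thesis using gaps_label_shift[OF finite_lab[OF assms(1)], of i] assms by (simp add: lab_alpha)
qed

text \<open>Equal images may come from shifts at different positions \<open>i \<le> i'\<close>. Both
  positions see \<open>j\<close> ones of the common image label, so no one lies between them,
  \<open>\<alpha> i\<close> may be replaced by \<open>\<alpha> i'\<close> on the first element, and
  injectivity of a single shift suffices.\<close>

lemma inj_on_ins: "inj_on (ins j) Y"
proof (rule inj_onI)
  have main: "y = z" if y: "y \<in> Y" "j < rank y" and z: "z \<in> Y" "j < rank z" and "i \<le> i'"
    and i: "ones_below (lab y) i = j" and i': "ones_below (lab z) i' = j" and e: "\<alpha> i y = \<alpha> i' z"
    for y z i i'
  proof -
    define w where "w = lab (\<alpha> i y)"
    have w: "w = label_shift i (lab y)" "w = label_shift i' (lab z)"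
      unfolding w_def using e y z by (metis lab_alpha)+
    have "ones_below w i = ones_below w i'"
      using i i' w ones_below_label_shift_le[of i i "lab y"] ones_below_label_shift_le[of i' i' "lab z"] by simp
    then have "w \<inter> {i..<i'} = {}" using ones_below_eqD \<open>i \<le> i'\<close> by blast
    moreover have "i' \<notin> w" using w(2) not_in_label_shift by blast
    \<comment> \<open>Position \<open>i'\<close> has to be included because ones of
      \<open>lab y\<close> from \<open>i\<close> on appear in \<open>w\<close> one place
      later.\<close>
    ultimately have *: "w \<inter> {i..<Suc i'} = {}" by (auto simp: less_Suc_eq)
    have "lab y \<inter> {i..<i'} = {}"
    proof (rule ccontr)
      assume "lab y \<inter> {i..<i'} \<noteq> {}"
      then obtain q where "q \<in> lab y" "i \<le> q" "q < i'" by auto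
      then have "Suc q \<in> w" "Suc q \<in> {i..<Suc i'}" by (auto simp: w(1) label_shift_def)
      then show False using * by blast
    qed
    then have "\<alpha> i y = \<alpha> i' y" using alpha_eq \<open>i \<le> i'\<close> by blast
    then show "y = z" using e y z by (simp add: alpha_eq_iff)
  qed
  fix y z assume y: "y \<in> Y" and z: "z \<in> Y" and e: "ins j y = ins j z"
  then have r: "rank y = rank z" using rank_ins by metis
  show "y = z"
  proof (cases "j < rank y")
    case False
    then show ?thesis using e r ins_trivial by simp
  next
    case True
    obtain i where i: "ones_below (lab y) i = j" "ins j y = \<alpha> i y" using obtain_ins[OF y True] .
    obtain i' where i': "ones_below (lab z) i' = j" "ins j z = \<alpha> i' z"
      using obtain_ins[OF z, of j] True r by auto
    show ?thesis using main[of y z i i'] main[of z y i' i] y z i i' True r e by (metis nle_le)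
  qed
qed

text \<open>For \<open>a < b\<close> the zeros go to positions \<open>i < j\<close>. Inserting the
  earlier zero first moves the later position to \<open>Suc j\<close>, and then the two sides are
  those of the relation between \<open>\<alpha> i\<close> and
  \<open>\<alpha> (Suc j)\<close>.\<close>

lemma ins_comm: "ins a (ins b y) = ins b (ins a y)"
proof -
  have main: "ins a (ins b y) = ins b (ins a y)" if ab: "a < b" and y: "y \<in> Y" and b: "b < rank y" for a b y
  proof -
    obtain j where j: "ones_below (lab y) j = b" "ins b y = \<alpha> j y" using obtain_ins[OF y b] .
    have "a < rank y" using ab b by simp
    then obtain i where i: "ones_below (lab y) i = a" "ins a y = \<alpha> i y"
      using obtain_ins[OF y] by blast
    have "i < j" using i(1) j(1) that(1) ones_below_mono[of j i "lab y"] by (cases "i < j") auto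
    have "ins a (\<alpha> j y) = \<alpha> i (\<alpha> j y)"
      using alpha_eq_ins[of "\<alpha> j y" i] that i \<open>i < j\<close> by (simp add: closed lab_alpha ones_below_label_shift_le)
    moreover have "ins b (\<alpha> i y) = \<alpha> (Suc j) (\<alpha> i y)"
      using alpha_eq_ins[of "\<alpha> i y" "Suc j"] that j \<open>i < j\<close> ones_below_label_shift_skip[of i "lab y" j]
      by (simp add: closed lab_alpha skip_def)
    moreover have "\<alpha> (Suc j) (\<alpha> i y) = \<alpha> i (\<alpha> j y)" using rel[of i "Suc j" y] \<open>i < j\<close> that by simp
    ultimately show ?thesis unfolding i(2) j(2) by (rule trans[OF _ sym, OF _ trans])
  qed
  show ?thesis
  proof (cases "y \<in> Y \<and> a < rank y \<and> b < rank y")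
    case True
    then show ?thesis using main[of a b y] main[of b a y] by (metis linorder_neqE_nat)
  next
    case False
    have "ins c (ins d y) = ins d (ins c y)" if "y \<in> Y" "rank y \<le> c" for c d
      using that ins_trivial rank_ins by metis
    moreover have "ins c y = y" if "y \<notin> Y" for c using that by (simp add: ins_def)
    ultimately show ?thesis using False by (metis not_le)
  qed
qed

text \<open>Folding over multisets asks for commutation on the whole type; this is why
  \<open>ins\<close> is the identity outside \<open>Y\<close> and for indices attained at no
  position.\<close>

sublocale comp_fun_commute ins
  by standard (simp add: fun_eq_iff ins_comm)

definition Ins :: "nat multiset \<Rightarrow> 'y \<Rightarrow> 'y" where
  "Ins M y = fold_mset ins y M"

lemma Ins_empty [simp]: "Ins {#} y = y"
  by (simp add: Ins_def)

lemma Ins_add: "Ins (add_mset j M) y = ins j (Ins M y)"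
  by (simp add: Ins_def)

lemma Ins_union: "Ins (M + N) y = Ins M (Ins N y)"
  by (simp add: Ins_def fold_mset_union add.commute[of M N])

lemma Ins_closed: "y \<in> Y \<Longrightarrow> Ins M y \<in> Y"
  by (induction M) (auto simp: Ins_add ins_closed)

lemma rank_Ins: "y \<in> Y \<Longrightarrow> rank (Ins M y) = rank y"
  by (induction M) (auto simp: Ins_add rank_ins Ins_closed)

lemma inj_on_Ins: "inj_on (Ins M) Y"
proof (induction M)
  case (add j M)
  have "Ins M ` Y \<subseteq> Y" using Ins_closed by blast
  then have "inj_on (ins j \<circ> Ins M) Y" using add inj_on_ins[of j] by (blast intro: comp_inj_on inj_on_subset)
  then show ?case by (simp add: o_def Ins_add[abs_def])
qed simp

text \<open>Makes the multiset applied, restricted to the indices that act at all, recoverable from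
  the labels before and after.\<close>

lemma gaps_Ins:
  "y \<in> Y \<Longrightarrow> gaps (lab (Ins M y)) = filter_mset (\<lambda>j. j < rank y) M + gaps (lab y)"
proof (induction M)
  case (add j M)
  then show ?case using gaps_ins[of "Ins M y" j] ins_trivial[of "Ins M y" j]
    by (auto simp: Ins_add rank_Ins Ins_closed not_less)
qed simp

lemma Ins_filter: "y \<in> Y \<Longrightarrow> Ins (filter_mset (\<lambda>j. j < rank y) M) y = Ins M y"
proof (induction M)
  case (add j M)
  then show ?case using ins_trivial[of "Ins M y" j] by (auto simp: Ins_add rank_Ins not_less)
qed simp

lemma fold_eq_Ins:
  assumes "y \<in> Y"
  shows "\<exists>M. fold \<alpha> is y = Ins M y"
  using assms
proof (induction "is" arbitrary: y)
  case Nil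
  show ?case by (rule exI[of _ "{#}"]) simp
next
  case (Cons i "is")
  then obtain M where "fold \<alpha> is (\<alpha> i y) = Ins M (\<alpha> i y)" using closed by blast
  also have "\<dots> = Ins (M + {#ones_below (lab y) i#}) y"
    using alpha_eq_ins[OF Cons.prems, of i] by (simp only: Ins_union) (simp add: Ins_add)
  finally show ?case by (simp only: fold_simps) blast
qed

lemma Ins_eq_fold:
  assumes "y \<in> Y"
  shows "\<exists>is. Ins M y = fold \<alpha> is y"
proof (induction M)
  case empty
  show ?case by (rule exI[of _ "[]"]) simp
next
  case (add j M)
  then obtain "is" where "is": "Ins M y = fold \<alpha> is y" by blast
  show ?case
  proof (cases "j < rank (Ins M y)")
    case False
    then show ?thesis using "is" ins_trivial by (auto simp: Ins_add)
  next
    case True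
    then obtain i where "ins j (Ins M y) = \<alpha> i (Ins M y)" using obtain_ins[OF Ins_closed[OF assms]] by blast
    then show ?thesis using "is" by (intro exI[of _ "is @ [i]"]) (simp add: Ins_add)
  qed
qed

text \<open>The classes of this relation are the connected components of the system. For a normal
  SCS they become the layers.\<close>

definition linked :: "'y \<Rightarrow> 'y \<Rightarrow> bool" where
  "linked y z \<longleftrightarrow> y \<in> Y \<and> z \<in> Y \<and> (\<exists>M N. Ins M y = Ins N z)"

lemma linked_refl: "y \<in> Y \<Longrightarrow> linked y y"
  by (auto simp: linked_def)

lemma linked_sym: "linked y z \<Longrightarrow> linked z y"
  unfolding linked_def by metis

text \<open>Confluence: the multisets applied to \<open>y\<close> on either side commute, so the two
  common descendants have a common descendant.\<close>

lemma linked_trans: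
  assumes "linked x y" "linked y z"
  shows "linked x z"
proof -
  obtain M N M' N' where *: "Ins M x = Ins N y" "Ins M' y = Ins N' z" using assms by (auto simp: linked_def)
  have "Ins (M' + M) x = Ins (N + N') z"
    by (simp add: Ins_union * flip: *(2)) (simp add: Ins_union[symmetric] add.commute)
  then show ?thesis using assms unfolding linked_def by blast
qed

lemma linked_Ins: "y \<in> Y \<Longrightarrow> linked y (Ins M y)"
  unfolding linked_def using Ins_closed by (metis Ins_empty)

lemma linked_fold: "y \<in> Y \<Longrightarrow> linked y (fold \<alpha> is y)"
  using fold_eq_Ins linked_Ins by metis

lemma linked_alpha: "y \<in> Y \<Longrightarrow> linked y (\<alpha> i y)"
  using linked_fold[of y "[i]"] by simp

lemma linked_rank: "linked y z \<Longrightarrow> rank y = rank z"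
  unfolding linked_def using rank_Ins by metis

text \<open>Equal labels force the two multisets leading to the common descendant to agree below the
  rank, where alone they act; the injective operator is then cancelled.\<close>

lemma linked_lab_eq:
  assumes "linked y z" "lab y = lab z"
  shows "y = z"
proof -
  obtain M N where e: "Ins M y = Ins N z" and Y: "y \<in> Y" "z \<in> Y" using assms by (auto simp: linked_def)
  let ?f = "filter_mset (\<lambda>j. j < rank y)"
  have "?f M = ?f N" using e gaps_Ins[of y M] gaps_Ins[of z N] Y assms(2) by simp
  moreover have "Ins (?f M) y = Ins (?f N) z" using e Ins_filter[of y M] Ins_filter[of z N] Y assms(2) by simp
  ultimately show ?thesis using inj_on_Ins Y by (metis inj_onD)
qed

text \<open>The insertions that turn one label into the other, performed on \<open>y\<close>, lead
  to an element linked to \<open>z\<close> and with the label of \<open>z\<close>, hence to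
  \<open>z\<close>.\<close>

lemma linked_label_le_iff:
  assumes "linked y z"
  shows "label_le (lab y) (lab z) \<longleftrightarrow> (\<exists>is. z = fold \<alpha> is y)"
proof
  have y: "y \<in> Y" using assms by (simp add: linked_def)
  assume "label_le (lab y) (lab z)"
  then obtain "is" where "lab z = fold label_shift is (lab y)" using label_le_obtain_shifts finite_lab y by metis
  then have "lab z = lab (fold \<alpha> is y)" using lab_fold y by simp
  moreover have "linked z (fold \<alpha> is y)" using assms linked_fold y linked_sym linked_trans by metis
  ultimately show "\<exists>is. z = fold \<alpha> is y" using linked_lab_eq by blast
next
  assume "\<exists>is. z = fold \<alpha> is y"
  then show "label_le (lab y) (lab z)" using assms lab_fold label_le_fold_label_shift by (auto simp: linked_def)
qed

text \<open>Free of levels, unlike \<open>is_root\<close>; for saturated SCSs the two agree by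
  \<open>is_root_iff\<close>. The conclusion \<open>z = y\<close> tolerates the shifts that fix
  \<open>y\<close>.\<close>

definition root :: "'y \<Rightarrow> bool" where
  "root y \<longleftrightarrow> y \<in> Y \<and> (\<forall>i. \<forall>z\<in>Y. y = \<alpha> i z \<longrightarrow> z = y)"

text \<open>Undoing a shift that moves an element removes one inner zero from the label, so the
  descent ends.\<close>

lemma obtain_root:
  assumes "y \<in> Y"
  obtains r "is" where "root r" "y = fold \<alpha> is r" "linked r y"
proof -
  have "\<exists>r is. root r \<and> y = fold \<alpha> is r"
    using assms
  proof (induction "size (gaps (lab y))" arbitrary: y rule: less_induct)
    case less
    show ?case
    proof (cases "root y")
      case True
      then show ?thesis by (intro exI[of _ y] exI[of _ "[]"]) simp
    next
      case False
      then obtain i z where z: "z \<in> Y" "y = \<alpha> i z" "z \<noteq> y" using less.prems by (auto simp: root_def)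
      define j where "j = ones_below (lab z) i"
      have y: "y = ins j z" using alpha_eq_ins z j_def by simp
      then have "j < rank z" using ins_trivial[of z j] z by force
      then have "size (gaps (lab z)) < size (gaps (lab y))" using gaps_ins[of z j] y z by simp
      then obtain r "is" where "root r" "z = fold \<alpha> is r" using less.hyps z by blast
      then show ?thesis using z by (intro exI[of _ r] exI[of _ "is @ [i]"]) simp
    qed
  qed
  then show thesis using that linked_fold by (metis root_def)
qed

lemma root_fold:
  assumes "y \<in> Y" "root (fold \<alpha> is y)"
  shows "fold \<alpha> is y = y"
  using assms(2)
proof (induction "is" rule: rev_induct)
  case (snoc i "is")
  have "fold \<alpha> is y \<in> Y" using fold_closed assms by blast
  then have "fold \<alpha> is y = fold \<alpha> (is @ [i]) y" using snoc.prems by (auto simp: root_def)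
  then show ?case using snoc by simp
qed simp

text \<open>What normality becomes on the union of the tower: every zero of a label can be removed
  by undoing a shift. See \<open>scs_normal_iff\<close>.\<close>

definition normal :: bool where
  "normal \<longleftrightarrow> (\<forall>y\<in>Y. \<forall>n. n \<notin> lab y \<longrightarrow> y \<in> \<alpha> n ` Y)"

text \<open>A zero at \<open>n\<close> makes the root an \<open>n\<close>-th shift, necessarily of
  itself, so no one follows this zero. A finite label in which no one follows a zero is an initial
  segment.\<close>

lemma normal_root_lab:
  assumes normal "root r"
  shows "lab r = {..<rank r}"
proof -
  have r: "r \<in> Y" using assms(2) by (simp add: root_def)
  have "lab r \<subseteq> {..<n}" if n: "n \<notin> lab r" for n
  proof -
    obtain z where z: "z \<in> Y" "r = \<alpha> n z" using n assms(1) r by (auto simp: normal_def)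
    then have "z = r" using assms(2) unfolding root_def by blast
    then have "\<alpha> n r = r" using z by simp
    then show ?thesis using fixed_iff r by blast
  qed
  then have down: "m \<in> lab r" if "n \<in> lab r" "m \<le> n" for m n using that by fastforce
  define m where "m = (LEAST m. m \<notin> lab r)"
  have "\<exists>m. m \<notin> lab r" using finite_lab[OF r] infinite_UNIV_nat by (metis UNIV_eq_I)
  then have "m \<notin> lab r" unfolding m_def by (rule LeastI_ex)
  moreover have "n \<in> lab r" if "n < m" for n using that not_less_Least unfolding m_def by blast
  ultimately have "lab r = {..<m}" using down by (auto simp: lessThan_def) (meson not_le)
  then show ?thesis by simp
qed

lemma linked_closed: "linked y z \<Longrightarrow> y \<in> Y" "linked y z \<Longrightarrow> z \<in> Y"
  by (auto simp: linked_def)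

end

section \<open>The labels as a system of partial shifts, and their order\<close>

lemma lab_label_shift [simp]: "pshifts.lab label_shift v = v"
proof -
  have "n \<in> {n. label_shift n v \<noteq> label_shift (Suc n) v} \<longleftrightarrow> n \<in> v" for n
    by (simp add: label_shift_Suc_eq_iff)
  \<comment> \<open>The defining equation is exported under the locale assumptions; they hold
    vacuously for the empty set, and \<open>lab\<close> does not depend on the set.\<close>
  moreover have "pshifts.lab label_shift v = {n. label_shift n v \<noteq> label_shift (Suc n) v}"
    by (rule pshifts.lab_def[of "{}"]) (unfold_locales; simp)
  ultimately show ?thesis by blast
qed

lemma pshifts_labels:
  assumes "\<And>v. v \<in> V \<Longrightarrow> finite v" "\<And>v i. v \<in> V \<Longrightarrow> label_shift i v \<in> V"
  shows "pshifts V label_shift"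
proof
  fix v assume "v \<in> V"
  then obtain n where "v \<subseteq> {..<n}" using assms(1) finite_nat_iff_bounded by blast
  then show "\<exists>n. label_shift n v = v" using label_shift_fixed_iff assms(1) \<open>v \<in> V\<close> by blast
next
  show "inj_on (label_shift n) V" for n using inj_label_shift inj_on_subset by blast
qed (simp_all add: assms label_shift_label_shift)

lemma label_shift_in_rank_labels: "v \<in> rank_labels k \<Longrightarrow> label_shift i v \<in> rank_labels k"
  by (simp add: rank_labels_def)

interpretation labels: pshifts "rank_labels k" label_shift for k
  by (rule pshifts_labels) (simp_all add: rank_labels_def)

lemma labels_normal: "labels.normal k"
  unfolding labels.normal_def
proof (intro ballI allI impI)
  fix v n assume v: "v \<in> rank_labels k" and "n \<notin> pshifts.lab label_shift v"
  then obtain w where "v = label_shift n w" using label_shift_surj by auto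
  then show "v \<in> label_shift n ` rank_labels k" using v by (auto simp: rank_labels_def)
qed

lemma initial_in_rank_labels: "{..<k} \<in> rank_labels k"
  by (simp add: rank_labels_def)

text \<open>Normality leaves only one candidate for a root, and a root exists by descent.\<close>

lemma labels_root_iff: "labels.root k v \<longleftrightarrow> v = {..<k}"
proof
  assume r: "labels.root k v"
  then have "v \<in> rank_labels k" by (simp add: labels.root_def)
  then show "v = {..<k}" using labels.normal_root_lab[OF labels_normal r] by (simp add: rank_labels_def)
next
  assume v: "v = {..<k}"
  obtain r "is" where r: "labels.root k r" using labels.obtain_root[OF initial_in_rank_labels] by metis
  then have "r \<in> rank_labels k" by (simp add: labels.root_def)
  then have "r = {..<k}" using labels.normal_root_lab[OF labels_normal r] by (simp add: rank_labels_def)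
  then show "labels.root k v" using r v by simp
qed

lemma labels_linked:
  assumes "u \<in> rank_labels k" "v \<in> rank_labels k"
  shows "labels.linked k u v"
proof -
  have *: "labels.linked k w {..<k}" if w: "w \<in> rank_labels k" for w
    using labels.obtain_root[OF w] labels_root_iff labels.linked_sym by metis
  show ?thesis using *[OF assms(1)] *[OF assms(2)] labels.linked_sym labels.linked_trans by blast
qed

lemma label_le_initial: "v \<in> rank_labels k \<Longrightarrow> label_le {..<k} v"
  by (metis labels.obtain_root labels_root_iff label_le_fold_label_shift)

lemma gaps_initial: "gaps {..<k} = {#}"
proof -
  have "{p. p \<notin> {..<k} \<and> (\<exists>q\<in>{..<k}. p < q)} = {}" by auto
  then show ?thesis unfolding gaps_def by (simp only: mset_set.empty image_mset_empty)
qed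

lemma gaps_less:
  assumes "v \<in> rank_labels k" "j \<in># gaps v"
  shows "j < k"
proof -
  obtain p where p: "j = ones_below v p" "p \<in># mset_set {p. p \<notin> v \<and> (\<exists>q\<in>v. p < q)}"
    using assms(2) by (auto simp: gaps_def)
  then have "p \<in> {p. p \<notin> v \<and> (\<exists>q\<in>v. p < q)}"
    by (cases "finite {p. p \<notin> v \<and> (\<exists>q\<in>v. p < q)}") simp_all
  then have "\<exists>q\<in>v. p \<le> q" using less_imp_le by blast
  then show ?thesis using p(1) ones_below_less_card_iff[of v p] assms(1) by (auto simp: rank_labels_def)
qed

lemma gaps_labels_Ins:
  assumes "v \<in> rank_labels k" "set_mset M \<subseteq> {..<k}"
  shows "gaps (labels.Ins k M v) = M + gaps v"
proof -
  have "filter_mset (\<lambda>j. j < k) M = M" using assms(2) by (auto simp: filter_mset_eq_conv)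
  then show ?thesis using labels.gaps_Ins[of v k M] assms(1) by (simp add: rank_labels_def)
qed

lemma labels_Ins_in: "v \<in> rank_labels k \<Longrightarrow> labels.Ins k M v \<in> rank_labels k"
  by (rule labels.Ins_closed)

text \<open>A label of rank \<open>k\<close> arises from \<open>{..<k}\<close>, which has no inner
  zeros, by applying exactly the multiset of its gaps.\<close>

lemma gaps_inject:
  assumes "u \<in> rank_labels k" "v \<in> rank_labels k" "gaps u = gaps v"
  shows "u = v"
proof -
  have *: "w = labels.Ins k (gaps w) {..<k}" if w: "w \<in> rank_labels k" for w
  proof -
    obtain "is" where "w = fold label_shift is {..<k}"
      using labels.obtain_root[OF w] labels_root_iff by metis
    then obtain M where M: "w = labels.Ins k M {..<k}"
      using labels.fold_eq_Ins[OF initial_in_rank_labels] by metis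
    let ?N = "filter_mset (\<lambda>j. j < k) M"
    have "w = labels.Ins k ?N {..<k}" using labels.Ins_filter[OF initial_in_rank_labels, of k M] M by simp
    moreover have "gaps w = ?N"
      using labels.gaps_Ins[OF initial_in_rank_labels, of k M] M by (simp add: gaps_initial)
    ultimately show ?thesis by simp
  qed
  show ?thesis using *[OF assms(1)] *[OF assms(2)] assms(3) by simp
qed

text \<open>This identifies the poset of labels of rank \<open>k\<close> with a set of multisets
  over \<open>{..<k}\<close> under inclusion, hence with tuples of naturals under the product
  order.\<close>

lemma label_le_iff_gaps:
  assumes u: "u \<in> rank_labels k" and v: "v \<in> rank_labels k"
  shows "label_le u v \<longleftrightarrow> gaps u \<subseteq># gaps v"
proof
  assume "label_le u v"
  then obtain "is" where "v = fold label_shift is u"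
    using label_le_obtain_shifts u by (auto simp: rank_labels_def)
  then obtain M where "v = labels.Ins k M u" using labels.fold_eq_Ins[OF u] by metis
  then show "gaps u \<subseteq># gaps v" using labels.gaps_Ins[OF u] by simp
next
  assume le: "gaps u \<subseteq># gaps v"
  define D where "D = gaps v - gaps u"
  have D: "set_mset D \<subseteq> {..<k}" using gaps_less[OF v] by (auto simp: D_def dest: in_diffD)
  have "gaps (labels.Ins k D u) = gaps v" using gaps_labels_Ins[OF u D] le by (simp add: D_def)
  then have "v = labels.Ins k D u" using gaps_inject v labels_Ins_in[OF u] by metis
  then show "label_le u v" using labels.Ins_eq_fold[OF u] label_le_fold_label_shift by metis
qed

text \<open>A translation of N^k: labels above \<open>u\<close> are those whose gaps contain
  \<open>gaps u\<close>, and subtracting \<open>gaps u\<close> preserves and reflects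
  inclusion.\<close>

lemma ex_label_order_iso:
  assumes u: "u \<in> rank_labels k"
  shows "\<exists>\<phi>. bij_betw \<phi> {v \<in> rank_labels k. label_le u v} (rank_labels k) \<and>
    (\<forall>v w. label_le u v \<and> label_le u w \<and> v \<in> rank_labels k \<and> w \<in> rank_labels k \<longrightarrow>
       (label_le v w \<longleftrightarrow> label_le (\<phi> v) (\<phi> w)))"
proof -
  define \<phi> where "\<phi> v = labels.Ins k (gaps v - gaps u) {..<k}" for v
  define \<psi> where "\<psi> w = labels.Ins k (gaps w) u" for w
  have in_phi: "\<phi> v \<in> rank_labels k" for v
    unfolding \<phi>_def by (rule labels_Ins_in[OF initial_in_rank_labels])
  have sub: "set_mset (gaps v - gaps u) \<subseteq> {..<k}" if "v \<in> rank_labels k" for v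
    using gaps_less[OF that] by (auto dest: in_diffD)
  have gaps_phi: "gaps (\<phi> v) = gaps v - gaps u" if "v \<in> rank_labels k" for v
    unfolding \<phi>_def using gaps_labels_Ins[OF initial_in_rank_labels sub[OF that]] by (simp add: gaps_initial)
  have in_psi: "\<psi> w \<in> rank_labels k" for w
    unfolding \<psi>_def by (rule labels_Ins_in[OF u])
  have gaps_psi: "gaps (\<psi> w) = gaps w + gaps u" if "w \<in> rank_labels k" for w
    unfolding \<psi>_def using gaps_labels_Ins[OF u, of "gaps w"] gaps_less[OF that] by auto
  have "bij_betw \<phi> {v \<in> rank_labels k. label_le u v} (rank_labels k)"
  proof (rule bij_betwI[where g = \<psi>])
    show "\<psi> \<in> rank_labels k \<rightarrow> {v \<in> rank_labels k. label_le u v}"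
      using in_psi gaps_psi label_le_iff_gaps[OF u] by auto
    show "\<psi> (\<phi> v) = v" if v: "v \<in> {v \<in> rank_labels k. label_le u v}" for v
      using gaps_psi[OF in_phi, of v] gaps_phi[of v] v label_le_iff_gaps[OF u, of v]
      by (intro gaps_inject[OF in_psi, of v]) auto
    show "\<phi> (\<psi> w) = w" if w: "w \<in> rank_labels k" for w
      using gaps_psi[OF w] gaps_phi[OF in_psi, of w] by (intro gaps_inject[OF in_phi w]) auto
  qed (use in_phi in auto)
  moreover have "label_le v w \<longleftrightarrow> label_le (\<phi> v) (\<phi> w)"
    if "label_le u v" "label_le u w" "v \<in> rank_labels k" "w \<in> rank_labels k" for v w
  proof -
    have le: "gaps u \<subseteq># gaps v" "gaps u \<subseteq># gaps w" using label_le_iff_gaps[OF u] that by auto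
    have "gaps v \<subseteq># gaps w \<longleftrightarrow> gaps v - gaps u \<subseteq># gaps w - gaps u"
      using le by (metis subset_mset.diff_add mset_subset_eq_mono_add_right_cancel)
    then show ?thesis using label_le_iff_gaps that gaps_phi in_phi by metis
  qed
  ultimately show ?thesis by blast
qed

section \<open>Dickson's lemma and antichains of labels\<close>

lemma ex_incseq_subseq_nat:
  fixes f :: "nat \<Rightarrow> nat"
  shows "\<exists>r. strict_mono r \<and> incseq (f \<circ> r)"
proof -
  obtain s where s: "strict_mono s" "monoseq (\<lambda>n. f (s n))" using seq_monosub[of f] by blast
  then consider "incseq (\<lambda>n. f (s n))" | "decseq (\<lambda>n. f (s n))" by (auto simp: monoseq_iff)
  then show ?thesis
  proof cases
    case 1
    then show ?thesis using s by (auto simp: o_def)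
  next
    case 2
    \<comment> \<open>A decreasing sequence of naturals is constant from the place on where its
      minimum is attained.\<close>
    obtain N where N: "\<And>n. f (s N) \<le> f (s n)" using ex_has_least_nat[of "\<lambda>_. True" _ "\<lambda>n. f (s n)"] by auto
    then have "f (s (n + N)) = f (s N)" for n using 2 by (simp add: decseq_def le_antisym)
    then have "incseq (f \<circ> (\<lambda>n. s (n + N)))" by (simp add: incseq_def)
    moreover have "strict_mono (\<lambda>n. s (n + N))" using s by (simp add: strict_mono_def)
    ultimately show ?thesis by blast
  qed
qed

lemma dickson_subseq:
  fixes f :: "nat \<Rightarrow> nat \<Rightarrow> nat"
  shows "\<exists>r. strict_mono r \<and> (\<forall>j<k. incseq (\<lambda>n. f (r n) j))"
proof (induction k)
  case 0
  show ?case using strict_mono_id by auto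
next
  case (Suc k)
  then obtain r where r: "strict_mono r" "\<And>j. j < k \<Longrightarrow> incseq (\<lambda>n. f (r n) j)" by blast
  obtain s where s: "strict_mono s" "incseq ((\<lambda>n. f (r n) k) \<circ> s)" using ex_incseq_subseq_nat by blast
  have "incseq (\<lambda>n. f ((r \<circ> s) n) j)" if "j < Suc k" for j
    using that s r(2)[of j] by (cases "j = k") (auto simp: incseq_def strict_mono_less_eq)
  then show ?case using strict_mono_o[OF r(1) s(1)] by blast
qed

text \<open>The multiplicities of the \<open>k\<close> possible gap indices are tuples of naturals.
  Along a subsequence that is increasing in every coordinate the first two labels are
  comparable.\<close>

lemma finite_label_antichain:
  assumes A: "A \<subseteq> rank_labels k" and anti: "\<And>u v. u \<in> A \<Longrightarrow> v \<in> A \<Longrightarrow> u \<noteq> v \<Longrightarrow> \<not> label_le u v"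
  shows "finite A"
proof (rule ccontr)
  assume "infinite A"
  then obtain f :: "nat \<Rightarrow> nat set" where f: "inj f" "range f \<subseteq> A" by (meson infinite_countable_subset)
  obtain r where r: "strict_mono r" "\<And>j. j < k \<Longrightarrow> incseq (\<lambda>n. count (gaps (f (r n))) j)"
    using dickson_subseq[of k "\<lambda>n j. count (gaps (f n)) j"] by blast
  have in_A: "f (r 0) \<in> A" "f (r 1) \<in> A" using f by auto
  have "count (gaps (f (r 0))) j \<le> count (gaps (f (r 1))) j" for j
  proof (cases "j < k")
    case True
    then show ?thesis using r(2) by (simp add: incseq_def)
  next
    case False
    then have "j \<notin># gaps (f (r 0))" using gaps_less in_A A by blast
    then show ?thesis by (simp add: not_in_iff)
  qed
  then have "label_le (f (r 0)) (f (r 1))"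
    using label_le_iff_gaps in_A A by (metis mset_subset_eqI subsetD)
  moreover have "f (r 0) \<noteq> f (r 1)" using f(1) r(1) by (simp add: inj_eq strict_mono_eq)
  ultimately show False using anti in_A by blast
qed

context pshifts
begin

text \<open>The root above which \<open>y\<close> lies has label \<open>{..<rank y}\<close>,
  dominated by every label of this rank; the insertions leading to \<open>v\<close> are repeated on
  the root.\<close>

lemma normal_fill:
  assumes normal "y \<in> Y" "v \<in> rank_labels (rank y)"
  shows "\<exists>z. linked y z \<and> lab z = v"
proof -
  obtain r "is" where r: "root r" "y = fold \<alpha> is r" "linked r y" using obtain_root assms(2) by blast
  have "lab r = {..<rank y}" using normal_root_lab[OF assms(1) r(1)] linked_rank r(3) by simp
  then have "label_le (lab r) v" using label_le_initial assms(3) by simp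
  then obtain js where "v = fold label_shift js (lab r)"
    using label_le_obtain_shifts finite_lab linked_closed r(3) by metis
  then have "lab (fold \<alpha> js r) = v" using lab_fold linked_closed(1)[OF r(3)] by simp
  moreover have "linked y (fold \<alpha> js r)"
    using linked_fold linked_sym[OF r(3)] linked_closed(1)[OF r(3)] linked_trans by metis
  ultimately show ?thesis by blast
qed

lemma lab_in_rank_labels: "y \<in> Y \<Longrightarrow> lab y \<in> rank_labels (rank y)"
  by (simp add: rank_labels_def finite_lab)

lemma root_eqI:
  assumes "root r" "linked y r" "label_le (lab y) (lab r)"
  shows "y = r"
  using linked_label_le_iff[OF assms(2)] assms root_fold linked_closed by metis

end

section \<open>Injective maps between systems of partial shifts\<close>

locale pshifts_hom = A: pshifts Y \<alpha> + B: pshifts Y' \<alpha>'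
  for Y :: "'y set" and \<alpha> and Y' :: "'z set" and \<alpha>' +
  fixes h :: "'y \<Rightarrow> 'z"
  assumes h_in: "y \<in> Y \<Longrightarrow> h y \<in> Y'" and h_inj: "inj_on h Y"
    and h_alpha: "y \<in> Y \<Longrightarrow> h (\<alpha> i y) = \<alpha>' i (h y)"
begin

lemma h_eq_iff: "y \<in> Y \<Longrightarrow> z \<in> Y \<Longrightarrow> h y = h z \<longleftrightarrow> y = z"
  using h_inj by (meson inj_onD)

lemma lab_h: "y \<in> Y \<Longrightarrow> B.lab (h y) = A.lab y"
  unfolding A.lab_def B.lab_def by (simp add: h_eq_iff A.closed flip: h_alpha)

lemma fold_h: "y \<in> Y \<Longrightarrow> h (fold \<alpha> is y) = fold \<alpha>' is (h y)"
  by (induction "is" arbitrary: y) (auto simp: A.closed h_alpha)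

lemma ins_h:
  assumes y: "y \<in> Y"
  shows "h (A.ins j y) = B.ins j (h y)"
proof (cases "j < A.rank y")
  case True
  obtain i where i: "ones_below (A.lab y) i = j" "A.ins j y = \<alpha> i y" using A.obtain_ins[OF y True] .
  then show ?thesis using B.alpha_eq_ins[OF h_in[OF y], of i] y by (simp add: h_alpha lab_h)
next
  case False
  then show ?thesis using y by (simp add: A.ins_trivial B.ins_trivial lab_h)
qed

lemma Ins_h: "y \<in> Y \<Longrightarrow> h (A.Ins M y) = B.Ins M (h y)"
  by (induction M) (auto simp: A.Ins_add B.Ins_add ins_h A.Ins_closed)

text \<open>Links are reflected as well as preserved, since \<open>h\<close> intertwines all
  \<open>Ins M\<close> and is injective.\<close>

lemma linked_h: "y \<in> Y \<Longrightarrow> z \<in> Y \<Longrightarrow> B.linked (h y) (h z) \<longleftrightarrow> A.linked y z"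
  unfolding A.linked_def B.linked_def by (simp add: h_in h_eq_iff A.Ins_closed flip: Ins_h)

end

text \<open>A correspondence \<open>Q\<close> between elements of two systems that matches linkedness classes induces
  a label preserving map, because a label determines at most one element of a class.\<close>

locale pshifts_glue = A: pshifts Y \<alpha> + B: pshifts Y' \<alpha>'
  for Y :: "'y set" and \<alpha> and Y' :: "'z set" and \<alpha>' +
  fixes Q :: "'y \<Rightarrow> 'z \<Rightarrow> bool"
  assumes cover: "x \<in> Y \<Longrightarrow> \<exists>a b. Q a b \<and> A.linked x a"
    and compat: "Q a b \<Longrightarrow> Q a' b' \<Longrightarrow> A.linked a a' \<longleftrightarrow> B.linked b b'"
    and fill: "Q a b \<Longrightarrow> A.linked x a \<Longrightarrow> \<exists>z. B.linked z b \<and> B.lab z = A.lab x"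
begin

definition glue :: "'y \<Rightarrow> 'z" where
  "glue x = (THE z. B.lab z = A.lab x \<and> (\<exists>a b. Q a b \<and> A.linked x a \<and> B.linked z b))"

text \<open>The pair used does not matter: by \<open>compat\<close> the partners of two members of
  one class are linked, and within a class the label decides.\<close>

lemma glue_eqI:
  assumes "Q a b" "A.linked x a" "B.linked z b" "B.lab z = A.lab x"
  shows "glue x = z"
  unfolding glue_def
proof (rule the_equality)
  show "B.lab z = A.lab x \<and> (\<exists>a b. Q a b \<and> A.linked x a \<and> B.linked z b)" using assms by blast
next
  fix z' assume z': "B.lab z' = A.lab x \<and> (\<exists>a b. Q a b \<and> A.linked x a \<and> B.linked z' b)"
  then obtain a' b' where "Q a' b'" "A.linked x a'" "B.linked z' b'" by blast
  then have "B.linked z' z"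
    using compat assms A.linked_sym A.linked_trans B.linked_sym B.linked_trans by metis
  then show "z' = z" using B.linked_lab_eq z' assms by metis
qed

lemma obtain_glue:
  assumes "x \<in> Y"
  obtains a b where "Q a b" "A.linked x a" "B.linked (glue x) b" "B.lab (glue x) = A.lab x"
  using cover[OF assms] fill glue_eqI by metis

lemma glue_Q:
  assumes "Q a b" "A.lab a = B.lab b" "a \<in> Y" "b \<in> Y'"
  shows "glue a = b"
  using glue_eqI[OF assms(1) A.linked_refl B.linked_refl] assms by simp

sublocale hom: pshifts_hom Y \<alpha> Y' \<alpha>' glue
proof
  fix y assume y: "y \<in> Y"
  obtain a b where *: "Q a b" "A.linked y a" "B.linked (glue y) b" "B.lab (glue y) = A.lab y"
    using obtain_glue[OF y] .
  show g: "glue y \<in> Y'" using * B.linked_closed by blast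
  show "glue (\<alpha> i y) = \<alpha>' i (glue y)" for i
  proof (rule glue_eqI[OF *(1)])
    show "A.linked (\<alpha> i y) a" using A.linked_alpha[OF y] A.linked_sym A.linked_trans *(2) by blast
    show "B.linked (\<alpha>' i (glue y)) b" using B.linked_alpha[OF g] B.linked_sym B.linked_trans *(3) by blast
    show "B.lab (\<alpha>' i (glue y)) = A.lab (\<alpha> i y)" using y g * by (simp add: A.lab_alpha B.lab_alpha)
  qed
next
  show "inj_on glue Y"
  proof (rule inj_onI)
    fix x y assume x: "x \<in> Y" and y: "y \<in> Y" and e: "glue x = glue y"
    obtain a b where *: "Q a b" "A.linked x a" "B.linked (glue x) b" "B.lab (glue x) = A.lab x"
      using obtain_glue[OF x] .
    obtain c d where **: "Q c d" "A.linked y c" "B.linked (glue y) d" "B.lab (glue y) = A.lab y"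
      using obtain_glue[OF y] .
    have "B.linked b d" using *(3) **(3) e B.linked_sym B.linked_trans by metis
    then have "A.linked a c" using compat[OF *(1) **(1)] by simp
    then have "A.linked x y" using *(2) **(2) A.linked_sym A.linked_trans by blast
    then show "x = y" using A.linked_lab_eq *(4) **(4) e by metis
  qed
qed

lemma glue_surj:
  assumes "\<And>z. z \<in> Y' \<Longrightarrow> \<exists>a b. Q a b \<and> B.linked z b"
    and "\<And>a b z. Q a b \<Longrightarrow> B.linked z b \<Longrightarrow> \<exists>x. A.linked x a \<and> A.lab x = B.lab z"
  shows "glue ` Y = Y'"
proof (intro equalityI subsetI)
  fix z assume "z \<in> Y'"
  then obtain a b where ab: "Q a b" "B.linked z b" using assms(1) by blast
  then obtain x where x: "A.linked x a" "A.lab x = B.lab z" using assms(2) by blast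
  then have "glue x = z" using glue_eqI ab by metis
  then show "z \<in> glue ` Y" using x A.linked_closed by blast
qed (use hom.h_in in blast)

end

section \<open>The direct limit of the tower\<close>

locale semicosimplicial =
  fixes S :: "'a scs"
  assumes scs: "is_scs S"
begin

lemma cof_in: "i \<le> n \<Longrightarrow> x \<in> lev S n \<Longrightarrow> cof S n i x \<in> lev S (Suc n)"
  using scs by (auto simp: is_scs_def)

lemma cof_eq_iff: "i \<le> n \<Longrightarrow> x \<in> lev S n \<Longrightarrow> z \<in> lev S n \<Longrightarrow> cof S n i x = cof S n i z \<longleftrightarrow> x = z"
  using scs unfolding is_scs_def by (meson inj_onD)

lemma cof_cof: "i < j \<Longrightarrow> j \<le> Suc n \<Longrightarrow> x \<in> lev S n \<Longrightarrow>
    cof S (Suc n) j (cof S n i x) = cof S (Suc n) i (cof S n (j - 1) x)"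
  using scs by (auto simp: is_scs_def)

lemma push_in: "x \<in> lev S n \<Longrightarrow> push S n d x \<in> lev S (n + d)"
  by (induction d) (auto simp: cof_in)

lemma push_eq_iff: "x \<in> lev S n \<Longrightarrow> z \<in> lev S n \<Longrightarrow> push S n d x = push S n d z \<longleftrightarrow> x = z"
  by (induction d) (auto simp: cof_eq_iff push_in)

lemma push_add: "push S n (d + e) x = push S (n + d) e (push S n d x)"
  by (induction e) (auto simp: add.assoc)

text \<open>The coface identity in which the larger index is the top one: coface maps are compatible
  with the inclusions of the tower.\<close>

lemma push_cof:
  assumes "i \<le> m" "x \<in> lev S m"
  shows "push S (Suc m) d (cof S m i x) = cof S (m + d) i (push S m d x)"
proof (induction d)
  case (Suc d)
  then show ?case
    using cof_cof[of i "Suc (m + d)" "m + d" "push S m d x"] assms by (simp add: push_in)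
qed simp

text \<open>Since pushes are injective, whether two representatives agree can be tested at any one
  common level.\<close>

lemma lim_rel_iff:
  assumes "x \<in> lev S n" "z \<in> lev S m" "n + d = m + e"
  shows "((n, x), (m, z)) \<in> lim_rel S \<longleftrightarrow> push S n d x = push S m e z"
proof
  assume "push S n d x = push S m e z"
  then show "((n, x), (m, z)) \<in> lim_rel S" using assms by (auto simp: lim_rel_def)
next
  assume "((n, x), (m, z)) \<in> lim_rel S"
  then obtain d' e' where e': "n + d' = m + e'" "push S n d' x = push S m e' z" by (auto simp: lim_rel_def)
  show "push S n d x = push S m e z"
  proof (cases "d' \<le> d")
    case True
    then have "d = d' + (d - d')" "e = e' + (d - d')" using assms(3) e'(1) by simp_all
    then show ?thesis using push_add[of n d' "d - d'" x] push_add[of m e' "d - d'" z] e' by simp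
  next
    case False
    then have "d' = d + (d' - d)" "e' = e + (d' - d)" using assms(3) e'(1) by simp_all
    then have "push S (n + d) (d' - d) (push S n d x) = push S (n + d) (d' - d) (push S m e z)"
      using push_add[of n d "d' - d" x] push_add[of m e "d' - d" z] e' assms(3) by simp
    then show ?thesis using push_eq_iff push_in[OF assms(1), of d] push_in[OF assms(2), of e] assms(3) by simp
  qed
qed

lemma germ_eq_iff:
  assumes "x \<in> lev S n" "z \<in> lev S m" "n + d = m + e"
  shows "germ S n x = germ S m z \<longleftrightarrow> push S n d x = push S m e z"
proof -
  have refl: "((n, x), (n, x)) \<in> lim_rel S" if "x \<in> lev S n" for n x
    using lim_rel_iff[OF that that, of 0 0] by simp
  have sym: "((m, z), (n, x)) \<in> lim_rel S" if r: "((n, x), (m, z)) \<in> lim_rel S" for n x m z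
  proof -
    obtain d e where "x \<in> lev S n" "z \<in> lev S m" "n + d = m + e" "push S n d x = push S m e z"
      using r by (auto simp: lim_rel_def)
    then show ?thesis using lim_rel_iff[of z m x n e d] by simp
  qed
  have trans: "((n, x), (l, w)) \<in> lim_rel S"
    if xz: "((n, x), (m, z)) \<in> lim_rel S" and zw: "((m, z), (l, w)) \<in> lim_rel S" for n x m z l w
  proof -
    have lev: "x \<in> lev S n" "z \<in> lev S m" "w \<in> lev S l" using xz zw by (auto simp: lim_rel_def)
    \<comment> \<open>All three representatives are compared at level
      \<open>n + m + l\<close>.\<close>
    have "push S n (m + l) x = push S m (n + l) z" using xz lev by (subst (asm) lim_rel_iff) auto
    moreover have "push S m (n + l) z = push S l (n + m) w" using zw lev by (subst (asm) lim_rel_iff) auto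
    ultimately show ?thesis using lev by (subst lim_rel_iff[where d = "m + l" and e = "n + m"]) auto
  qed
  have "germ S n x = germ S m z \<longleftrightarrow> ((n, x), (m, z)) \<in> lim_rel S"
  proof
    assume "germ S n x = germ S m z"
    then show "((n, x), (m, z)) \<in> lim_rel S" using refl[OF assms(2)] by (simp add: germ_def set_eq_iff)
  next
    assume r: "((n, x), (m, z)) \<in> lim_rel S"
    show "germ S n x = germ S m z"
      unfolding germ_def
    proof (rule set_eqI)
      fix p :: "nat \<times> 'a"
      obtain l w where p: "p = (l, w)" by (cases p)
      show "p \<in> lim_rel S `` {(n, x)} \<longleftrightarrow> p \<in> lim_rel S `` {(m, z)}"
        using trans[OF r, of l w] trans[OF sym[OF r], of l w] unfolding p by blast
    qed
  qed
  then show ?thesis using lim_rel_iff[OF assms] by simp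
qed

lemma germ_inject: "x \<in> lev S n \<Longrightarrow> z \<in> lev S n \<Longrightarrow> germ S n x = germ S n z \<longleftrightarrow> x = z"
  using germ_eq_iff[of x n z n 0 0] by simp

lemma germ_push: "x \<in> lev S n \<Longrightarrow> germ S (n + d) (push S n d x) = germ S n x"
  using germ_eq_iff[of "push S n d x" "n + d" x n 0 d] push_in by simp

lemma in_germ: "x \<in> lev S n \<Longrightarrow> (m, z) \<in> germ S n x \<longleftrightarrow> z \<in> lev S m \<and> germ S m z = germ S n x"
proof (cases "z \<in> lev S m")
  case True
  assume "x \<in> lev S n"
  then show ?thesis
    using True germ_eq_iff[of x n z m m n] lim_rel_iff[of x n z m m n] by (auto simp: germ_def)
qed (simp add: germ_def lim_rel_def)

text \<open>Two representatives agree after pushing, and \<open>push_cof\<close> carries this over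
  to their images; so the definite description has a unique value.\<close>

lemma pshift_germ:
  assumes i: "i \<le> m" and x: "x \<in> lev S m"
  shows "pshift S i (germ S m x) = germ S (Suc m) (cof S m i x)"
  unfolding pshift_def
proof (rule the_equality)
  show "\<exists>m'\<ge>i. \<exists>x'\<in>lev S m'. germ S m x = germ S m' x' \<and>
      germ S (Suc m) (cof S m i x) = germ S (Suc m') (cof S m' i x')"
    using assms by blast
next
  fix z assume "\<exists>m'\<ge>i. \<exists>x'\<in>lev S m'. germ S m x = germ S m' x' \<and> z = germ S (Suc m') (cof S m' i x')"
  then obtain m' x' where *: "i \<le> m'" "x' \<in> lev S m'" "germ S m x = germ S m' x'"
    "z = germ S (Suc m') (cof S m' i x')" by blast
  have "push S m m' x = push S m' m x'" using germ_eq_iff[OF x *(2), of m' m] *(3) by simp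
  then have "push S (Suc m') m (cof S m' i x') = push S (Suc m) m' (cof S m i x)"
    using push_cof i x *(1,2) by (simp add: add.commute)
  then show "z = germ S (Suc m) (cof S m i x)"
    using germ_eq_iff[OF cof_in[OF *(1,2)] cof_in[OF i x], of m m'] *(4) by simp
qed

lemma germ_in: "x \<in> lev S n \<Longrightarrow> germ S n x \<in> Yinf S"
  by (auto simp: Yinf_def tower_def)

lemma obtain_germ_ge:
  assumes "y \<in> Yinf S"
  obtains m x where "k \<le> m" "x \<in> lev S m" "y = germ S m x"
proof -
  obtain n x where "x \<in> lev S n" "y = germ S n x" using assms by (auto simp: Yinf_def tower_def)
  then show thesis using that[of "n + k" "push S n k x"] push_in germ_push by simp
qed

lemma obtain_germ:
  assumes "y \<in> Yinf S"
  obtains n x where "x \<in> lev S n" "y = germ S n x"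
  using obtain_germ_ge[OF assms, of 0] by blast

lemma obtain_germ2:
  assumes "y \<in> Yinf S" "z \<in> Yinf S"
  obtains n u v where "k \<le> n" "u \<in> lev S n" "v \<in> lev S n" "y = germ S n u" "z = germ S n v"
proof -
  obtain m u where u: "k \<le> m" "u \<in> lev S m" "y = germ S m u" using obtain_germ_ge[OF assms(1), of k] .
  obtain n v where v: "m \<le> n" "v \<in> lev S n" "z = germ S n v" using obtain_germ_ge[OF assms(2), of m] .
  show thesis using that[of n "push S m (n - m) u" v] u v push_in[OF u(2), of "n - m"] germ_push[OF u(2), of "n - m"] by simp
qed

lemma pshift_germ_level: "x \<in> lev S n \<Longrightarrow> pshift S n (germ S n x) = germ S n x"
  using germ_push[of x n 1] by (simp add: pshift_germ)

sublocale pshifts "Yinf S" "pshift S"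
proof
  fix y n assume "y \<in> Yinf S"
  then obtain m x where *: "n \<le> m" "x \<in> lev S m" "y = germ S m x" using obtain_germ_ge[of y n] by blast
  then show "pshift S n y \<in> Yinf S" by (simp add: pshift_germ germ_in cof_in)
next
  fix n
  show "inj_on (pshift S n) (Yinf S)"
  proof (rule inj_onI)
    fix y z assume "y \<in> Yinf S" "z \<in> Yinf S" and e: "pshift S n y = pshift S n z"
    then obtain m u v where *: "n \<le> m" "u \<in> lev S m" "v \<in> lev S m" "y = germ S m u" "z = germ S m v"
      using obtain_germ2[of y z n] by blast
    then show "y = z" using e by (simp add: pshift_germ germ_inject cof_in cof_eq_iff)
  qed
next
  fix i j :: nat and y assume ij: "i < j" and "y \<in> Yinf S"
  then obtain m x where *: "j \<le> m" "x \<in> lev S m" "y = germ S m x" using obtain_germ_ge[of y j] by blast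
  then show "pshift S j (pshift S i y) = pshift S i (pshift S (j - 1) y)"
    using ij cof_cof[of i j m x] by (simp add: pshift_germ cof_in)
next
  fix y assume "y \<in> Yinf S"
  then show "\<exists>n. pshift S n y = y" using obtain_germ pshift_germ_level by metis
qed

lemma normal_label_eq: "normal_label S = lab"
  by (rule ext) (simp add: normal_label_def lab_def)

lemma scs_le_iff: "scs_le S y z \<longleftrightarrow> (\<exists>is. z = fold (pshift S) is y)"
  by (simp add: scs_le_def)

end

locale saturated = semicosimplicial +
  assumes sat: "scs_saturated S"
begin

lemma tower_eq: "tower S n = {y \<in> Yinf S. lab y \<subseteq> {..<n}}"
proof -
  have "tower S n = {y \<in> Yinf S. pshift S n y = y}" using sat unfolding scs_saturated_def by blast
  also have "\<dots> = {y \<in> Yinf S. lab y \<subseteq> {..<n}}" by (rule Collect_cong) (use fixed_iff in blast)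
  finally show ?thesis .
qed

lemma ex_germ_iff: "y \<in> Yinf S \<Longrightarrow> (\<exists>x\<in>lev S n. y = germ S n x) \<longleftrightarrow> lab y \<subseteq> {..<n}"
proof -
  assume y: "y \<in> Yinf S"
  have "(\<exists>x\<in>lev S n. y = germ S n x) \<longleftrightarrow> y \<in> tower S n" by (auto simp: tower_def)
  then show ?thesis using y by (simp add: tower_eq)
qed

lemma lab_germ: "x \<in> lev S n \<Longrightarrow> lab (germ S n x) \<subseteq> {..<n}"
  using ex_germ_iff germ_in by blast

text \<open>\<open>is_root\<close> looks only at shifts from one level. If \<open>y\<close> is a
  shift of another element \<open>z\<close>, then some one of \<open>z\<close> at or behind
  \<open>i\<close> moves, which bounds \<open>i\<close> and places \<open>z\<close> below the level
  of \<open>y\<close>. Conversely a root is tested at the least level containing it, where a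
  preimage one level lower would be the root itself.\<close>

lemma is_root_iff: "is_root S y \<longleftrightarrow> root y"
proof
  assume "is_root S y"
  then obtain n where n: "y \<in> innovation S n" and
    nr: "\<And>m i. n = Suc m \<Longrightarrow> i \<le> m \<Longrightarrow> y \<notin> pshift S i ` tower S m"
    by (auto simp: is_root_def)
  have y: "y \<in> Yinf S" "lab y \<subseteq> {..<n}"
    using n by (auto simp: innovation_def tower_eq split: nat.splits)
  have "z = y" if z: "z \<in> Yinf S" and e: "y = pshift S i z" for i z
  proof (rule ccontr)
    assume "z \<noteq> y"
    then have "pshift S i z \<noteq> z" using e by simp
    then have "\<not> lab z \<subseteq> {..<i}" using fixed_iff[OF z] by blast
    then obtain p where p: "p \<in> lab z" "i \<le> p" by (meson lessThan_iff not_le subsetI)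
    have shift: "lab y = label_shift i (lab z)" using lab_alpha[OF z] e by simp
    then have "Suc p \<in> lab y" using p by (auto simp: label_shift_def)
    then have "Suc p < n" using y(2) by blast
    then obtain m where m: "n = Suc m" "i \<le> m" using p(2) by (cases n) auto
    have "lab z \<subseteq> {..<m}"
    proof
      fix q assume q: "q \<in> lab z"
      then have "skip i q \<in> lab y" using shift skip_in_label_shift by simp
      then have "skip i q < Suc m" using y(2) m(1) by blast
      then show "q \<in> {..<m}" using m(2) by (auto simp: skip_def split: if_splits)
    qed
    then have "z \<in> tower S m" using z by (simp add: tower_eq)
    then show False using nr[OF m] e by blast
  qed
  then show "root y" using y(1) by (auto simp: root_def)
next
  assume r: "root y"
  then have y: "y \<in> Yinf S" by (simp add: root_def)
  define n where "n = (LEAST n. lab y \<subseteq> {..<n})"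
  have "\<exists>n. lab y \<subseteq> {..<n}" using finite_lab[OF y] finite_nat_iff_bounded by blast
  then have n: "lab y \<subseteq> {..<n}" unfolding n_def by (rule LeastI_ex)
  have least: "\<not> lab y \<subseteq> {..<m}" if "m < n" for m using that not_less_Least unfolding n_def by blast
  have "y \<in> innovation S n"
    using n least y by (auto simp: innovation_def tower_eq split: nat.splits)
  moreover have "y \<notin> pshift S i ` tower S m" if m: "n = Suc m" for m i
  proof
    assume "y \<in> pshift S i ` tower S m"
    then obtain z where z: "z \<in> tower S m" "y = pshift S i z" by blast
    then have "z = y" using r by (auto simp: root_def tower_eq)
    then show False using z least[of m] m by (auto simp: tower_eq)
  qed
  ultimately show "is_root S y" unfolding is_root_def by blast
qed

lemma roots_eq: "roots S = {y. root y}"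
  by (simp add: roots_def is_root_iff)

end

section \<open>Embeddings, isomorphisms and their action on the union of the tower\<close>

lemma scs_embedding_iff:
  assumes "is_scs S" "is_scs S'"
  shows "scs_embedding U S S' \<longleftrightarrow>
    (\<forall>n. U n ` lev S n \<subseteq> lev S' n \<and> inj_on (U n) (lev S n)) \<and>
    (\<forall>n i x. i \<le> n \<and> x \<in> lev S n \<longrightarrow> U (Suc n) (cof S n i x) = cof S' n i (U n x))"
    (is "_ \<longleftrightarrow> ?R")
proof
  assume "scs_embedding U S S'"
  then obtain T where T: "\<And>n. lev T n \<subseteq> lev S' n" "cof T = cof S'" "is_scs_iso U S T"
    by (auto simp: scs_embedding_def sub_scs_def)
  then show ?R by (auto simp: is_scs_iso_def bij_betw_def)
next
  assume R: ?R
  \<comment> \<open>The image levels with the coface maps of \<open>S'\<close> are the required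
    sub-SCS.\<close>
  define T where "T = \<lparr>lev = \<lambda>n. U n ` lev S n, cof = cof S'\<rparr>"
  interpret S: semicosimplicial S by unfold_locales (rule assms)
  interpret S': semicosimplicial S' by unfold_locales (rule assms)
  have "is_scs T"
    unfolding is_scs_def
  proof (intro conjI allI impI)
    fix n i :: nat assume i: "i \<le> n"
    show "cof T n i ` lev T n \<subseteq> lev T (Suc n)"
    proof
      fix z assume "z \<in> cof T n i ` lev T n"
      then obtain x where "x \<in> lev S n" "z = cof S' n i (U n x)" by (auto simp: T_def)
      then have "z = U (Suc n) (cof S n i x)" "cof S n i x \<in> lev S (Suc n)" using R i S.cof_in by auto
      then show "z \<in> lev T (Suc n)" by (simp add: T_def)
    qed
    show "inj_on (cof T n i) (lev T n)"
    proof (rule inj_onI)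
      fix x y assume "x \<in> lev T n" "y \<in> lev T n" and e: "cof T n i x = cof T n i y"
      then have "x \<in> lev S' n" "y \<in> lev S' n" using R by (auto simp: T_def)
      then show "x = y" using e S'.cof_eq_iff i by (simp add: T_def)
    qed
  next
    fix n i j x assume *: "i < j \<and> j \<le> Suc n \<and> x \<in> lev T n"
    then have "x \<in> lev S' n" using R by (auto simp: T_def)
    then show "cof T (Suc n) j (cof T n i x) = cof T (Suc n) i (cof T n (j - 1) x)"
      using * S'.cof_cof by (simp add: T_def)
  qed
  then have "sub_scs T S'" using R by (auto simp: sub_scs_def T_def)
  moreover have "is_scs_iso U S T" using R by (auto simp: is_scs_iso_def bij_betw_def T_def)
  ultimately show "scs_embedding U S S'" unfolding scs_embedding_def by blast
qed

text \<open>The induced map of direct limits. It evaluates at an arbitrary representative, which is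
  harmless for embeddings by \<open>lift_germ\<close>.\<close>

definition lift :: "'b scs \<Rightarrow> (nat \<Rightarrow> 'a \<Rightarrow> 'b) \<Rightarrow> (nat \<times> 'a) set \<Rightarrow> (nat \<times> 'b) set" where
  "lift S' U y = (case SOME p. p \<in> y of (n, x) \<Rightarrow> germ S' n (U n x))"

locale embedding = S: semicosimplicial S + S': semicosimplicial S'
  for S :: "'a scs" and S' :: "'b scs" +
  fixes U
  assumes emb: "scs_embedding U S S'"
begin

lemma U_in: "x \<in> lev S n \<Longrightarrow> U n x \<in> lev S' n"
  and U_inj: "inj_on (U n) (lev S n)"
  and U_cof: "i \<le> n \<Longrightarrow> x \<in> lev S n \<Longrightarrow> U (Suc n) (cof S n i x) = cof S' n i (U n x)"
  using emb scs_embedding_iff[OF S.scs S'.scs] by blast+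

lemma U_push: "x \<in> lev S n \<Longrightarrow> U (n + d) (push S n d x) = push S' n d (U n x)"
  by (induction d) (auto simp: U_cof S.push_in)

lemma germ_U_eq_iff:
  assumes "x \<in> lev S n" "z \<in> lev S m"
  shows "germ S' n (U n x) = germ S' m (U m z) \<longleftrightarrow> germ S n x = germ S m z"
proof -
  have "germ S' n (U n x) = germ S' m (U m z) \<longleftrightarrow> push S' n m (U n x) = push S' m n (U m z)"
    using S'.germ_eq_iff U_in assms by simp
  also have "\<dots> \<longleftrightarrow> U (n + m) (push S n m x) = U (n + m) (push S m n z)"
    using U_push[OF assms(1), of m] U_push[OF assms(2), of n] by (simp add: add.commute)
  also have "\<dots> \<longleftrightarrow> push S n m x = push S m n z"
    using U_inj[of "n + m"] S.push_in[OF assms(1), of m] S.push_in[OF assms(2), of n]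
    by (simp add: inj_on_eq_iff add.commute)
  also have "\<dots> \<longleftrightarrow> germ S n x = germ S m z"
    using S.germ_eq_iff[OF assms, of m n] by (simp add: add.commute)
  finally show ?thesis .
qed

lemma lift_germ:
  assumes "x \<in> lev S n"
  shows "lift S' U (germ S n x) = germ S' n (U n x)"
proof -
  obtain m z where mz: "(SOME p. p \<in> germ S n x) = (m, z)" by fastforce
  have "(n, x) \<in> germ S n x" using S.in_germ assms by simp
  then have "(m, z) \<in> germ S n x" unfolding mz[symmetric] by (rule someI)
  then have "germ S' m (U m z) = germ S' n (U n x)" using S.in_germ assms germ_U_eq_iff by blast
  then show ?thesis by (simp add: lift_def mz)
qed

sublocale hom: pshifts_hom "Yinf S" "pshift S" "Yinf S'" "pshift S'" "lift S' U"
proof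
  fix y assume y: "y \<in> Yinf S"
  obtain n x where *: "x \<in> lev S n" "y = germ S n x" using S.obtain_germ[OF y] .
  show "lift S' U y \<in> Yinf S'" using * lift_germ S'.germ_in U_in by simp
  fix i
  obtain n x where *: "i \<le> n" "x \<in> lev S n" "y = germ S n x" using S.obtain_germ_ge[OF y] .
  then show "lift S' U (pshift S i y) = pshift S' i (lift S' U y)"
    by (simp add: lift_germ S.pshift_germ S'.pshift_germ U_in U_cof S.cof_in)
next
  show "inj_on (lift S' U) (Yinf S)"
  proof (rule inj_onI)
    fix y z assume "y \<in> Yinf S" "z \<in> Yinf S" and e: "lift S' U y = lift S' U z"
    then obtain n u v where "u \<in> lev S n" "v \<in> lev S n" "y = germ S n u" "z = germ S n v"
      using S.obtain_germ2[of y z 0] by blast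
    then show "y = z" using e by (simp add: lift_germ germ_U_eq_iff)
  qed
qed

end

lemma is_scs_iso_imp_embedding:
  assumes "is_scs S'" "is_scs_iso U S S'"
  shows "scs_embedding U S S'"
  using assms unfolding scs_embedding_def sub_scs_def by blast

locale isomorphism = S: semicosimplicial S + S': semicosimplicial S'
  for S :: "'a scs" and S' :: "'b scs" +
  fixes U
  assumes iso: "is_scs_iso U S S'"
begin

sublocale embedding S S' U
  by unfold_locales (rule is_scs_iso_imp_embedding[OF S'.scs iso])

lemma U_surj: "U n ` lev S n = lev S' n"
  using iso by (simp add: is_scs_iso_def bij_betw_def)

lemma lift_surj: "lift S' U ` Yinf S = Yinf S'"
proof (intro equalityI subsetI)
  fix z assume "z \<in> Yinf S'"
  then obtain n w where w: "w \<in> lev S' n" "z = germ S' n w" using S'.obtain_germ by blast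
  then obtain x where "x \<in> lev S n" "w = U n x" using U_surj by blast
  then show "z \<in> lift S' U ` Yinf S" using w lift_germ S.germ_in by (metis image_eqI)
qed (use hom.h_in in blast)

end

context pshifts_hom
begin

lemma root_h_iff:
  assumes "h ` Y = Y'" "y \<in> Y"
  shows "B.root (h y) \<longleftrightarrow> A.root y"
  unfolding A.root_def B.root_def
  using assms h_in h_eq_iff A.closed by (auto simp flip: assms(1) h_alpha)

lemma normal_h_iff:
  assumes "h ` Y = Y'"
  shows "B.normal \<longleftrightarrow> A.normal"
proof -
  have "h y \<in> \<alpha>' n ` Y' \<longleftrightarrow> y \<in> \<alpha> n ` Y" if y: "y \<in> Y" for y n
  proof
    assume "h y \<in> \<alpha>' n ` Y'"
    then obtain z where "z \<in> Y" "h y = \<alpha>' n (h z)" using assms by blast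
    then show "y \<in> \<alpha> n ` Y" using y by (auto simp: h_eq_iff A.closed simp flip: h_alpha)
  next
    assume "y \<in> \<alpha> n ` Y"
    then show "h y \<in> \<alpha>' n ` Y'" using h_alpha h_in by auto
  qed
  then show ?thesis
    unfolding A.normal_def B.normal_def by (simp add: lab_h flip: assms)
qed

end

context isomorphism
begin

lemma saturated_transfer:
  assumes "scs_saturated S"
  shows "scs_saturated S'"
  unfolding scs_saturated_def
proof (intro allI equalityI subsetI)
  fix n z assume "z \<in> tower S' n"
  then show "z \<in> {z \<in> Yinf S'. pshift S' n z = z}"
    by (auto simp: tower_def S'.pshift_germ_level S'.germ_in)
next
  fix n z assume "z \<in> {z \<in> Yinf S'. pshift S' n z = z}"
  then have z: "z \<in> lift S' U ` Yinf S" "pshift S' n z = z" unfolding lift_surj by simp_all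
  then obtain y where y: "y \<in> Yinf S" "z = lift S' U y" by (elim imageE)
  then have "pshift S' n (lift S' U y) = lift S' U y" using z(2) by simp
  then have "pshift S n y = y" using hom.h_eq_iff S.closed y(1) by (simp flip: hom.h_alpha)
  then have "y \<in> tower S n" using assms y(1) by (auto simp: scs_saturated_def)
  then obtain x where "x \<in> lev S n" "y = germ S n x" by (auto simp: tower_def)
  then show "z \<in> tower S' n" using y lift_germ U_in by (auto simp: tower_def)
qed

end

text \<open>The way back from unions to levels. A germ from level \<open>n\<close> has its label
  inside \<open>{..<n}\<close>, \<open>h\<close> keeps labels, and saturation of \<open>S'\<close>
  then yields a representative at level \<open>n\<close>. Surjectivity on levels is the same
  argument backwards, with saturation of \<open>S\<close>.\<close>

lemma ex_embedding_of_hom: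
  assumes "is_scs S" "is_scs S'" "scs_saturated S'" and
    "pshifts_hom (Yinf S) (pshift S) (Yinf S') (pshift S') h"
  shows "\<exists>g. scs_embedding g S S' \<and> (\<forall>n. \<forall>x\<in>lev S n. germ S' n (g n x) = h (germ S n x)) \<and>
    (scs_saturated S \<and> h ` Yinf S = Yinf S' \<longrightarrow> is_scs_iso g S S')"
proof -
  interpret S: semicosimplicial S by unfold_locales (rule assms)
  interpret S': saturated S' by unfold_locales (rule assms)+
  interpret hom: pshifts_hom "Yinf S" "pshift S" "Yinf S'" "pshift S'" h by (rule assms)
  define g where "g n x = (SOME z. z \<in> lev S' n \<and> germ S' n z = h (germ S n x))" for n x
  have g: "g n x \<in> lev S' n \<and> germ S' n (g n x) = h (germ S n x)" if x: "x \<in> lev S n" for n x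
    unfolding g_def
  proof (rule someI_ex)
    have "S.lab (germ S n x) \<subseteq> {..<n}" using S.pshift_germ_level S.fixed_iff S.germ_in x by simp
    then have "S'.lab (h (germ S n x)) \<subseteq> {..<n}" using hom.lab_h S.germ_in x by simp
    then show "\<exists>z. z \<in> lev S' n \<and> germ S' n z = h (germ S n x)"
      using S'.ex_germ_iff hom.h_in S.germ_in x by metis
  qed
  have "inj_on (g n) (lev S n)" for n
    using g S.germ_inject hom.h_eq_iff S.germ_in by (metis inj_onI)
  moreover have eq: "g (Suc n) (cof S n i x) = cof S' n i (g n x)" if i: "i \<le> n" "x \<in> lev S n" for n i x
  proof -
    have "germ S' (Suc n) (g (Suc n) (cof S n i x)) = germ S' (Suc n) (cof S' n i (g n x))"
      using g[OF i(2)] g[OF S.cof_in[OF i]] i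
      by (simp add: S.germ_in hom.h_alpha flip: S.pshift_germ S'.pshift_germ)
    moreover have "g (Suc n) (cof S n i x) \<in> lev S' (Suc n)" using g S.cof_in[OF i] by blast
    moreover have "cof S' n i (g n x) \<in> lev S' (Suc n)" using g S'.cof_in i by blast
    ultimately show ?thesis using S'.germ_inject by blast
  qed
  ultimately have emb: "scs_embedding g S S'"
    using g by (subst scs_embedding_iff[OF assms(1,2)]) auto
  have "is_scs_iso g S S'" if sat: "scs_saturated S" and surj: "h ` Yinf S = Yinf S'"
  proof -
    interpret S: saturated S by unfold_locales (rule sat)
    have "lev S' n \<subseteq> g n ` lev S n" for n
    proof
      fix z assume z: "z \<in> lev S' n"
      then obtain y where y: "y \<in> Yinf S" "germ S' n z = h y" using surj S'.germ_in by blast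
      then have "S.lab y \<subseteq> {..<n}" using S'.lab_germ[OF z] hom.lab_h by simp
      then obtain x where "x \<in> lev S n" "y = germ S n x" using S.ex_germ_iff y(1) by blast
      then have "z = g n x" using g y z S'.germ_inject by metis
      then show "z \<in> g n ` lev S n" using \<open>x \<in> lev S n\<close> by blast
    qed
    then show ?thesis
      unfolding is_scs_iso_def bij_betw_def using emb eq scs_embedding_iff[OF assms(1,2), of g] by blast
  qed
  then show ?thesis using emb g by blast
qed

section \<open>The SCS of an abstract system of partial shifts\<close>

definition pshifts_scs :: "'y set \<Rightarrow> (nat \<Rightarrow> 'y \<Rightarrow> 'y) \<Rightarrow> 'y scs" where
  "pshifts_scs Y \<alpha> = \<lparr>lev = \<lambda>n. {y \<in> Y. \<alpha> n y = y}, cof = \<lambda>n i. \<alpha> i\<rparr>"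

text \<open>Levels are fixed point sets, as saturation dictates, so the top coface maps are literal
  inclusions.\<close>

lemma push_pshifts_scs:
  assumes "y \<in> Y" "\<And>d. \<alpha> (n + d) y = y"
  shows "push (pshifts_scs Y \<alpha>) n d y = y"
  using assms by (induction d) (simp_all add: pshifts_scs_def)

context pshifts
begin

lemma is_scs_pshifts_scs: "is_scs (pshifts_scs Y \<alpha>)"
  unfolding is_scs_def
proof (intro conjI allI impI)
  fix n i :: nat assume i: "i \<le> n"
  show "cof (pshifts_scs Y \<alpha>) n i ` lev (pshifts_scs Y \<alpha>) n \<subseteq> lev (pshifts_scs Y \<alpha>) (Suc n)"
    using i rel[of i "Suc n"] closed by (auto simp: pshifts_scs_def)
  show "inj_on (cof (pshifts_scs Y \<alpha>) n i) (lev (pshifts_scs Y \<alpha>) n)"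
    using inj[of i] by (auto simp: pshifts_scs_def intro: inj_on_subset)
qed (auto simp: pshifts_scs_def rel)

text \<open>The identification of the system with the union of its tower; the level chosen is
  immaterial by \<open>pgerm_eq\<close>.\<close>

definition pgerm :: "'y \<Rightarrow> (nat \<times> 'y) set" where
  "pgerm y = germ (pshifts_scs Y \<alpha>) (SOME n. \<alpha> n y = y) y"

lemma in_lev_pshifts_scs: "y \<in> lev (pshifts_scs Y \<alpha>) n \<longleftrightarrow> y \<in> Y \<and> \<alpha> n y = y"
  by (simp add: pshifts_scs_def)

lemma germ_pshifts_scs:
  assumes "y \<in> lev (pshifts_scs Y \<alpha>) n" "z \<in> lev (pshifts_scs Y \<alpha>) m"
  shows "germ (pshifts_scs Y \<alpha>) n y = germ (pshifts_scs Y \<alpha>) m z \<longleftrightarrow> y = z"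
proof -
  interpret P: semicosimplicial "pshifts_scs Y \<alpha>" by unfold_locales (rule is_scs_pshifts_scs)
  have "push (pshifts_scs Y \<alpha>) n d y = y" if "y \<in> lev (pshifts_scs Y \<alpha>) n" for n d y
  proof (rule push_pshifts_scs)
    show "y \<in> Y" using that by (simp add: in_lev_pshifts_scs)
    show "\<alpha> (n + d) y = y" for d using that fixed_ge[of y n "n + d"] by (simp add: in_lev_pshifts_scs)
  qed
  then show ?thesis using P.germ_eq_iff[OF assms, of m n] assms by simp
qed

lemma pgerm_eq:
  assumes "y \<in> Y" "\<alpha> n y = y"
  shows "pgerm y = germ (pshifts_scs Y \<alpha>) n y"
proof -
  have "\<alpha> (SOME n. \<alpha> n y = y) y = y" using assms(2) by (rule someI)
  then show ?thesis unfolding pgerm_def using assms germ_pshifts_scs by (simp add: in_lev_pshifts_scs)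
qed

lemma pgerm_hom: "pshifts_hom Y \<alpha> (Yinf (pshifts_scs Y \<alpha>)) (pshift (pshifts_scs Y \<alpha>)) pgerm"
proof -
  interpret P: semicosimplicial "pshifts_scs Y \<alpha>" by unfold_locales (rule is_scs_pshifts_scs)
  show ?thesis
  proof
    fix y assume y: "y \<in> Y"
    obtain m where m: "\<alpha> m y = y" using fin y by blast
    show "pgerm y \<in> Yinf (pshifts_scs Y \<alpha>)" using pgerm_eq[OF y m] m y P.germ_in in_lev_pshifts_scs by simp
    fix i
    \<comment> \<open>A level that contains \<open>y\<close> and also has a coface map of index
      \<open>i\<close>.\<close>
    define n where "n = max m i"
    have n: "\<alpha> n y = y" using fixed_ge y m n_def by simp
    have "\<alpha> (Suc n) (\<alpha> i y) = \<alpha> i y" using rel[of i "Suc n" y] n y by (simp add: n_def)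
    then show "pgerm (\<alpha> i y) = pshift (pshifts_scs Y \<alpha>) i (pgerm y)"
      using pgerm_eq[OF y n] pgerm_eq[of "\<alpha> i y" "Suc n"] P.pshift_germ[of i n y] n y closed
      by (simp add: in_lev_pshifts_scs n_def) (simp add: pshifts_scs_def)
  next
    show "inj_on pgerm Y"
    proof (rule inj_onI)
      fix y z assume y: "y \<in> Y" and z: "z \<in> Y" and e: "pgerm y = pgerm z"
      obtain m n where "\<alpha> m y = y" "\<alpha> n z = z" using fin y z by blast
      then show "y = z" using e y z germ_pshifts_scs[of y m z n] pgerm_eq in_lev_pshifts_scs by simp
    qed
  qed
qed

lemma pgerm_surj: "pgerm ` Y = Yinf (pshifts_scs Y \<alpha>)"
proof -
  interpret P: semicosimplicial "pshifts_scs Y \<alpha>" by unfold_locales (rule is_scs_pshifts_scs)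
  interpret hom: pshifts_hom Y \<alpha> "Yinf (pshifts_scs Y \<alpha>)" "pshift (pshifts_scs Y \<alpha>)" pgerm
    by (rule pgerm_hom)
  show ?thesis
  proof (intro equalityI subsetI)
    fix z assume "z \<in> Yinf (pshifts_scs Y \<alpha>)"
    then obtain n y where "y \<in> lev (pshifts_scs Y \<alpha>) n" "z = germ (pshifts_scs Y \<alpha>) n y"
      using P.obtain_germ by blast
    then show "z \<in> pgerm ` Y" using pgerm_eq in_lev_pshifts_scs by (metis image_eqI)
  qed (use hom.h_in in blast)
qed

lemma saturated_pshifts_scs: "scs_saturated (pshifts_scs Y \<alpha>)"
proof -
  interpret P: semicosimplicial "pshifts_scs Y \<alpha>" by unfold_locales (rule is_scs_pshifts_scs)
  interpret hom: pshifts_hom Y \<alpha> "Yinf (pshifts_scs Y \<alpha>)" "pshift (pshifts_scs Y \<alpha>)" pgerm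
    by (rule pgerm_hom)
  show ?thesis
    unfolding scs_saturated_def
  proof (intro allI equalityI subsetI)
    fix n z assume "z \<in> tower (pshifts_scs Y \<alpha>) n"
    then show "z \<in> {z \<in> Yinf (pshifts_scs Y \<alpha>). pshift (pshifts_scs Y \<alpha>) n z = z}"
      by (auto simp: tower_def P.pshift_germ_level P.germ_in)
  next
    fix n z assume "z \<in> {z \<in> Yinf (pshifts_scs Y \<alpha>). pshift (pshifts_scs Y \<alpha>) n z = z}"
    then have z: "z \<in> pgerm ` Y" "pshift (pshifts_scs Y \<alpha>) n z = z" unfolding pgerm_surj by simp_all
    then obtain y where y: "y \<in> Y" "z = pgerm y" by (elim imageE)
    then have "pshift (pshifts_scs Y \<alpha>) n (pgerm y) = pgerm y" using z(2) by simp
    then have "\<alpha> n y = y" using hom.h_eq_iff closed y(1) by (simp flip: hom.h_alpha)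
    then show "z \<in> tower (pshifts_scs Y \<alpha>) n"
      using y pgerm_eq in_lev_pshifts_scs by (auto simp: tower_def)
  qed
qed

end

section \<open>Normality\<close>

lemma ell2_map_apply:
  assumes "inj_on d A" "x \<in> A"
  shows "ell2_map A d f (d x) = f x"
proof -
  have "{x' \<in> A. d x' = d x} = {x}" using assms by (auto dest: inj_onD)
  then show ?thesis by (simp add: ell2_map_def)
qed

lemma ell2_map_outside:
  assumes "z \<notin> d ` A"
  shows "ell2_map A d f z = 0"
proof -
  have "{x \<in> A. d x = z} = {}" using assms by auto
  then show ?thesis unfolding ell2_map_def by (simp only: sum.empty)
qed

lemma ell2_map_in_ell2:
  assumes d: "inj_on d A" "d ` A \<subseteq> B" and f: "f \<in> ell2 A"
  shows "ell2_map A d f \<in> ell2 B"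
proof -
  have "(\<lambda>x. (cmod (ell2_map A d f (d x)))\<^sup>2) summable_on A"
    using f ell2_map_apply[OF d(1)] by (simp add: ell2_def cong: summable_on_cong)
  then have "(\<lambda>z. (cmod (ell2_map A d f z))\<^sup>2) summable_on d ` A"
    by (subst summable_on_reindex[OF d(1)]) (simp add: o_def)
  moreover have "(\<lambda>z. (cmod (ell2_map A d f z))\<^sup>2) summable_on B \<longleftrightarrow>
      (\<lambda>z. (cmod (ell2_map A d f z))\<^sup>2) summable_on d ` A"
    by (rule summable_on_cong_neutral) (use d(2) ell2_map_outside in auto)
  moreover have "ell2_map A d f z = 0" if "z \<notin> B" for z
    by (rule ell2_map_outside) (use that d(2) in blast)
  ultimately show ?thesis by (simp add: ell2_def)
qed

definition unit_vec :: "'a \<Rightarrow> 'a \<Rightarrow> complex" where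
  "unit_vec x = (\<lambda>y. if y = x then 1 else 0)"

lemma unit_vec_in_ell2:
  assumes "x \<in> A"
  shows "unit_vec x \<in> ell2 A"
proof -
  have "(\<lambda>y. (cmod (unit_vec x y))\<^sup>2) summable_on {x}" by simp
  then have "(\<lambda>y. (cmod (unit_vec x y))\<^sup>2) summable_on A"
    by (subst summable_on_cong_neutral[where T = "{x}" and g = "\<lambda>y. (cmod (unit_vec x y))\<^sup>2"])
      (use assms in \<open>auto simp: unit_vec_def\<close>)
  then show ?thesis using assms by (auto simp: ell2_def unit_vec_def)
qed

lemma ell2_inner_unit_vec:
  assumes "x \<in> A"
  shows "ell2_inner A (unit_vec x) h = h x"
proof -
  have "ell2_inner A (unit_vec x) h = (\<Sum>\<^sub>\<infinity>y\<in>{x}. cnj (unit_vec x y) * h y)"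
    unfolding ell2_inner_def by (rule infsum_cong_neutral) (use assms in \<open>auto simp: unit_vec_def\<close>)
  then show ?thesis by (simp add: unit_vec_def)
qed

text \<open>The adjoint of the isometry is composition with \<open>d\<close>: reindexing along
  \<open>d\<close> gives the adjunction, and pairing with basis vectors gives the uniqueness that
  the definite description needs.\<close>

lemma ell2_adjoint_map:
  assumes d: "inj_on d A" "d ` A \<subseteq> B" and g: "g \<in> ell2 B"
  shows "ell2_adjoint A B (ell2_map A d) g = (\<lambda>x. if x \<in> A then g (d x) else 0)"
  unfolding ell2_adjoint_def
proof (rule the_equality)
  let ?h = "\<lambda>x. if x \<in> A then g (d x) else 0"
  have "(\<lambda>z. (cmod (g z))\<^sup>2) summable_on d ` A"
    using g d(2) unfolding ell2_def by (auto intro: summable_on_subset_banach)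
  then have "(\<lambda>x. (cmod (g (d x)))\<^sup>2) summable_on A"
    by (subst (asm) summable_on_reindex[OF d(1)]) (simp add: o_def)
  then have h: "?h \<in> ell2 A" unfolding ell2_def by (simp cong: summable_on_cong)
  have inner: "ell2_inner B (ell2_map A d f) g = ell2_inner A f ?h" for f
  proof -
    have "ell2_inner B (ell2_map A d f) g = (\<Sum>\<^sub>\<infinity>z\<in>d ` A. cnj (ell2_map A d f z) * g z)"
      unfolding ell2_inner_def by (rule infsum_cong_neutral) (use d(2) ell2_map_outside in auto)
    also have "\<dots> = (\<Sum>\<^sub>\<infinity>x\<in>A. cnj (ell2_map A d f (d x)) * g (d x))"
      using infsum_reindex[OF d(1)] by (simp add: o_def)
    also have "\<dots> = ell2_inner A f ?h"
      unfolding ell2_inner_def by (rule infsum_cong) (simp add: ell2_map_apply[OF d(1)])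
    finally show ?thesis .
  qed
  show "?h \<in> ell2 A \<and> (\<forall>f\<in>ell2 A. ell2_inner B (ell2_map A d f) g = ell2_inner A f ?h)"
    using h inner by blast
  fix h' assume h': "h' \<in> ell2 A \<and> (\<forall>f\<in>ell2 A. ell2_inner B (ell2_map A d f) g = ell2_inner A f h')"
  show "h' = ?h"
  proof
    fix x
    show "h' x = ?h x"
    proof (cases "x \<in> A")
      case True
      have "ell2_inner A (unit_vec x) h' = ell2_inner A (unit_vec x) ?h"
        using h' inner unit_vec_in_ell2[OF True] by metis
      then show ?thesis using True by (simp add: ell2_inner_unit_vec)
    next
      case False
      then show ?thesis using h' by (simp add: ell2_def)
    qed
  qed
qed

context semicosimplicial
begin

lemma cof_inj: "i \<le> n \<Longrightarrow> inj_on (cof S n i) (lev S n)"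
  using scs by (simp add: is_scs_def)

lemma cof_image: "i \<le> n \<Longrightarrow> cof S n i ` lev S n \<subseteq> lev S (Suc n)"
  using cof_in by blast

lemma hcof_adj_eq:
  assumes "i \<le> n" "g \<in> ell2 (lev S (Suc n))"
  shows "hcof_adj S n i g = (\<lambda>x. if x \<in> lev S n then g (cof S n i x) else 0)"
  unfolding hcof_adj_def hcof_def using ell2_adjoint_map[OF cof_inj cof_image] assms by blast

lemma hcof_in_ell2: "i \<le> n \<Longrightarrow> f \<in> ell2 (lev S n) \<Longrightarrow> hcof S n i f \<in> ell2 (lev S (Suc n))"
  unfolding hcof_def using ell2_map_in_ell2[OF cof_inj cof_image] by blast

text \<open>Evaluating the operator identity on basis vectors turns normality into the condition that
  the squares of coface maps are pullbacks.\<close>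

lemma scs_normal_iff_pullback:
  "scs_normal S \<longleftrightarrow>
    (\<forall>k i j z w. i < j \<and> j \<le> Suc k \<and> z \<in> lev S (Suc k) \<and> w \<in> lev S (Suc k) \<and>
       cof S (Suc k) i z = cof S (Suc k) j w \<longrightarrow>
       (\<exists>x\<in>lev S k. z = cof S k (j - 1) x \<and> w = cof S k i x))" (is "_ \<longleftrightarrow> ?R")
proof
  assume N: "scs_normal S"
  show ?R
  proof (intro allI impI)
    fix k i j z w
    assume *: "i < j \<and> j \<le> Suc k \<and> z \<in> lev S (Suc k) \<and> w \<in> lev S (Suc k) \<and>
       cof S (Suc k) i z = cof S (Suc k) j w"
    then have ij: "i < j" "j \<le> Suc k" "i \<le> k" "j - 1 \<le> k" by auto
    have e: "unit_vec w \<in> ell2 (lev S (Suc k))" using * by (simp add: unit_vec_in_ell2)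
    \<comment> \<open>The identity is applied to the basis vector at \<open>w\<close> and evaluated
      at \<open>z\<close>. The right-hand side is 1 because the two images agree, so
      \<open>z\<close> must lie in the range of \<open>cof S k (j - 1)\<close>.\<close>
    have "hcof S k (j - 1) (hcof_adj S k i (unit_vec w)) z =
        hcof_adj S (Suc k) i (hcof S (Suc k) j (unit_vec w)) z"
      using N ij e unfolding scs_normal_def by metis
    also have "\<dots> = hcof S (Suc k) j (unit_vec w) (cof S (Suc k) j w)"
      using hcof_adj_eq[of i "Suc k"] hcof_in_ell2[OF ij(2) e] ij * by simp
    also have "\<dots> = 1"
      using ell2_map_apply[OF cof_inj[OF ij(2)], of w] * by (simp add: hcof_def unit_vec_def)
    finally have "hcof S k (j - 1) (hcof_adj S k i (unit_vec w)) z \<noteq> 0" by simp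
    then have "z \<in> cof S k (j - 1) ` lev S k" unfolding hcof_def using ell2_map_outside by metis
    then obtain x where x: "x \<in> lev S k" "z = cof S k (j - 1) x" by blast
    then have "cof S (Suc k) j (cof S k i x) = cof S (Suc k) j w" using * cof_cof ij by simp
    then have "cof S k i x = w" using cof_eq_iff ij(2) cof_in[OF ij(3) x(1)] * by blast
    then show "\<exists>x\<in>lev S k. z = cof S k (j - 1) x \<and> w = cof S k i x" using x by blast
  qed
next
  assume R: ?R
  show "scs_normal S"
    unfolding scs_normal_def
  proof (intro allI impI ballI ext)
    fix k i j f z assume ij': "i < j \<and> j \<le> Suc k" and f: "f \<in> ell2 (lev S (Suc k))"
    then have ij: "i < j" "j \<le> Suc k" "i \<le> k" "j - 1 \<le> k" "i \<le> Suc k" by auto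
    have adj: "hcof_adj S k i f = (\<lambda>x. if x \<in> lev S k then f (cof S k i x) else 0)"
      using hcof_adj_eq ij f by blast
    have adj': "hcof_adj S (Suc k) i (hcof S (Suc k) j f) =
        (\<lambda>x. if x \<in> lev S (Suc k) then hcof S (Suc k) j f (cof S (Suc k) i x) else 0)"
      using hcof_adj_eq hcof_in_ell2 ij f by blast
    show "hcof S k (j - 1) (hcof_adj S k i f) z = hcof_adj S (Suc k) i (hcof S (Suc k) j f) z"
    proof (cases "z \<in> cof S k (j - 1) ` lev S k")
      case True
      then obtain x where x: "x \<in> lev S k" "z = cof S k (j - 1) x" by blast
      have z: "z \<in> lev S (Suc k)" using x cof_in ij by simp
      have "cof S (Suc k) i z = cof S (Suc k) j (cof S k i x)" using x cof_cof ij by simp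
      then show ?thesis
        using x z ell2_map_apply[OF cof_inj[OF ij(4)] x(1)] ell2_map_apply[OF cof_inj[OF ij(2)] cof_in[OF ij(3) x(1)]]
        unfolding adj adj' by (simp add: hcof_def)
    next
      case False
      \<comment> \<open>Off the range of \<open>cof S k (j - 1)\<close> the left-hand side vanishes;
        were \<open>cof S (Suc k) i z\<close> in the range of \<open>cof S (Suc k) j\<close>, the
        pullback condition would put \<open>z\<close> into that range.\<close>
      have "hcof S (Suc k) j f (cof S (Suc k) i z) = 0" if z: "z \<in> lev S (Suc k)"
      proof -
        have "cof S (Suc k) i z \<notin> cof S (Suc k) j ` lev S (Suc k)"
        proof
          assume "cof S (Suc k) i z \<in> cof S (Suc k) j ` lev S (Suc k)"
          then obtain w where "w \<in> lev S (Suc k)" "cof S (Suc k) i z = cof S (Suc k) j w" by blast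
          then show False using R ij z False by blast
        qed
        then show ?thesis unfolding hcof_def by (rule ell2_map_outside)
      qed
      then show ?thesis using ell2_map_outside[OF False] unfolding adj' by (simp add: hcof_def)
    qed
  qed
qed

end

context saturated
begin

text \<open>The pullback condition for the indices \<open>n\<close>, \<open>Suc n\<close> and twice
  the same element removes a zero at \<open>n\<close>. Conversely, an \<open>i\<close>-th shift
  equal to the \<open>j\<close>-th shift of \<open>y\<close> with \<open>i < j\<close> reveals a
  zero of \<open>lab y\<close> at \<open>i\<close>; undoing it shortens the label by one entry, so
  by saturation the preimage lies one level lower.\<close>

lemma scs_normal_iff: "scs_normal S \<longleftrightarrow> normal"
proof
  assume N: "scs_normal S"
  show normal
    unfolding normal_def
  proof (intro ballI allI impI)
    fix y n assume y: "y \<in> Yinf S" and n: "n \<notin> lab y"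
    \<comment> \<open>At level \<open>m\<close> both shifts \<open>n\<close> and
      \<open>Suc n\<close> are given by coface maps.\<close>
    obtain m x where m: "Suc n \<le> m" "x \<in> lev S m" "y = germ S m x" using obtain_germ_ge[OF y] .
    then obtain k where k: "m = Suc k" "n \<le> k" by (cases m) auto
    have "germ S (Suc m) (cof S m n x) = germ S (Suc m) (cof S m (Suc n) x)"
      using n m by (simp add: lab_def pshift_germ)
    then have "cof S m n x = cof S m (Suc n) x" using germ_inject m cof_in by simp
    then obtain x' where x': "x' \<in> lev S k" "x = cof S k n x'"
      using N m k unfolding scs_normal_iff_pullback by (metis le_SucI lessI)
    then have "y = pshift S n (germ S k x')" using m k by (simp add: pshift_germ)
    then show "y \<in> pshift S n ` Yinf S" using germ_in x' by blast
  qed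
next
  assume N: normal
  show "scs_normal S"
    unfolding scs_normal_iff_pullback
  proof (intro allI impI)
    fix k i j z w
    assume *: "i < j \<and> j \<le> Suc k \<and> z \<in> lev S (Suc k) \<and> w \<in> lev S (Suc k) \<and>
       cof S (Suc k) i z = cof S (Suc k) j w"
    then have ij: "i < j" "j \<le> Suc k" "i \<le> k" "j - 1 \<le> k" "i \<le> Suc k" by auto
    define y where "y = germ S (Suc k) w"
    have y: "y \<in> Yinf S" using * germ_in by (simp add: y_def)
    have "pshift S i (germ S (Suc k) z) = pshift S j y" using * ij by (simp add: y_def pshift_germ)
    then have "i \<notin> lab (pshift S j y)"
      using lab_alpha[of "germ S (Suc k) z" i] * germ_in not_in_label_shift by metis
    then have "i \<notin> lab y" using lab_alpha[OF y] ij(1) by (simp add: label_shift_def)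
    then obtain y' where y': "y' \<in> Yinf S" "y = pshift S i y'" using N y unfolding normal_def by blast
    have ly: "lab y \<subseteq> {..<Suc k}" unfolding y_def by (rule lab_germ) (use * in blast)
    have "lab y' \<subseteq> {..<k}"
    proof
      fix p assume "p \<in> lab y'"
      then have "skip i p \<in> lab y" using lab_alpha[OF y'(1)] y'(2) skip_in_label_shift by simp
      then have "skip i p < Suc k" using ly by blast
      then show "p \<in> {..<k}" using ij(3) by (auto simp: skip_def split: if_splits)
    qed
    then obtain x where x: "x \<in> lev S k" "y' = germ S k x" using ex_germ_iff y'(1) by blast
    then have "germ S (Suc k) w = germ S (Suc k) (cof S k i x)"
      using y'(2) ij by (simp add: y_def pshift_germ)
    then have w: "w = cof S k i x" using germ_inject cof_in[OF ij(3) x(1)] * by blast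
    have "cof S (Suc k) i (cof S k (j - 1) x) = cof S (Suc k) i z" using * w cof_cof ij x by simp
    then have "cof S k (j - 1) x = z" using cof_eq_iff ij(5) cof_in[OF ij(4) x(1)] * by blast
    then show "\<exists>x\<in>lev S k. z = cof S k (j - 1) x \<and> w = cof S k i x" using w x by blast
  qed
qed

end

context pshifts
begin

lemma scs_normal_pshifts_scs: "scs_normal (pshifts_scs Y \<alpha>) \<longleftrightarrow> normal"
proof -
  interpret P: saturated "pshifts_scs Y \<alpha>"
    by unfold_locales (rule is_scs_pshifts_scs saturated_pshifts_scs)+
  interpret hom: pshifts_hom Y \<alpha> "Yinf (pshifts_scs Y \<alpha>)" "pshift (pshifts_scs Y \<alpha>)" pgerm
    by (rule pgerm_hom)
  show ?thesis using P.scs_normal_iff hom.normal_h_iff[OF pgerm_surj] by simp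
qed

end

section \<open>The SCSs \<open>Lambda k\<close> and \<open>Lambda_above k u\<close>\<close>

lemma label_level_le_iff:
  assumes "finite v"
  shows "label_level v \<le> int n - 1 \<longleftrightarrow> v \<subseteq> {..<n}"
proof (cases "v = {}")
  case False
  have "label_level v \<le> int n - 1 \<longleftrightarrow> Max v < n" using False by (auto simp: label_level_def)
  also have "\<dots> \<longleftrightarrow> (\<forall>p\<in>v. p < n)" using assms False by (rule Max_less_iff)
  finally show ?thesis by blast
qed (simp add: label_level_def)

lemma Lambda_eq: "Lambda k = pshifts_scs (rank_labels k) label_shift"
proof -
  have "label_level v \<le> int n - 1 \<longleftrightarrow> label_shift n v = v" if "v \<in> rank_labels k" for v n
    using that label_level_le_iff label_shift_fixed_iff by (simp add: rank_labels_def)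
  then have "(\<lambda>n. {v \<in> rank_labels k. label_level v \<le> int n - 1}) =
      (\<lambda>n. {v \<in> rank_labels k. label_shift n v = v})" by (intro ext Collect_cong) blast
  then show ?thesis by (simp add: Lambda_def pshifts_scs_def)
qed

definition labels_above :: "nat \<Rightarrow> nat set \<Rightarrow> nat set set" where
  "labels_above k u = {v \<in> rank_labels k. label_le u v}"

lemma Lambda_above_eq: "Lambda_above k u = pshifts_scs (labels_above k u) label_shift"
  unfolding Lambda_above_def Lambda_eq by (simp add: pshifts_scs_def labels_above_def conj_ac)

interpretation above: pshifts "labels_above k u" label_shift for k u
  by (rule pshifts_labels)
    (auto simp: labels_above_def rank_labels_def intro: label_le_trans[OF _ label_le_label_shift])

lemma labels_above_initial: "labels_above k {..<k} = rank_labels k"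
  using label_le_initial by (auto simp: labels_above_def)

lemma Lambda_above_initial: "Lambda_above k {..<k} = Lambda k"
  by (simp add: Lambda_above_eq Lambda_eq labels_above_initial)

interpretation Lambda: saturated "Lambda k" for k
  unfolding Lambda_eq
  by unfold_locales (rule labels.is_scs_pshifts_scs labels.saturated_pshifts_scs)+

interpretation Lambda_above: saturated "Lambda_above k u" for k u
  unfolding Lambda_above_eq
  by unfold_locales (rule above.is_scs_pshifts_scs above.saturated_pshifts_scs)+

lemma sub_scs_Lambda_above: "sub_scs (Lambda_above k u) (Lambda k)"
  unfolding sub_scs_def using Lambda_above.scs by (auto simp: Lambda_above_def)

lemma scs_normal_Lambda: "scs_normal (Lambda k)"
  unfolding Lambda_eq using labels.scs_normal_pshifts_scs labels_normal by blast

lemma germ_Lambda: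
  assumes "v \<in> lev (Lambda k) n"
  shows "germ (Lambda k) n v = labels.pgerm k v"
  using assms labels.pgerm_eq[of v k n] unfolding Lambda_eq labels.in_lev_pshifts_scs by simp

interpretation Lambda_hom: pshifts_hom "rank_labels k" label_shift "Yinf (Lambda k)" "pshift (Lambda k)" "labels.pgerm k" for k
  unfolding Lambda_eq by (rule labels.pgerm_hom)

lemma in_lev_Lambda: "v \<in> lev (Lambda k) n \<longleftrightarrow> v \<in> rank_labels k \<and> v \<subseteq> {..<n}"
  using label_shift_fixed_iff[of v n] unfolding Lambda_eq labels.in_lev_pshifts_scs
  by (auto simp: rank_labels_def)

lemma lab_germ_Lambda: "v \<in> lev (Lambda k) n \<Longrightarrow> Lambda.lab k (germ (Lambda k) n v) = v"
  using Lambda_hom.lab_h[of v k] by (simp add: germ_Lambda in_lev_Lambda)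

lemma roots_Lambda: "roots (Lambda k) = {germ (Lambda k) k {..<k}}"
proof -
  have s: "labels.pgerm k ` rank_labels k = Yinf (Lambda k)" unfolding Lambda_eq by (rule labels.pgerm_surj)
  have "{y. Lambda.root k y} = labels.pgerm k ` {v. labels.root k v}"
  proof (intro equalityI subsetI)
    fix y assume "y \<in> {y. Lambda.root k y}"
    then have y: "Lambda.root k y" by simp
    then have "y \<in> labels.pgerm k ` rank_labels k" unfolding s by (simp add: Lambda.root_def)
    then obtain v where "v \<in> rank_labels k" "y = labels.pgerm k v" by blast
    then show "y \<in> labels.pgerm k ` {v. labels.root k v}" using y Lambda_hom.root_h_iff[OF s] by blast
  next
    fix y assume "y \<in> labels.pgerm k ` {v. labels.root k v}"
    then obtain v where v: "labels.root k v" "y = labels.pgerm k v" by blast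
    then have "v \<in> rank_labels k" by (simp add: labels.root_def)
    then show "y \<in> {y. Lambda.root k y}" using v Lambda_hom.root_h_iff[OF s] by blast
  qed
  also have "\<dots> = {labels.pgerm k {..<k}}" by (simp add: labels_root_iff)
  finally show ?thesis
    using germ_Lambda[of "{..<k}" k k] initial_in_rank_labels by (simp add: Lambda.roots_eq in_lev_Lambda)
qed

section \<open>Roots and layers\<close>

lemma is_scs_iso_inverse:
  assumes S: "is_scs S" and U: "is_scs_iso U S S'"
  shows "is_scs_iso (\<lambda>n. inv_into (lev S n) (U n)) S' S"
proof -
  interpret S: semicosimplicial S by unfold_locales (rule S)
  have bij: "bij_betw (U n) (lev S n) (lev S' n)" for n using U by (simp add: is_scs_iso_def)
  have "inv_into (lev S (Suc n)) (U (Suc n)) (cof S' n i w) = cof S n i (inv_into (lev S n) (U n) w)"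
    if i: "i \<le> n" and w: "w \<in> lev S' n" for n i w
  proof -
    obtain x where x: "x \<in> lev S n" "w = U n x" using w bij[of n] unfolding bij_betw_def by blast
    have "cof S' n i w = U (Suc n) (cof S n i x)" using U i x by (simp add: is_scs_iso_def)
    then show ?thesis using bij_betw_inv_into_left[OF bij] x S.cof_in[OF i x(1)] by simp
  qed
  then show ?thesis using bij_betw_inv_into[OF bij] by (simp add: is_scs_iso_def)
qed

lemma scs_isomorphic_sym: "is_scs S \<Longrightarrow> scs_isomorphic S S' \<Longrightarrow> scs_isomorphic S' S"
  unfolding scs_isomorphic_def using is_scs_iso_inverse by blast

lemma is_scs_iso_comp:
  assumes U: "is_scs_iso U S S'" and V: "is_scs_iso V S' S''"
  shows "is_scs_iso (\<lambda>n x. V n (U n x)) S S''"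
proof -
  have "bij_betw (V n \<circ> U n) (lev S n) (lev S'' n)" for n
    using U V unfolding is_scs_iso_def by (blast intro: bij_betw_trans)
  moreover have "U n x \<in> lev S' n" if "x \<in> lev S n" for n x
    using U that unfolding is_scs_iso_def bij_betw_def by blast
  ultimately show ?thesis using U V by (simp add: is_scs_iso_def o_def)
qed

lemma scs_isomorphic_trans: "scs_isomorphic S S' \<Longrightarrow> scs_isomorphic S' S'' \<Longrightarrow> scs_isomorphic S S''"
  unfolding scs_isomorphic_def using is_scs_iso_comp by blast

locale saturated_isomorphism = S: saturated S + S': saturated S' + isomorphism S S' U
  for S :: "'a scs" and S' :: "'b scs" and U
begin

lemma scs_normal_transfer: "scs_normal S' \<longleftrightarrow> scs_normal S"
  using hom.normal_h_iff[OF lift_surj] S.scs_normal_iff S'.scs_normal_iff by simp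

lemma roots_transfer: "roots S' = lift S' U ` roots S"
proof -
  have "z \<in> roots S' \<longleftrightarrow> z \<in> lift S' U ` roots S" for z
  proof
    assume "z \<in> roots S'"
    then have z: "S'.root z" by (simp add: S'.roots_eq)
    then have "z \<in> lift S' U ` Yinf S" unfolding lift_surj by (simp add: S'.root_def)
    then obtain y where "y \<in> Yinf S" "z = lift S' U y" by (elim imageE)
    then show "z \<in> lift S' U ` roots S" using z hom.root_h_iff[OF lift_surj] by (auto simp: S.roots_eq)
  next
    assume "z \<in> lift S' U ` roots S"
    then obtain y where "S.root y" "z = lift S' U y" by (auto simp: S.roots_eq)
    then show "z \<in> roots S'"
      using hom.root_h_iff[OF lift_surj, of y] by (simp add: S'.roots_eq S.root_def)
  qed
  then show ?thesis by blast
qed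

end

lemma obtain_saturated_isomorphism:
  assumes "is_scs S" "is_scs S'" "scs_saturated S" "scs_isomorphic S S'"
  obtains U where "saturated_isomorphism S S' U"
proof -
  obtain U where U: "is_scs_iso U S S'" using assms(4) by (auto simp: scs_isomorphic_def)
  interpret isomorphism S S' U by unfold_locales (rule assms U)+
  have "saturated_isomorphism S S' U"
    by unfold_locales (rule assms U saturated_transfer)+
  then show thesis using that by blast
qed

text \<open>The ambient coface maps are kept, as \<open>sub_scs\<close> demands, so components are
  equal as records once their levels are. The layers of a normal SCS turn out to be these.\<close>

definition component :: "'a scs \<Rightarrow> (nat \<times> 'a) set \<Rightarrow> 'a scs" where
  "component S y = \<lparr>lev = \<lambda>n. {x \<in> lev S n. pshifts.linked (Yinf S) (pshift S) y (germ S n x)}, cof = cof S\<rparr>"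

context semicosimplicial
begin

lemma component_alt: "component S y = \<lparr>lev = \<lambda>n. {x \<in> lev S n. linked y (germ S n x)}, cof = cof S\<rparr>"
  by (simp add: component_def)

lemma in_lev_component: "x \<in> lev (component S y) n \<longleftrightarrow> x \<in> lev S n \<and> linked y (germ S n x)"
  by (simp add: component_def)

lemma cof_component: "cof (component S y) = cof S"
  by (simp add: component_def)

lemma sub_scs_component: "sub_scs (component S y) S"
proof -
  have "is_scs (component S y)"
    unfolding is_scs_def
  proof (intro conjI allI impI)
    fix n i :: nat assume i: "i \<le> n"
    show "cof (component S y) n i ` lev (component S y) n \<subseteq> lev (component S y) (Suc n)"
    proof
      fix z assume "z \<in> cof (component S y) n i ` lev (component S y) n"
      then obtain x where x: "x \<in> lev S n" "linked y (germ S n x)" "z = cof S n i x"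
        by (auto simp: in_lev_component cof_component)
      have "linked y (pshift S i (germ S n x))"
        using linked_trans[OF x(2) linked_alpha] germ_in x(1) by blast
      then show "z \<in> lev (component S y) (Suc n)"
        using x i cof_in by (simp add: in_lev_component pshift_germ)
    qed
    show "inj_on (cof (component S y) n i) (lev (component S y) n)"
      using cof_eq_iff[OF i] by (auto simp: in_lev_component cof_component inj_on_def)
  qed (simp add: in_lev_component cof_component cof_cof)
  then show ?thesis by (auto simp: sub_scs_def in_lev_component cof_component)
qed

lemma is_scs_component: "is_scs (component S y)"
  using sub_scs_component by (simp add: sub_scs_def)

lemma component_eq_iff:
  assumes "y \<in> Yinf S" "z \<in> Yinf S"
  shows "component S y = component S z \<longleftrightarrow> linked y z"
proof
  assume e: "component S y = component S z"
  obtain n x where x: "x \<in> lev S n" "y = germ S n x" using obtain_germ[OF assms(1)] .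
  then have "x \<in> lev (component S y) n" using linked_refl[OF assms(1)] by (simp add: in_lev_component)
  then have "linked z y" using x(2) unfolding e by (simp add: in_lev_component)
  then show "linked y z" by (rule linked_sym)
next
  assume "linked y z"
  then have "linked y w \<longleftrightarrow> linked z w" for w using linked_trans linked_sym by blast
  then show "component S y = component S z" by (simp add: component_alt)
qed

end

lemma in_lev_Lambda_above:
  "v \<in> lev (Lambda_above k u) n \<longleftrightarrow> v \<in> labels_above k u \<and> v \<subseteq> {..<n}"
  by (auto simp: Lambda_above_def in_lev_Lambda labels_above_def)

lemma cof_Lambda_above: "cof (Lambda_above k u) n i = label_shift i"
  by (simp add: Lambda_above_def Lambda_def)

context saturated
begin

text \<open>Within a class the label determines the element, and by saturation it also determines
  the levels containing it. So labels are the isomorphism once the set of labels that occur is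
  known.\<close>

lemma component_iso_Lambda_above:
  assumes y: "y \<in> Yinf S" and labs: "lab ` {z. linked y z} = labels_above k u"
  shows "is_scs_iso (\<lambda>n x. lab (germ S n x)) (component S y) (Lambda_above k u)"
  unfolding is_scs_iso_def
proof (intro conjI allI impI)
  fix n
  show "bij_betw (\<lambda>x. lab (germ S n x)) (lev (component S y) n) (lev (Lambda_above k u) n)"
    unfolding bij_betw_def
  proof (intro conjI equalityI subsetI)
    show "inj_on (\<lambda>x. lab (germ S n x)) (lev (component S y) n)"
    proof (rule inj_onI)
      fix x z assume x: "x \<in> lev (component S y) n" and z: "z \<in> lev (component S y) n"
        and e: "lab (germ S n x) = lab (germ S n z)"
      then have "linked (germ S n x) (germ S n z)"
        using linked_sym linked_trans unfolding in_lev_component by blast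
      then have "germ S n x = germ S n z" using linked_lab_eq e by blast
      then show "x = z" using germ_inject x z by (simp add: in_lev_component)
    qed
  next
    fix v assume "v \<in> (\<lambda>x. lab (germ S n x)) ` lev (component S y) n"
    then obtain x where x: "x \<in> lev S n" "linked y (germ S n x)" "v = lab (germ S n x)"
      by (auto simp: in_lev_component)
    then have "v \<in> labels_above k u" unfolding labs[symmetric] by blast
    then show "v \<in> lev (Lambda_above k u) n" using lab_germ x by (simp add: in_lev_Lambda_above)
  next
    fix v assume "v \<in> lev (Lambda_above k u) n"
    then have v: "v \<in> lab ` {z. linked y z}" "v \<subseteq> {..<n}" unfolding labs by (simp_all add: in_lev_Lambda_above)
    then obtain z where z: "linked y z" "v = lab z" by blast
    then obtain x where x: "x \<in> lev S n" "z = germ S n x" using ex_germ_iff[of z n] linked_closed(2) v(2) by blast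
    then show "v \<in> (\<lambda>x. lab (germ S n x)) ` lev (component S y) n"
      using z by (intro image_eqI[of _ _ x]) (simp_all add: in_lev_component)
  qed
next
  fix n i x assume "i \<le> n \<and> x \<in> lev (component S y) n"
  then show "lab (germ S (Suc n) (cof (component S y) n i x)) =
      cof (Lambda_above k u) n i (lab (germ S n x))"
    by (simp add: in_lev_component cof_component cof_Lambda_above germ_in lab_alpha flip: pshift_germ)
qed

end

section \<open>SCSs with a single root\<close>

locale single_root = saturated +
  fixes y
  assumes roots: "roots S = {y}"
begin

lemma root_y: "root y" and y_in: "y \<in> Yinf S"
proof -
  show "root y" using roots roots_eq by blast
  then show "y \<in> Yinf S" by (simp add: root_def)
qed

lemma linked_y:
  assumes "z \<in> Yinf S"
  shows "linked y z"
proof -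
  obtain r "is" where r: "root r" "linked r z" using obtain_root[OF assms] by metis
  then have "r = y" using roots roots_eq by blast
  then show ?thesis using r(2) by simp
qed

lemma linked_all: "z \<in> Yinf S \<Longrightarrow> w \<in> Yinf S \<Longrightarrow> linked z w"
  using linked_y linked_sym linked_trans by blast

lemma component_y: "component S y = S"
  using linked_y germ_in by (simp add: component_alt cong: conj_cong)

text \<open>All elements descend from the only root, and any sequence of insertions can be performed
  on it.\<close>

lemma lab_image: "lab ` Yinf S = labels_above (rank y) (lab y)"
proof (intro equalityI subsetI)
  fix v assume "v \<in> lab ` Yinf S"
  then obtain z where z: "z \<in> Yinf S" "v = lab z" by blast
  obtain r "is" where r: "root r" "z = fold (pshift S) is r" using obtain_root[OF z(1)] by metis
  then have "r = y" using roots roots_eq by blast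
  then have "label_le (lab y) v" using linked_label_le_iff[OF linked_y[OF z(1)]] z r by blast
  moreover have "rank z = rank y" using linked_rank[OF linked_y[OF z(1)]] by simp
  ultimately show "v \<in> labels_above (rank y) (lab y)"
    using z finite_lab by (simp add: labels_above_def rank_labels_def)
next
  fix v assume "v \<in> labels_above (rank y) (lab y)"
  then have "label_le (lab y) v" by (simp add: labels_above_def)
  then obtain "is" where "v = fold label_shift is (lab y)"
    using label_le_obtain_shifts finite_lab[OF y_in] by blast
  then have "v = lab (fold (pshift S) is y)" using lab_fold[OF y_in] by simp
  then show "v \<in> lab ` Yinf S" using fold_closed[OF y_in] by blast
qed

lemma iso_Lambda_above: "scs_isomorphic S (Lambda_above (rank y) (lab y))"
proof -
  have "{z. linked y z} = Yinf S" using linked_y linked_closed by blast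
  then show ?thesis
    using component_iso_Lambda_above[OF y_in, of "rank y" "lab y"] lab_image
    unfolding component_y scs_isomorphic_def by auto
qed

lemma scs_normal_if_iso_Lambda:
  assumes "scs_isomorphic S (Lambda k)"
  shows "scs_normal S"
proof -
  obtain U where "saturated_isomorphism S (Lambda k) U"
    using obtain_saturated_isomorphism[OF scs Lambda.scs sat assms] .
  then interpret U: saturated_isomorphism S "Lambda k" U .
  show ?thesis using U.scs_normal_transfer scs_normal_Lambda by blast
qed

lemma scs_normal_iff_lab: "scs_normal S \<longleftrightarrow> lab y = {..<rank y}"
proof
  show "scs_normal S \<Longrightarrow> lab y = {..<rank y}"
    using normal_root_lab root_y scs_normal_iff by blast
next
  assume "lab y = {..<rank y}"
  then have "scs_isomorphic S (Lambda (rank y))"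
    using iso_Lambda_above Lambda_above_initial by metis
  then show "scs_normal S" by (rule scs_normal_if_iso_Lambda)
qed

lemma scs_normal_iff_iso_Lambda: "scs_normal S \<longleftrightarrow> scs_isomorphic S (Lambda (rank y))"
proof
  assume "scs_normal S"
  then have "lab y = {..<rank y}" using scs_normal_iff_lab by blast
  then show "scs_isomorphic S (Lambda (rank y))"
    using iso_Lambda_above Lambda_above_initial by metis
qed (rule scs_normal_if_iso_Lambda)

text \<open>Labels identify the poset with the labels above \<open>lab y\<close>, and the
  translation of \<open>ex_label_order_iso\<close> moves these onto all labels of the rank.\<close>

lemma ex_order_iso:
  "\<exists>\<phi>. bij_betw \<phi> (Yinf S) (rank_labels (rank y)) \<and>
    (\<forall>z\<in>Yinf S. \<forall>z'\<in>Yinf S. scs_le S z z' \<longleftrightarrow> label_le (\<phi> z) (\<phi> z'))"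
proof -
  obtain \<phi> where \<phi>: "bij_betw \<phi> {v \<in> rank_labels (rank y). label_le (lab y) v} (rank_labels (rank y))"
    and le': "\<forall>v w. label_le (lab y) v \<and> label_le (lab y) w \<and> v \<in> rank_labels (rank y) \<and>
      w \<in> rank_labels (rank y) \<longrightarrow> (label_le v w \<longleftrightarrow> label_le (\<phi> v) (\<phi> w))"
    using ex_label_order_iso[OF lab_in_rank_labels[OF y_in]] by (elim exE conjE)
  have le: "label_le v w \<longleftrightarrow> label_le (\<phi> v) (\<phi> w)"
    if "v \<in> labels_above (rank y) (lab y)" "w \<in> labels_above (rank y) (lab y)" for v w
    using le' that unfolding labels_above_def by blast
  have "inj_on lab (Yinf S)" using linked_lab_eq linked_all by (meson inj_onI)
  then have "bij_betw lab (Yinf S) {v \<in> rank_labels (rank y). label_le (lab y) v}"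
    using lab_image by (simp add: bij_betw_def labels_above_def)
  then have "bij_betw (\<phi> \<circ> lab) (Yinf S) (rank_labels (rank y))" using \<phi> by (rule bij_betw_trans)
  moreover have "scs_le S z z' \<longleftrightarrow> label_le ((\<phi> \<circ> lab) z) ((\<phi> \<circ> lab) z')"
    if z: "z \<in> Yinf S" "z' \<in> Yinf S" for z z'
  proof -
    have "lab z \<in> labels_above (rank y) (lab y)" "lab z' \<in> labels_above (rank y) (lab y)"
      using z unfolding lab_image[symmetric] by blast+
    then show ?thesis using linked_label_le_iff[OF linked_all[OF z]] le by (simp add: scs_le_iff)
  qed
  ultimately show ?thesis by blast
qed

end

lemma single_root_iso_iff:
  assumes "single_root S y" "single_root S' y'"
  shows "scs_isomorphic S S' \<longleftrightarrow> normal_label S y = normal_label S' y'"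
proof -
  interpret S: single_root S y by (rule assms)
  interpret S': single_root S' y' by (rule assms)
  show ?thesis
    unfolding S.normal_label_eq S'.normal_label_eq
  proof
    assume "scs_isomorphic S S'"
    then obtain U where "saturated_isomorphism S S' U"
      using obtain_saturated_isomorphism[OF S.scs S'.scs S.sat] by blast
    then interpret U: saturated_isomorphism S S' U .
    have "lift S' U y = y'" using U.roots_transfer S.roots S'.roots by simp
    then show "S.lab y = S'.lab y'" using U.hom.lab_h[OF S.y_in] by simp
  next
    assume "S.lab y = S'.lab y'"
    then show "scs_isomorphic S S'"
      using S.iso_Lambda_above S'.iso_Lambda_above scs_isomorphic_sym[OF S'.scs] scs_isomorphic_trans by metis
  qed
qed

lemma rank_Yinf_Lambda:
  assumes "z \<in> Yinf (Lambda k)"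
  shows "Lambda.rank k z = k"
proof -
  obtain n v where v: "v \<in> lev (Lambda k) n" "z = germ (Lambda k) n v" using Lambda.obtain_germ[OF assms] .
  then show ?thesis using lab_germ_Lambda[OF v(1)] by (simp add: in_lev_Lambda rank_labels_def)
qed

text \<open>Linked roots have the same rank, and under normality the rank fixes the label of a
  root.\<close>

lemma (in pshifts) normal_linked_roots:
  assumes normal "root r" "root s" "linked r s"
  shows "r = s"
proof (rule linked_lab_eq)
  show "linked r s" by fact
  have "lab r = {..<rank s}"
    unfolding linked_rank[OF assms(4), symmetric] using assms(1,2) by (rule normal_root_lab)
  also have "\<dots> = lab s" using assms(1,3) by (rule normal_root_lab[symmetric])
  finally show "lab r = lab s" .
qed

section \<open>Normal SCSs and their layers\<close>

locale normal_scs = saturated +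
  assumes norm: "scs_normal S"
begin

lemma normal: normal
  using norm scs_normal_iff by blast

lemma lab_linked_image:
  assumes "y \<in> Yinf S"
  shows "lab ` {z. linked y z} = rank_labels (rank y)"
proof (intro equalityI subsetI)
  fix v assume "v \<in> lab ` {z. linked y z}"
  then obtain z where "linked y z" "v = lab z" by blast
  then show "v \<in> rank_labels (rank y)"
    using lab_in_rank_labels[OF linked_closed(2)] linked_rank by metis
next
  fix v assume "v \<in> rank_labels (rank y)"
  then show "v \<in> lab ` {z. linked y z}" using normal_fill[OF normal assms] by blast
qed

lemma component_iso_Lambda: "y \<in> Yinf S \<Longrightarrow> scs_isomorphic (component S y) (Lambda (rank y))"
  using component_iso_Lambda_above[of y "rank y" "{..<rank y}"] lab_linked_image[of y]
  unfolding scs_isomorphic_def labels_above_initial Lambda_above_initial by blast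

text \<open>Different \<open>Lambda k\<close> are not isomorphic, because isomorphisms preserve
  labels and hence ranks.\<close>

lemma component_iso_Lambda_iff:
  assumes y: "y \<in> Yinf S"
  shows "scs_isomorphic (component S y) (Lambda k) \<longleftrightarrow> k = rank y"
proof
  assume "scs_isomorphic (component S y) (Lambda k)"
  then have "scs_isomorphic (Lambda (rank y)) (Lambda k)"
    using component_iso_Lambda[OF y] scs_isomorphic_sym[OF is_scs_component] scs_isomorphic_trans by blast
  then obtain U where "saturated_isomorphism (Lambda (rank y)) (Lambda k) U"
    using obtain_saturated_isomorphism[OF Lambda.scs Lambda.scs Lambda.sat] by blast
  then interpret U: saturated_isomorphism "Lambda (rank y)" "Lambda k" U .
  define z where "z = germ (Lambda (rank y)) (rank y) {..<rank y}"
  have z: "z \<in> Yinf (Lambda (rank y))"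
    unfolding z_def by (rule Lambda.germ_in) (simp add: in_lev_Lambda initial_in_rank_labels)
  show "k = rank y"
    using U.hom.lab_h[OF z] rank_Yinf_Lambda[OF z] rank_Yinf_Lambda[OF U.hom.h_in[OF z]] by simp
qed (simp add: component_iso_Lambda y)

lemma component_layer:
  assumes y: "y \<in> Yinf S"
  shows "scs_saturated (component S y)" "scs_normal (component S y)" "\<exists>r. roots (component S y) = {r}"
proof -
  have "scs_isomorphic (Lambda (rank y)) (component S y)"
    using component_iso_Lambda[OF y] scs_isomorphic_sym[OF is_scs_component] by blast
  then obtain U where "saturated_isomorphism (Lambda (rank y)) (component S y) U"
    using obtain_saturated_isomorphism[OF Lambda.scs is_scs_component Lambda.sat] by blast
  then interpret U: saturated_isomorphism "Lambda (rank y)" "component S y" U .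
  show "scs_saturated (component S y)" by (rule U.S'.sat)
  show "scs_normal (component S y)" using U.scs_normal_transfer scs_normal_Lambda by blast
  show "\<exists>r. roots (component S y) = {r}" unfolding U.roots_transfer roots_Lambda by simp
qed

lemma layer_decomposition_components: "layer_decomposition S (component S ` Yinf S)"
  unfolding layer_decomposition_def
proof (intro conjI ballI allI impI)
  fix L assume "L \<in> component S ` Yinf S"
  then obtain y where y: "y \<in> Yinf S" "L = component S y" by blast
  show "sub_scs L S" "scs_saturated L" "scs_normal L" "\<exists>y. roots L = {y}"
    unfolding y(2) using sub_scs_component component_layer[OF y(1)] by blast+
next
  fix n
  show "lev S n = (\<Union>L\<in>component S ` Yinf S. lev L n)"
  proof (intro equalityI subsetI)
    fix x assume x: "x \<in> lev S n"
    then have "x \<in> lev (component S (germ S n x)) n" using linked_refl germ_in by (simp add: in_lev_component)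
    then show "x \<in> (\<Union>L\<in>component S ` Yinf S. lev L n)" using germ_in[OF x] by blast
  qed (auto simp: in_lev_component)
next
  fix n L L' assume "L \<in> component S ` Yinf S" "L' \<in> component S ` Yinf S" and ne: "L \<noteq> L'"
  then obtain y y' where y: "y \<in> Yinf S" "L = component S y" "y' \<in> Yinf S" "L' = component S y'" by blast
  show "lev L n \<inter> lev L' n = {}"
  proof (rule ccontr)
    assume "lev L n \<inter> lev L' n \<noteq> {}"
    then obtain x where "linked y (germ S n x)" "linked y' (germ S n x)"
      unfolding y(2,4) by (auto simp: in_lev_component)
    then have "linked y y'" using linked_sym linked_trans by blast
    then show False using ne y component_eq_iff by blast
  qed
qed

text \<open>Pieces are closed under shifts and levelwise disjoint, so linked germs, having a common
  descendant, come from one piece. The single root makes all elements of a piece linked. So the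
  pieces are exactly the classes.\<close>

lemma layer_decomposition_unique:
  assumes D: "layer_decomposition S \<L>"
  shows "\<L> = component S ` Yinf S"
proof -
  note D' = D[unfolded layer_decomposition_def]
  have sub: "sub_scs L S" "scs_saturated L" "\<exists>y. roots L = {y}" if "L \<in> \<L>" for L
    using bspec[OF conjunct1[OF D'] that] by simp_all
  have union: "lev S n = (\<Union>L\<in>\<L>. lev L n)" for n
    using conjunct1[OF conjunct2[OF D']] by (rule spec)
  have disj: "L = L'" if "L \<in> \<L>" "L' \<in> \<L>" "x \<in> lev L n" "x \<in> lev L' n" for L L' n x
    using conjunct2[OF conjunct2[OF D']] that by blast
  have emb: "embedding L S (\<lambda>n x. x)" if L: "L \<in> \<L>" for L
  proof -
    have "is_scs L" and lev_L: "\<And>n. lev L n \<subseteq> lev S n" and "cof L = cof S"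
      using sub(1)[OF L] by (auto simp: sub_scs_def)
    moreover have "scs_embedding (\<lambda>n x. x) L S"
      using calculation by (subst scs_embedding_iff[OF _ scs]) auto
    ultimately show ?thesis by unfold_locales
  qed
  have fold_in: "\<exists>m a. a \<in> lev L m \<and> fold (pshift S) is (germ S n x) = germ S m a"
    if L: "L \<in> \<L>" and x: "x \<in> lev L n" for L n x "is"
  proof -
    interpret emb: embedding L S "\<lambda>n x. x" by (rule emb[OF L])
    obtain m a where "a \<in> lev L m" "fold (pshift L) is (germ L n x) = germ L m a"
      using emb.S.obtain_germ[OF emb.S.fold_closed[OF emb.S.germ_in[OF x]]] .
    then show ?thesis using emb.hom.fold_h[OF emb.S.germ_in[OF x], of "is"] emb.lift_germ x by auto
  qed
  have push_in: "push S n d x \<in> lev L (n + d)" if L: "L \<in> \<L>" and x: "x \<in> lev L n" for L n d x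
  proof -
    interpret emb: embedding L S "\<lambda>n x. x" by (rule emb[OF L])
    show ?thesis using emb.S.push_in[OF x, of d] emb.U_push[OF x, of d] by simp
  qed
  have same: "L = L'" if L: "L \<in> \<L>" "L' \<in> \<L>" and x: "x \<in> lev L n" and z: "z \<in> lev L' m"
    and link: "linked (germ S n x) (germ S m z)" for L L' n m x z
  proof -
    obtain "is" js where e: "fold (pshift S) is (germ S n x) = fold (pshift S) js (germ S m z)"
      using link Ins_eq_fold unfolding linked_def by metis
    obtain p a where a: "a \<in> lev L p" "fold (pshift S) is (germ S n x) = germ S p a"
      using fold_in[OF L(1) x] by blast
    obtain q b where b: "b \<in> lev L' q" "fold (pshift S) js (germ S m z) = germ S q b"
      using fold_in[OF L(2) z] by blast
    have "a \<in> lev S p" "b \<in> lev S q" using a b L union by blast+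
    then have "push S p q a = push S q p b"
      using germ_eq_iff[of a p b q q p] a b e by (simp add: add.commute)
    then show ?thesis
      using disj[OF L, of "push S p q a" "p + q"] push_in[OF L(1) a(1), of q] push_in[OF L(2) b(1), of p]
      by (simp add: add.commute)
  qed
  have comp: "\<exists>r\<in>Yinf S. L = component S r" if L: "L \<in> \<L>" for L
  proof -
    obtain y where y: "roots L = {y}" using sub(3)[OF L] by (elim exE)
    have L_scs: "is_scs L" using sub(1)[OF L] by (simp add: sub_scs_def)
    interpret L: single_root L y by unfold_locales (rule L_scs sub(2)[OF L] y)+
    interpret emb: embedding L S "\<lambda>n x. x" by (rule emb[OF L])
    obtain p c where c: "c \<in> lev L p" "y = germ L p c" using L.obtain_germ[OF L.y_in] .
    have cS: "c \<in> lev S p" using c(1) L union by blast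
    have "x \<in> lev L n \<longleftrightarrow> x \<in> lev S n \<and> linked (germ S p c) (germ S n x)" for n x
    proof
      assume x: "x \<in> lev L n"
      have "L.linked (germ L p c) (germ L n x)" using L.linked_all L.germ_in c x by blast
      then have "linked (germ S p c) (germ S n x)"
        using emb.hom.linked_h[OF L.germ_in[OF c(1)] L.germ_in[OF x]] emb.lift_germ c x by simp
      then show "x \<in> lev S n \<and> linked (germ S p c) (germ S n x)" using x L union by blast
    next
      assume x: "x \<in> lev S n \<and> linked (germ S p c) (germ S n x)"
      then obtain L' where L': "L' \<in> \<L>" "x \<in> lev L' n" using union by blast
      then have "L = L'" using same[OF L L'(1) c(1) L'(2)] x by blast
      then show "x \<in> lev L n" using L' by simp
    qed
    then have "lev L = lev (component S (germ S p c))" by (intro ext set_eqI) (simp add: in_lev_component)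
    moreover have "cof L = cof S" using sub(1)[OF L] by (simp add: sub_scs_def)
    ultimately have "L = component S (germ S p c)" by (simp add: component_def)
    then show ?thesis using germ_in[OF cS] by blast
  qed
  show ?thesis
  proof (intro equalityI subsetI)
    fix L assume "L \<in> \<L>"
    then show "L \<in> component S ` Yinf S" using comp by blast
  next
    fix L assume "L \<in> component S ` Yinf S"
    then obtain y where y: "y \<in> Yinf S" "L = component S y" by blast
    obtain n x where x: "x \<in> lev S n" "y = germ S n x" using obtain_germ[OF y(1)] .
    obtain L' where L': "L' \<in> \<L>" "x \<in> lev L' n" using union x(1) by blast
    obtain r where r: "r \<in> Yinf S" "L' = component S r" using comp[OF L'(1)] by blast
    have "linked r y" using L'(2) x(2) unfolding r(2) by (simp add: in_lev_component)
    then have "L = L'" using component_eq_iff[OF r(1) y(1)] r y by simp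
    then show "L \<in> \<L>" using L' by simp
  qed
qed

lemma ex1_layer_decomposition: "\<exists>!\<L>. layer_decomposition S \<L>"
  using layer_decomposition_components layer_decomposition_unique by blast

lemma layers_eq: "layers S = component S ` Yinf S"
  unfolding layers_def using layer_decomposition_components layer_decomposition_unique by (rule the_equality)

text \<open>Each layer contains exactly one root, by descent and \<open>normal_linked_roots\<close>,
  so multiplicities can be counted on roots.\<close>

lemma roots_eqpoll_layers:
  "{r \<in> roots S. rank r = k} \<approx> {L \<in> layers S. scs_isomorphic L (Lambda k)}"
proof -
  have "bij_betw (component S) {r \<in> roots S. rank r = k} {L \<in> layers S. scs_isomorphic L (Lambda k)}"
    unfolding bij_betw_def
  proof (intro conjI equalityI subsetI)
    show "inj_on (component S) {r \<in> roots S. rank r = k}"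
    proof (rule inj_onI)
      fix r s assume "r \<in> {r \<in> roots S. rank r = k}" "s \<in> {r \<in> roots S. rank r = k}"
        and e: "component S r = component S s"
      then have r: "root r" "root s" unfolding roots_eq by simp_all
      then have "linked r s" using e component_eq_iff by (simp add: root_def)
      with r show "r = s" by (rule normal_linked_roots[OF normal])
    qed
  next
    fix L assume "L \<in> component S ` {r \<in> roots S. rank r = k}"
    then obtain r where r: "root r" "rank r = k" "L = component S r" unfolding roots_eq by blast
    then have "r \<in> Yinf S" by (simp add: root_def)
    then show "L \<in> {L \<in> layers S. scs_isomorphic L (Lambda k)}"
      using r component_iso_Lambda layers_eq by blast
  next
    fix L assume "L \<in> {L \<in> layers S. scs_isomorphic L (Lambda k)}"
    then obtain y where y: "y \<in> Yinf S" "L = component S y" "scs_isomorphic (component S y) (Lambda k)"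
      unfolding layers_eq by blast
    obtain r "is" where r: "root r" "linked r y" using obtain_root[OF y(1)] by metis
    have "component S r = L" using r component_eq_iff[OF linked_closed(1)] y by blast
    moreover have "rank r = k" using component_iso_Lambda_iff y linked_rank[OF r(2)] by simp
    ultimately show "L \<in> component S ` {r \<in> roots S. rank r = k}" using r(1) unfolding roots_eq by blast
  qed
  then show ?thesis unfolding eqpoll_def by blast
qed

end

text \<open>The bijections of roots, one for each rank, combine to a map \<open>c\<close>. Gluing
  along it asks only that partners have equal rank, since normality realises every label of that
  rank.\<close>

lemma normal_scs_iso_iff:
  assumes "normal_scs S" "normal_scs S'"
  shows "scs_isomorphic S S' \<longleftrightarrow>
    (\<forall>k. {L \<in> layers S. scs_isomorphic L (Lambda k)} \<approx> {L \<in> layers S'. scs_isomorphic L (Lambda k)})"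
proof -
  interpret S: normal_scs S by (rule assms)
  interpret S': normal_scs S' by (rule assms)
  let ?R = "\<lambda>k. {r \<in> roots S. S.rank r = k}" and ?R' = "\<lambda>k. {r \<in> roots S'. S'.rank r = k}"
  have "{L \<in> layers S. scs_isomorphic L (Lambda k)} \<approx> {L \<in> layers S'. scs_isomorphic L (Lambda k)}
      \<longleftrightarrow> ?R k \<approx> ?R' k" for k
    using S.roots_eqpoll_layers[of k] S'.roots_eqpoll_layers[of k] eqpoll_trans eqpoll_sym by meson
  moreover have "scs_isomorphic S S' \<longleftrightarrow> (\<forall>k. ?R k \<approx> ?R' k)"
  proof
    assume "scs_isomorphic S S'"
    then obtain U where "saturated_isomorphism S S' U"
      using obtain_saturated_isomorphism[OF S.scs S'.scs S.sat] by blast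
    then interpret U: saturated_isomorphism S S' U .
    have in_Yinf: "r \<in> Yinf S" if "r \<in> roots S" for r using that unfolding S.roots_eq by (simp add: S.root_def)
    have "lift S' U ` ?R k = ?R' k" for k
      unfolding U.roots_transfer using U.hom.lab_h in_Yinf by auto
    moreover have "inj_on (lift S' U) (?R k)" for k
      using U.hom.h_inj by (rule inj_on_subset) (use in_Yinf in blast)
    ultimately show "\<forall>k. ?R k \<approx> ?R' k" unfolding eqpoll_def bij_betw_def by blast
  next
    assume "\<forall>k. ?R k \<approx> ?R' k"
    then have "\<exists>b. \<forall>k. bij_betw (b k) (?R k) (?R' k)" unfolding eqpoll_def by (rule choice)
    then obtain b where b': "\<forall>k. bij_betw (b k) (?R k) (?R' k)" by (elim exE)
    have b: "bij_betw (b k) (?R k) (?R' k)" for k using b' by (rule spec)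
    define c where "c r = b (S.rank r) r" for r
    have c_in: "c r \<in> roots S'" "S'.rank (c r) = S.rank r" if "r \<in> roots S" for r
    proof -
      have "b (S.rank r) r \<in> ?R' (S.rank r)" by (rule bij_betw_apply[OF b]) (simp add: that)
      then show "c r \<in> roots S'" "S'.rank (c r) = S.rank r" by (simp_all add: c_def)
    qed
    have c_inj: "r = s" if rs: "r \<in> roots S" "s \<in> roots S" "c r = c s" for r s
    proof -
      have "S.rank r = S.rank s" using c_in(2)[OF rs(1)] c_in(2)[OF rs(2)] rs(3) by simp
      then have "b (S.rank r) r = b (S.rank r) s" "r \<in> ?R (S.rank r)" "s \<in> ?R (S.rank r)"
        using rs by (simp_all add: c_def)
      then show ?thesis by (rule inj_onD[OF bij_betw_imp_inj_on[OF b]])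
    qed
    have c_surj: "\<exists>r\<in>roots S. c r = s" if s: "s \<in> roots S'" for s
    proof -
      have "s \<in> b (S'.rank s) ` ?R (S'.rank s)" unfolding bij_betw_imp_surj_on[OF b] using s by simp
      then obtain r where "r \<in> ?R (S'.rank s)" "s = b (S'.rank s) r" by (elim imageE)
      then have "r \<in> roots S" "c r = s" by (simp_all add: c_def)
      then show ?thesis by (rule bexI[rotated])
    qed
    note root_eq = S.normal_linked_roots[OF S.normal] and root_eq' = S'.normal_linked_roots[OF S'.normal]
    interpret glue: pshifts_glue "Yinf S" "pshift S" "Yinf S'" "pshift S'"
      "\<lambda>r s. r \<in> roots S \<and> s = c r"
    proof
      fix x assume "x \<in> Yinf S"
      then obtain r "is" where "S.root r" "S.linked r x" using S.obtain_root by metis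
      then show "\<exists>a b. (a \<in> roots S \<and> b = c a) \<and> S.linked x a"
        using S.linked_sym unfolding S.roots_eq by blast
    next
      fix a b a' b' assume ab: "a \<in> roots S \<and> b = c a" and ab': "a' \<in> roots S \<and> b' = c a'"
      have r: "S.root a" "S.root a'" "S'.root b" "S'.root b'"
        using ab ab' c_in(1) unfolding S.roots_eq S'.roots_eq by blast+
      have "S.linked a a' \<longleftrightarrow> a = a'" using r root_eq S.linked_refl S.root_def by blast
      also have "\<dots> \<longleftrightarrow> b = b'" using ab ab' c_inj by blast
      also have "\<dots> \<longleftrightarrow> S'.linked b b'" using r root_eq' S'.linked_refl S'.root_def by blast
      finally show "S.linked a a' \<longleftrightarrow> S'.linked b b'" .
    next
      fix a b x assume ab: "a \<in> roots S \<and> b = c a" and x: "S.linked x a"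
      have "S.lab x \<in> rank_labels (S'.rank b)"
        using S.lab_in_rank_labels[OF S.linked_closed(1)[OF x]] S.linked_rank[OF x] c_in(2) ab by simp
      moreover have "b \<in> Yinf S'" using c_in(1) ab unfolding S'.roots_eq S'.root_def by blast
      ultimately show "\<exists>z. S'.linked z b \<and> S'.lab z = S.lab x"
        using S'.normal_fill[OF S'.normal] S'.linked_sym by blast
    qed
    have "glue.glue ` Yinf S = Yinf S'"
    proof (rule glue.glue_surj)
      fix z assume "z \<in> Yinf S'"
      then obtain r "is" where r: "S'.root r" "S'.linked r z" using S'.obtain_root by metis
      then obtain a where "a \<in> roots S" "c a = r" using c_surj unfolding S'.roots_eq by blast
      then show "\<exists>a b. (a \<in> roots S \<and> b = c a) \<and> S'.linked z b" using S'.linked_sym[OF r(2)] by blast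
    next
      fix a b z assume ab: "a \<in> roots S \<and> b = c a" and z: "S'.linked z b"
      have "S'.lab z \<in> rank_labels (S.rank a)"
        using S'.lab_in_rank_labels[OF S'.linked_closed(1)[OF z]] S'.linked_rank[OF z] c_in(2) ab by simp
      moreover have "a \<in> Yinf S" using ab unfolding S.roots_eq S.root_def by blast
      ultimately show "\<exists>x. S.linked x a \<and> S.lab x = S'.lab z"
        using S.normal_fill[OF S.normal] S.linked_sym by blast
    qed
    then show "scs_isomorphic S S'"
      using ex_embedding_of_hom[OF S.scs S'.scs S'.sat glue.hom.pshifts_hom_axioms] S.sat
      unfolding scs_isomorphic_def by blast
  qed
  ultimately show ?thesis by simp
qed

section \<open>Normal extensions\<close>

lemma (in semicosimplicial) in_Yinf_germ:
  assumes "y \<in> Yinf S" "(n, x) \<in> y"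
  shows "x \<in> lev S n" "y = germ S n x"
proof -
  obtain m z where "z \<in> lev S m" "y = germ S m z" using obtain_germ[OF assms(1)] .
  then show "x \<in> lev S n" "y = germ S n x" using in_germ assms(2) by auto
qed

lemma pshifts_hom_comp:
  assumes "pshifts_hom Y \<alpha> Y' \<alpha>' h" "pshifts_hom Y' \<alpha>' Y'' \<alpha>'' h'"
  shows "pshifts_hom Y \<alpha> Y'' \<alpha>'' (\<lambda>y. h' (h y))"
proof -
  interpret h: pshifts_hom Y \<alpha> Y' \<alpha>' h by (rule assms)
  interpret h': pshifts_hom Y' \<alpha>' Y'' \<alpha>'' h' by (rule assms)
  show ?thesis
    by unfold_locales (auto intro!: inj_onI simp: h.h_in h'.h_in h.h_eq_iff h'.h_eq_iff h.h_alpha h'.h_alpha)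
qed

lemma scs_embedding_comp:
  assumes "is_scs S" "is_scs S'" "is_scs S''" "scs_embedding f S S'" "scs_embedding g S' S''"
  shows "scs_embedding (\<lambda>n x. g n (f n x)) S S''"
proof -
  have f: "\<And>n x. x \<in> lev S n \<Longrightarrow> f n x \<in> lev S' n" "\<And>n. inj_on (f n) (lev S n)"
    "\<And>n i x. i \<le> n \<Longrightarrow> x \<in> lev S n \<Longrightarrow> f (Suc n) (cof S n i x) = cof S' n i (f n x)"
    using assms(4) unfolding scs_embedding_iff[OF assms(1,2)] by blast+
  have g: "\<And>n x. x \<in> lev S' n \<Longrightarrow> g n x \<in> lev S'' n" "\<And>n. inj_on (g n) (lev S' n)"
    "\<And>n i x. i \<le> n \<Longrightarrow> x \<in> lev S' n \<Longrightarrow> g (Suc n) (cof S' n i x) = cof S'' n i (g n x)"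
    using assms(5) unfolding scs_embedding_iff[OF assms(2,3)] by blast+
  have "inj_on (\<lambda>x. g n (f n x)) (lev S n)" for n
    using f g by (auto intro!: inj_onI dest!: inj_onD[OF g(2)] inj_onD[OF f(2)])
  then show ?thesis
    unfolding scs_embedding_iff[OF assms(1,3)] using f g by auto
qed

context semicosimplicial
begin

text \<open>A class of linked elements is encoded by a pair representing one of its members, because the
  type over which minimality quantifies has no room for the class itself.\<close>

definition class_key :: "(nat \<times> 'a) set \<Rightarrow> nat \<times> 'a" where
  "class_key y = (SOME p. p \<in> (SOME z. linked y z))"

text \<open>The member chosen depends only on the class, as linked elements define the same
  predicate; and a pair lies in only one element of \<open>Yinf S\<close>, so the key gives the
  class back.\<close>

lemma class_key_eq_iff:
  assumes "y \<in> Yinf S" "z \<in> Yinf S"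
  shows "class_key y = class_key z \<longleftrightarrow> linked y z"
proof
  have key: "\<exists>w. linked y w \<and> class_key y \<in> w" if y: "y \<in> Yinf S" for y
  proof -
    define w where "w = (SOME w. linked y w)"
    have w: "linked y w" unfolding w_def by (rule someI, rule linked_refl[OF y])
    obtain n x where "x \<in> lev S n" "w = germ S n x" using obtain_germ[OF linked_closed(2)[OF w]] .
    then have "(n, x) \<in> w" using in_germ by simp
    then have "class_key y \<in> w" unfolding class_key_def w_def[symmetric] by (rule someI)
    then show ?thesis using w by blast
  qed
  assume e: "class_key y = class_key z"
  obtain v where v: "linked y v" "class_key y \<in> v" using key[OF assms(1)] by blast
  obtain w where w: "linked z w" "class_key z \<in> w" using key[OF assms(2)] by blast
  obtain n x where "class_key y = (n, x)" by (cases "class_key y")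
  then have "v = w"
    using in_Yinf_germ(2)[OF linked_closed(2)[OF v(1)]] in_Yinf_germ(2)[OF linked_closed(2)[OF w(1)]] v w e by metis
  then show "linked y z" using v(1) w(1) linked_sym linked_trans by blast
next
  assume "linked y z"
  then have "linked y = linked z" using linked_trans linked_sym by blast
  then show "class_key y = class_key z" by (simp add: class_key_def)
qed

text \<open>Each class of rank \<open>k\<close> is replaced by a full copy of the labels of rank
  \<open>k\<close>, tagged by its key. This is the union of the tower of the minimal normal
  extension.\<close>

definition fill_set :: "((nat \<times> 'a) \<times> nat set) set" where
  "fill_set = {(class_key y, v) |y v. y \<in> Yinf S \<and> v \<in> rank_labels (rank y)}"

definition fill_shift :: "nat \<Rightarrow> (nat \<times> 'a) \<times> nat set \<Rightarrow> (nat \<times> 'a) \<times> nat set" where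
  "fill_shift i = map_prod id (label_shift i)"

sublocale fill: pshifts fill_set fill_shift
proof
  show "fill_shift n p \<in> fill_set" if p: "p \<in> fill_set" for n p
  proof -
    obtain y v where "p = (class_key y, v)" "y \<in> Yinf S" "v \<in> rank_labels (rank y)"
      using p unfolding fill_set_def by blast
    then have "fill_shift n p = (class_key y, label_shift n v)" "y \<in> Yinf S"
      "label_shift n v \<in> rank_labels (rank y)"
      using label_shift_in_rank_labels by (simp_all add: fill_shift_def)
    then show ?thesis unfolding fill_set_def by blast
  qed
  show "inj_on (fill_shift n) fill_set" for n
    unfolding fill_shift_def using prod.inj_map[OF inj_on_id inj_label_shift] by (rule inj_on_subset) simp
  show "fill_shift j (fill_shift i p) = fill_shift i (fill_shift (j - 1) p)" if "i < j" for i j p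
    using that by (cases p) (simp add: fill_shift_def label_shift_label_shift)
  show "\<exists>n. fill_shift n p = p" if "p \<in> fill_set" for p
  proof -
    obtain y v where v: "p = (class_key y, v)" "v \<in> rank_labels (rank y)"
      using \<open>p \<in> fill_set\<close> unfolding fill_set_def by blast
    then obtain n where "label_shift n v = v" using labels.fin by blast
    then show ?thesis using v(1) by (auto simp: fill_shift_def)
  qed
qed

lemma fill_lab: "fill.lab (c, v) = v"
  unfolding fill.lab_def by (simp add: fill_shift_def label_shift_Suc_eq_iff)

lemma fill_normal: "fill.normal"
  unfolding fill.normal_def
proof (intro ballI allI impI)
  fix p n assume "p \<in> fill_set" and n: "n \<notin> fill.lab p"
  then obtain y v where v: "p = (class_key y, v)" "y \<in> Yinf S" "v \<in> rank_labels (rank y)"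
    unfolding fill_set_def by blast
  then obtain w where w: "v = label_shift n w" using n label_shift_surj fill_lab by metis
  then have "w \<in> rank_labels (rank y)" using v(3) by (simp add: rank_labels_def)
  then have "(class_key y, w) \<in> fill_set" using v(2) unfolding fill_set_def by blast
  moreover have "p = fill_shift n (class_key y, w)" using v w by (simp add: fill_shift_def)
  ultimately show "p \<in> fill_shift n ` fill_set" by blast
qed

lemma fill_linked:
  assumes "y \<in> Yinf S" "v \<in> rank_labels (rank y)" "w \<in> rank_labels (rank y)"
  shows "fill.linked (class_key y, v) (class_key y, w)"
proof -
  interpret h: pshifts_hom "rank_labels (rank y)" label_shift fill_set fill_shift "\<lambda>v. (class_key y, v)"
    by unfold_locales (use assms(1) in \<open>auto simp: fill_set_def fill_shift_def inj_on_def\<close>)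
  show ?thesis using labels_linked[OF assms(2,3)] h.linked_h[OF assms(2,3)] by simp
qed

definition fill_emb :: "(nat \<times> 'a) set \<Rightarrow> (nat \<times> 'a) \<times> nat set" where
  "fill_emb y = (class_key y, lab y)"

sublocale fill_emb: pshifts_hom "Yinf S" "pshift S" fill_set fill_shift fill_emb
proof
  show "fill_emb y \<in> fill_set" if "y \<in> Yinf S" for y
    using that lab_in_rank_labels unfolding fill_set_def fill_emb_def by blast
  show "inj_on fill_emb (Yinf S)"
    using linked_lab_eq class_key_eq_iff by (auto simp: fill_emb_def inj_on_def)
  show "fill_emb (pshift S i y) = fill_shift i (fill_emb y)" if y: "y \<in> Yinf S" for i y
    using class_key_eq_iff[OF closed[OF y] y] linked_sym[OF linked_alpha[OF y]] lab_alpha[OF y]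
    by (simp add: fill_emb_def fill_shift_def)
qed

text \<open>No copy is added beyond those that meet the given SCS; this becomes tightness.\<close>

lemma fill_linked_emb: "p \<in> fill_set \<Longrightarrow> \<exists>y\<in>Yinf S. fill.linked p (fill_emb y)"
  using fill_linked lab_in_rank_labels unfolding fill_set_def fill_emb_def by blast

end

text \<open>The minimal normal extensions turn out to be those in which every layer meets the given SCS.\<close>

definition tight_extension :: "'a scs \<Rightarrow> 'b scs \<Rightarrow> (nat \<Rightarrow> 'a \<Rightarrow> 'b) \<Rightarrow> bool" where
  "tight_extension S N \<iota> \<longleftrightarrow> normal_extension S N \<iota> \<and>
    (\<forall>z\<in>Yinf N. \<exists>y\<in>Yinf S. pshifts.linked (Yinf N) (pshift N) z (lift N \<iota> y))"

locale normal_ext = semicosimplicial S + N: normal_scs N + embedding S N \<iota>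
  for S :: "'a scs" and N :: "'b scs" and \<iota>
begin

abbreviation e :: "(nat \<times> 'a) set \<Rightarrow> (nat \<times> 'b) set" where "e \<equiv> lift N \<iota>"

end

lemma normal_extI:
  assumes "is_scs S" "normal_extension S N \<iota>"
  shows "normal_ext S N \<iota>"
  using assms unfolding normal_extension_def by unfold_locales auto

lemma ex_tight_extension:
  fixes S :: "'a scs"
  assumes "is_scs S"
  shows "\<exists>(N :: 'a ext_elem scs) \<iota>. tight_extension S N \<iota>"
proof -
  interpret semicosimplicial S by unfold_locales (rule assms)
  let ?N = "pshifts_scs fill_set fill_shift"
  interpret N: normal_scs ?N
    by unfold_locales (rule fill.is_scs_pshifts_scs fill.saturated_pshifts_scs
      fill.scs_normal_pshifts_scs[THEN iffD2] fill_normal)+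
  interpret g: pshifts_hom fill_set fill_shift "Yinf ?N" "pshift ?N" fill.pgerm by (rule fill.pgerm_hom)
  have hom: "pshifts_hom (Yinf S) (pshift S) (Yinf ?N) (pshift ?N) (\<lambda>y. fill.pgerm (fill_emb y))"
    by (rule pshifts_hom_comp[OF fill_emb.pshifts_hom_axioms g.pshifts_hom_axioms])
  obtain \<iota> where emb: "scs_embedding \<iota> S ?N"
    and \<iota>: "\<forall>n. \<forall>x\<in>lev S n. germ ?N n (\<iota> n x) = fill.pgerm (fill_emb (germ S n x))"
    using ex_embedding_of_hom[OF scs N.scs N.sat hom] by (elim exE conjE)
  interpret E: embedding S ?N \<iota> by unfold_locales (rule emb)
  have lift: "lift ?N \<iota> y = fill.pgerm (fill_emb y)" if y: "y \<in> Yinf S" for y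
  proof -
    obtain n x where "x \<in> lev S n" "y = germ S n x" using obtain_germ[OF y] .
    then show ?thesis using \<iota> E.lift_germ by simp
  qed
  have "\<exists>y\<in>Yinf S. N.linked z (lift ?N \<iota> y)" if z: "z \<in> Yinf ?N" for z
  proof -
    have "z \<in> fill.pgerm ` fill_set" unfolding fill.pgerm_surj by (rule z)
    then obtain p where p: "p \<in> fill_set" "z = fill.pgerm p" by (elim imageE)
    obtain y where y: "y \<in> Yinf S" "fill.linked p (fill_emb y)" using fill_linked_emb[OF p(1)] by blast
    then have "N.linked z (lift ?N \<iota> y)"
      using g.linked_h[OF p(1) fill_emb.h_in[OF y(1)]] p(2) lift by simp
    then show ?thesis using y(1) by blast
  qed
  then have "tight_extension S ?N \<iota>"
    unfolding tight_extension_def normal_extension_def using N.scs N.sat N.norm emb by blast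
  then show ?thesis by blast
qed

text \<open>The two images of the same element of \<open>S\<close> are declared partners. Tightness
  covers all classes of \<open>N\<close>, embeddings preserve and reflect links, and normality of
  \<open>N'\<close> supplies every label.\<close>

lemma tight_extension_universal:
  assumes "is_scs S" "tight_extension S N \<iota>" "normal_extension S N' \<iota>'"
  shows "\<exists>g. scs_embedding g N N' \<and> (\<forall>n. \<forall>x\<in>lev S n. g n (\<iota> n x) = \<iota>' n x)"
proof -
  interpret A: normal_ext S N \<iota>
    by (rule normal_extI) (use assms in \<open>simp_all add: tight_extension_def\<close>)
  interpret B: normal_ext S N' \<iota>' by (rule normal_extI) (use assms in simp_all)
  have tight: "\<exists>y\<in>Yinf S. A.N.linked z (A.e y)" if "z \<in> Yinf N" for z
    using assms(2) that unfolding tight_extension_def by blast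
  interpret glue: pshifts_glue "Yinf N" "pshift N" "Yinf N'" "pshift N'"
    "\<lambda>a b. \<exists>y\<in>Yinf S. a = A.e y \<and> b = B.e y"
  proof
    show "\<exists>a b. (\<exists>y\<in>Yinf S. a = A.e y \<and> b = B.e y) \<and> A.N.linked x a" if "x \<in> Yinf N" for x
      using tight[OF that] by blast
  next
    fix a b a' b'
    assume "\<exists>y\<in>Yinf S. a = A.e y \<and> b = B.e y" "\<exists>y\<in>Yinf S. a' = A.e y \<and> b' = B.e y"
    then obtain y y' where "y \<in> Yinf S" "a = A.e y" "b = B.e y" "y' \<in> Yinf S" "a' = A.e y'" "b' = B.e y'"
      by blast
    then show "A.N.linked a a' \<longleftrightarrow> B.N.linked b b'"
      using A.hom.linked_h B.hom.linked_h by simp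
  next
    fix a b x assume "\<exists>y\<in>Yinf S. a = A.e y \<and> b = B.e y" and x: "A.N.linked x a"
    then obtain y where y: "y \<in> Yinf S" "a = A.e y" "b = B.e y" by blast
    have "A.N.rank x = B.N.rank b"
      using A.N.linked_rank[OF x] A.hom.lab_h[OF y(1)] B.hom.lab_h[OF y(1)] y by simp
    then have "A.N.lab x \<in> rank_labels (B.N.rank b)"
      using A.N.lab_in_rank_labels[OF A.N.linked_closed(1)[OF x]] by simp
    then show "\<exists>z. B.N.linked z b \<and> B.N.lab z = A.N.lab x"
      using B.N.normal_fill[OF B.N.normal, of b] B.hom.h_in[OF y(1)] y(3) B.N.linked_sym by blast
  qed
  obtain g where g: "scs_embedding g N N'" "\<forall>n. \<forall>x\<in>lev N n. germ N' n (g n x) = glue.glue (germ N n x)"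
    using ex_embedding_of_hom[OF A.N.scs B.N.scs B.N.sat glue.hom.pshifts_hom_axioms] by (elim exE conjE)
  interpret G: embedding N N' g by unfold_locales (rule g(1))
  have "g n (\<iota> n x) = \<iota>' n x" if x: "x \<in> lev S n" for n x
  proof -
    define y where "y = germ S n x"
    have y: "y \<in> Yinf S" unfolding y_def by (rule A.germ_in[OF x])
    have "germ N' n (g n (\<iota> n x)) = glue.glue (A.e y)"
      using g(2) A.U_in[OF x] A.lift_germ[OF x] by (simp add: y_def)
    also have "\<dots> = B.e y"
    proof (rule glue.glue_Q)
      show "\<exists>ya\<in>Yinf S. A.e y = A.e ya \<and> B.e y = B.e ya" using y by blast
      show "A.N.lab (A.e y) = B.N.lab (B.e y)" using A.hom.lab_h[OF y] B.hom.lab_h[OF y] by simp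
    qed (use y A.hom.h_in B.hom.h_in in blast)+
    also have "\<dots> = germ N' n (\<iota>' n x)" using B.lift_germ[OF x] by (simp add: y_def)
    finally show ?thesis
      using B.N.germ_inject[OF G.U_in[OF A.U_in[OF x]] B.U_in[OF x]] by simp
  qed
  then show ?thesis using g(1) by blast
qed

text \<open>By tightness both images of \<open>z\<close> are linked to the common image of some
  element of \<open>S\<close>, and both carry the label of \<open>z\<close>.\<close>

lemma tight_extension_embedding_unique:
  assumes S: "is_scs S" and "tight_extension S N \<iota>" and N': "is_scs N'"
    and f: "scs_embedding f N N'" and g: "scs_embedding g N N'"
    and eq: "\<And>n x. x \<in> lev S n \<Longrightarrow> f n (\<iota> n x) = g n (\<iota> n x)"
    and z: "z \<in> lev N n"
  shows "f n z = g n z"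
proof -
  interpret A: normal_ext S N \<iota>
    by (rule normal_extI) (use assms in \<open>simp_all add: tight_extension_def\<close>)
  interpret N': semicosimplicial N' by unfold_locales (rule N')
  interpret f: embedding N N' f by unfold_locales (rule f)
  interpret g: embedding N N' g by unfold_locales (rule g)
  let ?z = "germ N n z"
  have zY: "?z \<in> Yinf N" using z A.N.germ_in by blast
  obtain y where y: "y \<in> Yinf S" "A.N.linked ?z (A.e y)"
    using assms(2) zY unfolding tight_extension_def by blast
  obtain m x where x: "x \<in> lev S m" "y = germ S m x" using A.obtain_germ[OF y(1)] .
  have e: "A.e y \<in> Yinf N" using A.hom.h_in[OF y(1)] .
  have "lift N' f (A.e y) = lift N' g (A.e y)"
    using x A.lift_germ[OF x(1)] f.lift_germ[OF A.U_in[OF x(1)]] g.lift_germ[OF A.U_in[OF x(1)]] eq[OF x(1)] by simp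
  moreover have "N'.linked (lift N' f ?z) (lift N' f (A.e y))" "N'.linked (lift N' g ?z) (lift N' g (A.e y))"
    using f.hom.linked_h[OF zY e] g.hom.linked_h[OF zY e] y(2) by simp_all
  ultimately have "N'.linked (lift N' f ?z) (lift N' g ?z)" using N'.linked_sym N'.linked_trans by metis
  then have "lift N' f ?z = lift N' g ?z"
    by (rule N'.linked_lab_eq) (simp add: f.hom.lab_h[OF zY] g.hom.lab_h[OF zY])
  then have "germ N' n (f n z) = germ N' n (g n z)" using f.lift_germ[OF z] g.lift_germ[OF z] by simp
  then show ?thesis using N'.germ_inject f.U_in[OF z] g.U_in[OF z] by blast
qed

text \<open>Uniqueness of embeddings makes the composite of the two universal ones the identity, so
  the first is onto.\<close>

lemma tight_extension_iso:
  assumes S: "is_scs S" and A: "tight_extension S N \<iota>" and B: "tight_extension S N' \<iota>'"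
  shows "\<exists>g. is_scs_iso g N N' \<and> (\<forall>n. \<forall>x\<in>lev S n. g n (\<iota> n x) = \<iota>' n x)"
proof -
  have AN: "normal_extension S N \<iota>" "is_scs N" and BN: "normal_extension S N' \<iota>'" "is_scs N'"
    using A B by (auto simp: tight_extension_def normal_extension_def)
  obtain g where g: "scs_embedding g N N'" "\<forall>n. \<forall>x\<in>lev S n. g n (\<iota> n x) = \<iota>' n x"
    using tight_extension_universal[OF S A BN(1)] by (elim exE conjE)
  obtain h where h: "scs_embedding h N' N" "\<forall>n. \<forall>x\<in>lev S n. h n (\<iota>' n x) = \<iota> n x"
    using tight_extension_universal[OF S B AN(1)] by (elim exE conjE)
  have id: "scs_embedding (\<lambda>n x. x) M M" if "is_scs M" for M :: "'z scs"
    by (subst scs_embedding_iff[OF that that]) simp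
  have gh: "g n (h n w) = w" if "w \<in> lev N' n" for n w
    using tight_extension_embedding_unique[OF S B BN(2)
        scs_embedding_comp[OF BN(2) AN(2) BN(2) h(1) g(1)] id[OF BN(2)] _ that] g(2) h(2) by simp
  have h_in: "h n w \<in> lev N n" if "w \<in> lev N' n" for n w
    using h(1) that unfolding scs_embedding_iff[OF BN(2) AN(2)] by blast
  have g': "g n ` lev N n \<subseteq> lev N' n" "inj_on (g n) (lev N n)" for n
    using g(1) unfolding scs_embedding_iff[OF AN(2) BN(2)] by blast+
  have "g n ` lev N n = lev N' n" for n
  proof (intro equalityI subsetI)
    fix w assume "w \<in> lev N' n"
    then show "w \<in> g n ` lev N n" using gh h_in by (intro image_eqI[of _ _ "h n w"]) simp_all
  qed (use g' in blast)
  then have "is_scs_iso g N N'"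
    using g(1) g'(2) unfolding scs_embedding_iff[OF AN(2) BN(2)] is_scs_iso_def bij_betw_def by blast
  then show ?thesis using g(2) by blast
qed

text \<open>Minimality is tested against the tight extension that exists over the competitor type:
  an embedding into it reflects links, so tightness is inherited. The converse is universality,
  available over every type.\<close>

lemma minimal_normal_extension_iff_tight:
  assumes S: "is_scs S"
  shows "minimal_normal_extension S N \<iota> \<longleftrightarrow> tight_extension S N \<iota>"
proof
  assume min: "minimal_normal_extension S N \<iota>"
  obtain N0 :: "'a ext_elem scs" and \<iota>0 where T: "tight_extension S N0 \<iota>0"
    using ex_tight_extension[OF S] by (elim exE)
  then have N0: "normal_extension S N0 \<iota>0" by (simp add: tight_extension_def)
  have N: "normal_extension S N \<iota>" using min by (simp add: minimal_normal_extension_def)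
  obtain g where g: "scs_embedding g N N0" "\<forall>n. \<forall>x\<in>lev S n. g n (\<iota> n x) = \<iota>0 n x"
    using min N0 unfolding minimal_normal_extension_def by metis
  interpret A: normal_ext S N \<iota> by (rule normal_extI[OF S N])
  interpret B: normal_ext S N0 \<iota>0 by (rule normal_extI[OF S N0])
  interpret g: embedding N N0 g by unfold_locales (rule g(1))
  have "\<exists>y\<in>Yinf S. A.N.linked z (A.e y)" if z: "z \<in> Yinf N" for z
  proof -
    obtain y where y: "y \<in> Yinf S" "B.N.linked (lift N0 g z) (B.e y)"
      using T g.hom.h_in[OF z] unfolding tight_extension_def by blast
    obtain n x where x: "x \<in> lev S n" "y = germ S n x" using A.obtain_germ[OF y(1)] .
    have "B.e y = lift N0 g (A.e y)"
      using x A.lift_germ[OF x(1)] B.lift_germ[OF x(1)] g.lift_germ[OF A.U_in[OF x(1)]] g(2) by simp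
    then have "A.N.linked z (A.e y)" using y(2) g.hom.linked_h[OF z A.hom.h_in[OF y(1)]] by simp
    then show ?thesis using y(1) by blast
  qed
  then show "tight_extension S N \<iota>" unfolding tight_extension_def using N by blast
next
  assume T: "tight_extension S N \<iota>"
  then have "normal_extension S N \<iota>" by (simp add: tight_extension_def)
  then show "minimal_normal_extension S N \<iota>"
    unfolding minimal_normal_extension_def by (intro conjI allI impI tight_extension_universal[OF S T])
qed

section \<open>The invariant of an SCS inside its minimal normal extension\<close>

locale tight_ext = saturated S + normal_ext S N \<iota> for S :: "'a scs" and N :: "'b scs" and \<iota> +
  assumes tight: "z \<in> Yinf N \<Longrightarrow> \<exists>y\<in>Yinf S. N.linked z (e y)"
begin

lemma component_e_eq_iff:
  "y \<in> Yinf S \<Longrightarrow> z \<in> Yinf S \<Longrightarrow> component N (e y) = component N (e z) \<longleftrightarrow> linked y z"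
  using N.component_eq_iff[OF hom.h_in hom.h_in] hom.linked_h by simp

lemma layers_N: "layers N = (\<lambda>y. component N (e y)) ` Yinf S"
proof (intro equalityI subsetI)
  fix L assume "L \<in> layers N"
  then obtain z where z: "z \<in> Yinf N" "L = component N z" unfolding N.layers_eq by blast
  obtain y where y: "y \<in> Yinf S" "N.linked z (e y)" using tight[OF z(1)] by blast
  then have "component N z = component N (e y)"
    using N.component_eq_iff[OF z(1) hom.h_in[OF y(1)]] by simp
  then show "L \<in> (\<lambda>y. component N (e y)) ` Yinf S" using z y by blast
next
  fix L assume "L \<in> (\<lambda>y. component N (e y)) ` Yinf S"
  then show "L \<in> layers N" unfolding N.layers_eq using hom.h_in by blast
qed

lemma component_e_iso_Lambda_iff:
  "y \<in> Yinf S \<Longrightarrow> scs_isomorphic (component N (e y)) (Lambda k) \<longleftrightarrow> k = rank y"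
  using N.component_iso_Lambda_iff[OF hom.h_in] hom.lab_h by simp

text \<open>The embedding reflects links, so the roots in the layer of \<open>y\<close> can be found
  inside \<open>S\<close>, without reference to the extension.\<close>

lemma layer_labels_eq:
  assumes y: "y \<in> Yinf S"
  shows "layer_labels S \<iota> (component N (e y)) = {lab r |r. root r \<and> linked y r}"
proof -
  have "(\<exists>n. \<exists>x\<in>lev S n. r = germ S n x \<and> \<iota> n x \<in> lev (component N (e y)) n) \<longleftrightarrow> linked y r"
    if r: "root r" for r
  proof -
    have rY: "r \<in> Yinf S" using r by (simp add: root_def)
    have *: "\<iota> n x \<in> lev (component N (e y)) n \<longleftrightarrow> linked y r" if x: "x \<in> lev S n" "r = germ S n x" for n x
      using U_in[OF x(1)] lift_germ[OF x(1)] hom.linked_h[OF y rY] x(2) by (simp add: N.in_lev_component)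
    obtain n x where x: "x \<in> lev S n" "r = germ S n x" using obtain_germ[OF rY] .
    show ?thesis using * x by blast
  qed
  then show ?thesis unfolding layer_labels_def normal_label_eq roots_eq by auto
qed

text \<open>Of two linked roots with comparable labels one would descend from the other, and a root
  descends only from itself. Finiteness is then a property of antichains of labels.\<close>

lemma layer_labels_antichain:
  assumes L: "L \<in> layers N"
  shows "\<exists>k. scs_isomorphic L (Lambda k) \<and> layer_labels S \<iota> L \<noteq> {} \<and> finite (layer_labels S \<iota> L) \<and>
    layer_labels S \<iota> L \<subseteq> rank_labels k \<and>
    (\<forall>u\<in>layer_labels S \<iota> L. \<forall>v\<in>layer_labels S \<iota> L. u \<noteq> v \<longrightarrow> \<not> label_le u v)"
proof -
  obtain y where y: "y \<in> Yinf S" "L = component N (e y)" using L unfolding layers_N by blast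
  have labels: "layer_labels S \<iota> L = {lab r |r. root r \<and> linked y r}" unfolding y(2) by (rule layer_labels_eq[OF y(1)])
  have iso: "scs_isomorphic L (Lambda (rank y))" unfolding y(2) using component_e_iso_Lambda_iff[OF y(1)] by simp
  obtain r "is" where r: "root r" "linked r y" using obtain_root[OF y(1)] by metis
  have ne: "layer_labels S \<iota> L \<noteq> {}" unfolding labels using r linked_sym by blast
  have sub: "layer_labels S \<iota> L \<subseteq> rank_labels (rank y)"
  proof
    fix v assume "v \<in> layer_labels S \<iota> L"
    then obtain r where r: "linked y r" "v = lab r" unfolding labels by blast
    show "v \<in> rank_labels (rank y)"
      using lab_in_rank_labels[OF linked_closed(2)[OF r(1)]] linked_rank[OF r(1)] r(2) by simp
  qed
  have anti: "\<not> label_le u v" if uv: "u \<in> layer_labels S \<iota> L" "v \<in> layer_labels S \<iota> L" "u \<noteq> v" for u v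
  proof
    assume le: "label_le u v"
    obtain r where r: "root r" "linked y r" "u = lab r" using uv(1) unfolding labels by blast
    obtain s where s: "root s" "linked y s" "v = lab s" using uv(2) unfolding labels by blast
    have "linked r s" using r(2) s(2) linked_sym linked_trans by blast
    then have "r = s" using root_eqI[OF s(1)] le r(3) s(3) by simp
    then show False using uv(3) r(3) s(3) by simp
  qed
  have "finite (layer_labels S \<iota> L)" using sub anti by (rule finite_label_antichain)
  then show ?thesis using iso ne sub anti by blast
qed

end

lemma tight_extI:
  assumes "is_scs S" "scs_saturated S" "minimal_normal_extension S N \<iota>"
  shows "tight_ext S N \<iota>"
proof -
  have T: "tight_extension S N \<iota>" using assms minimal_normal_extension_iff_tight by blast
  then interpret normal_ext S N \<iota> by (intro normal_extI assms) (simp add: tight_extension_def)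
  show ?thesis
    by unfold_locales (use T assms(2) in \<open>simp_all add: tight_extension_def\<close>)
qed

text \<open>Meant for layers, which are indexed with repetitions by the elements of the SCS: it
  suffices that both families repeat at the same places.\<close>

lemma ex_bij_betw_images:
  assumes "\<And>a b. a \<in> A \<Longrightarrow> b \<in> A \<Longrightarrow> f a = f b \<longleftrightarrow> g a = g b"
  shows "\<exists>\<phi>. bij_betw \<phi> (f ` A) (g ` A) \<and> (\<forall>a\<in>A. \<phi> (f a) = g a)"
proof -
  define \<phi> where "\<phi> = (\<lambda>c. g (inv_into A f c))"
  have \<phi>: "\<phi> (f a) = g a" if "a \<in> A" for a
    using assms[of "inv_into A f (f a)" a] that by (simp add: \<phi>_def inv_into_into f_inv_into_f)
  have "bij_betw \<phi> (f ` A) (g ` A)"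
    unfolding bij_betw_def
  proof
    show "inj_on \<phi> (f ` A)" using \<phi> assms by (auto simp: inj_on_def)
    show "\<phi> ` f ` A = g ` A" using \<phi> by (simp add: image_image)
  qed
  then show ?thesis using \<phi> by blast
qed

text \<open>Takes the place of normality: a label of the class arises from a root label by
  insertions, which can be repeated on any element of the other class carrying that root
  label.\<close>

lemma fill_from_roots:
  assumes "pshifts Y \<alpha>" "pshifts Y' \<alpha>'"
    and sub: "\<And>r. pshifts.root Y \<alpha> r \<Longrightarrow> pshifts.linked Y \<alpha> a r \<Longrightarrow>
      \<exists>r'. pshifts.linked Y' \<alpha>' b r' \<and> pshifts.lab \<alpha>' r' = pshifts.lab \<alpha> r"
    and x: "pshifts.linked Y \<alpha> x a"
  shows "\<exists>z. pshifts.linked Y' \<alpha>' z b \<and> pshifts.lab \<alpha>' z = pshifts.lab \<alpha> x"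
proof -
  interpret A: pshifts Y \<alpha> by (rule assms)
  interpret B: pshifts Y' \<alpha>' by (rule assms)
  obtain r "is" where r: "A.root r" "x = fold \<alpha> is r" "A.linked r x"
    using A.obtain_root[OF A.linked_closed(1)[OF x]] .
  have "A.linked a r" using r(3) x A.linked_sym A.linked_trans by blast
  then obtain r' where r': "B.linked b r'" "B.lab r' = A.lab r" using sub[OF r(1)] by blast
  have "B.lab (fold \<alpha>' is r') = A.lab x"
    using B.lab_fold[OF B.linked_closed(2)[OF r'(1)]] A.lab_fold[OF A.linked_closed(1)[OF r(3)]] r(2) r'(2) by simp
  moreover have "B.linked (fold \<alpha>' is r') b"
    using B.linked_fold[OF B.linked_closed(2)[OF r'(1)]] r'(1) B.linked_sym B.linked_trans by blast
  ultimately show ?thesis by blast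
qed

text \<open>An isomorphism moves layers through their indexing by elements. Conversely
  \<open>Q\<close> pairs elements whose layers correspond under \<open>\<phi>\<close>, and equality
  of the root labels gives the filling condition in both directions.\<close>

lemma tight_ext_iso_iff:
  assumes "tight_ext S N \<iota>" "tight_ext S' N' \<iota>'"
  shows "scs_isomorphic S S' \<longleftrightarrow>
    (\<exists>\<phi>. bij_betw \<phi> (layers N) (layers N') \<and>
      (\<forall>L\<in>layers N.
        (\<forall>k. scs_isomorphic L (Lambda k) \<longleftrightarrow> scs_isomorphic (\<phi> L) (Lambda k)) \<and>
        layer_labels S' \<iota>' (\<phi> L) = layer_labels S \<iota> L))"
    (is "_ \<longleftrightarrow> ?R")
proof
  interpret A: tight_ext S N \<iota> by (rule assms)
  interpret B: tight_ext S' N' \<iota>' by (rule assms)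
  {
    assume "scs_isomorphic S S'"
    then obtain U where "saturated_isomorphism S S' U"
      using obtain_saturated_isomorphism[OF A.scs B.scs A.sat] by blast
    then interpret U: saturated_isomorphism S S' U .
    let ?u = "lift S' U"
    have u_in: "?u y \<in> Yinf S'" if "y \<in> Yinf S" for y using U.hom.h_in that by blast
    have "\<exists>\<phi>. bij_betw \<phi> ((\<lambda>y. component N (A.e y)) ` Yinf S) ((\<lambda>y. component N' (B.e (?u y))) ` Yinf S) \<and>
        (\<forall>y\<in>Yinf S. \<phi> (component N (A.e y)) = component N' (B.e (?u y)))"
      by (rule ex_bij_betw_images) (simp add: A.component_e_eq_iff B.component_e_eq_iff u_in U.hom.linked_h)
    then obtain \<phi> where
      bij: "bij_betw \<phi> ((\<lambda>y. component N (A.e y)) ` Yinf S) ((\<lambda>y. component N' (B.e (?u y))) ` Yinf S)" and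
      \<phi>: "\<forall>y\<in>Yinf S. \<phi> (component N (A.e y)) = component N' (B.e (?u y))"
      by (elim exE conjE)
    have "(\<lambda>y. component N' (B.e (?u y))) ` Yinf S = layers N'"
      unfolding B.layers_N U.lift_surj[symmetric] by (simp add: image_image)
    then have "bij_betw \<phi> (layers N) (layers N')" using bij by (simp add: A.layers_N)
    moreover have "(\<forall>k. scs_isomorphic L (Lambda k) \<longleftrightarrow> scs_isomorphic (\<phi> L) (Lambda k)) \<and>
        layer_labels S' \<iota>' (\<phi> L) = layer_labels S \<iota> L" if L: "L \<in> layers N" for L
    proof -
      obtain y where y: "y \<in> Yinf S" "L = component N (A.e y)" using L unfolding A.layers_N by blast
      have \<phi>L: "\<phi> L = component N' (B.e (?u y))" using \<phi> y by blast
      have "scs_isomorphic L (Lambda k) \<longleftrightarrow> scs_isomorphic (\<phi> L) (Lambda k)" for k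
        unfolding \<phi>L unfolding y(2) using A.component_e_iso_Lambda_iff[OF y(1)]
          B.component_e_iso_Lambda_iff[OF u_in[OF y(1)]] U.hom.lab_h[OF y(1)] by simp
      moreover have "{B.lab r |r. B.root r \<and> B.linked (?u y) r} = {A.lab r |r. A.root r \<and> A.linked y r}"
      proof (intro equalityI subsetI)
        fix v assume "v \<in> {B.lab r |r. B.root r \<and> B.linked (?u y) r}"
        then obtain s where s: "B.root s" "B.linked (?u y) s" "v = B.lab s" by blast
        then have "s \<in> ?u ` Yinf S" unfolding U.lift_surj by (simp add: B.root_def)
        then obtain r where r: "r \<in> Yinf S" "s = ?u r" by (elim imageE)
        have "A.root r" "A.linked y r" "v = A.lab r"
          using s r U.hom.root_h_iff[OF U.lift_surj r(1)] U.hom.linked_h[OF y(1) r(1)] U.hom.lab_h[OF r(1)]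
          by simp_all
        then show "v \<in> {A.lab r |r. A.root r \<and> A.linked y r}" by blast
      next
        fix v assume "v \<in> {A.lab r |r. A.root r \<and> A.linked y r}"
        then obtain r where r: "A.root r" "A.linked y r" "v = A.lab r" by blast
        have rY: "r \<in> Yinf S" using r(1) by (simp add: A.root_def)
        have "B.root (?u r)" "B.linked (?u y) (?u r)" "v = B.lab (?u r)"
          using r U.hom.root_h_iff[OF U.lift_surj rY] U.hom.linked_h[OF y(1) rY] U.hom.lab_h[OF rY]
          by simp_all
        then show "v \<in> {B.lab r |r. B.root r \<and> B.linked (?u y) r}" by blast
      qed
      ultimately show ?thesis
        unfolding \<phi>L using A.layer_labels_eq[OF y(1)] B.layer_labels_eq[OF u_in[OF y(1)]] y(2) by simp
    qed
    ultimately show ?R by blast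
  next
    assume ?R
    then obtain \<phi> where bij: "bij_betw \<phi> (layers N) (layers N')" and
      labels: "\<forall>L\<in>layers N. (\<forall>k. scs_isomorphic L (Lambda k) \<longleftrightarrow> scs_isomorphic (\<phi> L) (Lambda k)) \<and>
        layer_labels S' \<iota>' (\<phi> L) = layer_labels S \<iota> L"
      by (elim exE conjE)
    define Q where "Q a b \<longleftrightarrow> a \<in> Yinf S \<and> b \<in> Yinf S' \<and> \<phi> (component N (A.e a)) = component N' (B.e b)" for a b
    have comp_in: "component N (A.e a) \<in> layers N" if "a \<in> Yinf S" for a
      unfolding A.layers_N using that by blast
    have Q_labels: "{B.lab r |r. B.root r \<and> B.linked b r} = {A.lab r |r. A.root r \<and> A.linked a r}"
      if ab: "Q a b" for a b
    proof -
      have Y: "a \<in> Yinf S" "b \<in> Yinf S'" and \<phi>: "\<phi> (component N (A.e a)) = component N' (B.e b)"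
        using ab by (simp_all add: Q_def)
      have "layer_labels S' \<iota>' (\<phi> (component N (A.e a))) = layer_labels S \<iota> (component N (A.e a))"
        using labels comp_in[OF Y(1)] by blast
      then show ?thesis unfolding \<phi> A.layer_labels_eq[OF Y(1)] B.layer_labels_eq[OF Y(2)] .
    qed
    have fill: "\<exists>z. B.linked z b \<and> B.lab z = A.lab x" if ab: "Q a b" and x: "A.linked x a" for a b x
    proof (rule fill_from_roots[OF A.pshifts_axioms B.pshifts_axioms _ x])
      fix r assume "A.root r" "A.linked a r"
      then have "A.lab r \<in> {B.lab r |r. B.root r \<and> B.linked b r}" unfolding Q_labels[OF ab] by blast
      then show "\<exists>r'. B.linked b r' \<and> B.lab r' = A.lab r" by force
    qed
    have fill': "\<exists>x. A.linked x a \<and> A.lab x = B.lab z" if ab: "Q a b" and z: "B.linked z b" for a b z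
    proof (rule fill_from_roots[OF B.pshifts_axioms A.pshifts_axioms _ z])
      fix r assume "B.root r" "B.linked b r"
      then have "B.lab r \<in> {A.lab r |r. A.root r \<and> A.linked a r}" unfolding Q_labels[OF ab, symmetric] by blast
      then show "\<exists>r'. A.linked a r' \<and> A.lab r' = B.lab r" by force
    qed
    interpret glue: pshifts_glue "Yinf S" "pshift S" "Yinf S'" "pshift S'" Q
    proof
      fix x assume x: "x \<in> Yinf S"
      have "\<phi> (component N (A.e x)) \<in> layers N'" using bij_betw_apply[OF bij comp_in[OF x]] .
      then obtain b where "b \<in> Yinf S'" "\<phi> (component N (A.e x)) = component N' (B.e b)"
        unfolding B.layers_N by blast
      then show "\<exists>a b. Q a b \<and> A.linked x a" using x A.linked_refl unfolding Q_def by blast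
    next
      fix a b a' b' assume ab: "Q a b" "Q a' b'"
      then have Y: "a \<in> Yinf S" "a' \<in> Yinf S" "b \<in> Yinf S'" "b' \<in> Yinf S'" by (simp_all add: Q_def)
      have "A.linked a a' \<longleftrightarrow> component N (A.e a) = component N (A.e a')"
        using A.component_e_eq_iff Y by simp
      also have "\<dots> \<longleftrightarrow> \<phi> (component N (A.e a)) = \<phi> (component N (A.e a'))"
        using inj_on_eq_iff[OF bij_betw_imp_inj_on[OF bij] comp_in[OF Y(1)] comp_in[OF Y(2)]] by simp
      also have "\<dots> \<longleftrightarrow> B.linked b b'"
        using B.component_e_eq_iff Y ab by (simp add: Q_def)
      finally show "A.linked a a' \<longleftrightarrow> B.linked b b'" .
    qed (rule fill)
    have "glue.glue ` Yinf S = Yinf S'"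
    proof (rule glue.glue_surj)
      fix z assume z: "z \<in> Yinf S'"
      then have "component N' (B.e z) \<in> \<phi> ` layers N"
        unfolding bij_betw_imp_surj_on[OF bij] B.layers_N by blast
      then obtain L where L: "L \<in> layers N" "component N' (B.e z) = \<phi> L" by (elim imageE)
      then obtain a where "a \<in> Yinf S" "L = component N (A.e a)" unfolding A.layers_N by blast
      then have "Q a z" using z L(2) by (simp add: Q_def)
      then show "\<exists>a b. Q a b \<and> B.linked z b" using B.linked_refl[OF z] by blast
    qed (rule fill')
    then show "scs_isomorphic S S'"
      using ex_embedding_of_hom[OF A.scs B.scs B.sat glue.hom.pshifts_hom_axioms] A.sat
      unfolding scs_isomorphic_def by blast
  }
qed

theorem theorem8p3:
  shows
    "(\<forall>(S :: 'a scs) y k.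
        is_scs S \<and> scs_saturated S \<and> roots S = {y} \<and> normal_rank S y = k \<longrightarrow>
          sub_scs (Lambda_above k (normal_label S y)) (Lambda k) \<and>
          scs_isomorphic S (Lambda_above k (normal_label S y)) \<and>
          (\<forall>(S' :: 'b scs) y'.
             is_scs S' \<and> scs_saturated S' \<and> roots S' = {y'} \<and> normal_rank S' y' = k \<longrightarrow>
               (scs_isomorphic S S' \<longleftrightarrow> normal_label S y = normal_label S' y')) \<and>
          (scs_normal S \<longleftrightarrow> normal_label S y = {..<k}) \<and>
          roots (Lambda k) = {germ (Lambda k) k {..<k}} \<and>
          (scs_normal S \<longleftrightarrow> scs_isomorphic S (Lambda k)) \<and>
          (\<exists>\<phi>. bij_betw \<phi> (Yinf S) (rank_labels k) \<and>
               (\<forall>z\<in>Yinf S. \<forall>z'\<in>Yinf S. scs_le S z z' \<longleftrightarrow> label_le (\<phi> z) (\<phi> z')))) \<and>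
     (\<forall>S :: 'a scs. is_scs S \<and> scs_saturated S \<and> scs_normal S \<longrightarrow>
        (\<exists>!\<L>. layer_decomposition S \<L>)) \<and>
     (\<forall>(S :: 'a scs) (S' :: 'b scs).
        is_scs S \<and> scs_saturated S \<and> scs_normal S \<and>
        is_scs S' \<and> scs_saturated S' \<and> scs_normal S' \<longrightarrow>
          (scs_isomorphic S S' \<longleftrightarrow>
            (\<forall>k. {L \<in> layers S. scs_isomorphic L (Lambda k)} \<approx>
                 {L \<in> layers S'. scs_isomorphic L (Lambda k)}))) \<and>
     (\<forall>S :: 'a scs. is_scs S \<and> scs_saturated S \<longrightarrow>
        (\<exists>(N :: 'a ext_elem scs) \<iota>. normal_extension S N \<iota>) \<and>
        (\<exists>(N :: 'a ext_elem scs) \<iota>. minimal_normal_extension S N \<iota>) \<and>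
        (\<forall>(N :: 'c scs) \<iota> (N' :: 'd scs) \<iota>'.
           minimal_normal_extension S N \<iota> \<and> normal_extension S N' \<iota>' \<longrightarrow>
             (\<exists>g. scs_embedding g N N' \<and> (\<forall>n. \<forall>x\<in>lev S n. g n (\<iota> n x) = \<iota>' n x))) \<and>
        (\<forall>(N :: 'c scs) \<iota> (N' :: 'd scs) \<iota>'.
           minimal_normal_extension S N \<iota> \<and> minimal_normal_extension S N' \<iota>' \<longrightarrow>
             (\<exists>g. is_scs_iso g N N' \<and> (\<forall>n. \<forall>x\<in>lev S n. g n (\<iota> n x) = \<iota>' n x)))) \<and>
     (\<forall>(S :: 'a scs) (N :: 'c scs) \<iota>.
        is_scs S \<and> scs_saturated S \<and> minimal_normal_extension S N \<iota> \<longrightarrow>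
          (\<forall>L\<in>layers N. \<exists>k. scs_isomorphic L (Lambda k) \<and>
             layer_labels S \<iota> L \<noteq> {} \<and> finite (layer_labels S \<iota> L) \<and>
             layer_labels S \<iota> L \<subseteq> rank_labels k \<and>
             (\<forall>u\<in>layer_labels S \<iota> L. \<forall>v\<in>layer_labels S \<iota> L. u \<noteq> v \<longrightarrow> \<not> label_le u v))) \<and>
     (\<forall>(S :: 'a scs) (N :: 'c scs) \<iota> (S' :: 'b scs) (N' :: 'd scs) \<iota>'.
        is_scs S \<and> scs_saturated S \<and> minimal_normal_extension S N \<iota> \<and>
        is_scs S' \<and> scs_saturated S' \<and> minimal_normal_extension S' N' \<iota>' \<longrightarrow>
          (scs_isomorphic S S' \<longleftrightarrow>
            (\<exists>\<phi>. bij_betw \<phi> (layers N) (layers N') \<and>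
                 (\<forall>L\<in>layers N.
                    (\<forall>k. scs_isomorphic L (Lambda k) \<longleftrightarrow> scs_isomorphic (\<phi> L) (Lambda k)) \<and>
                    layer_labels S' \<iota>' (\<phi> L) = layer_labels S \<iota> L))))"
proof (intro conjI allI impI; (elim conjE)?)
  fix S :: "'a scs" and y k
  assume S: "is_scs S" "scs_saturated S" "roots S = {y}" and k: "normal_rank S y = k"
  interpret S: single_root S y by unfold_locales (rule S)+
  have k': "k = S.rank y" using k by (simp add: normal_rank_def S.normal_label_eq)
  show "sub_scs (Lambda_above k (normal_label S y)) (Lambda k)" by (rule sub_scs_Lambda_above)
  show "scs_isomorphic S (Lambda_above k (normal_label S y))"
    unfolding k' S.normal_label_eq by (rule S.iso_Lambda_above)
  show "scs_isomorphic S S' \<longleftrightarrow> normal_label S y = normal_label S' y'"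
    if "is_scs S'" "scs_saturated S'" "roots S' = {y'}" for S' :: "'b scs" and y'
    by (rule single_root_iso_iff; unfold_locales) (rule S that)+
  show "scs_normal S \<longleftrightarrow> normal_label S y = {..<k}"
    unfolding k' S.normal_label_eq by (rule S.scs_normal_iff_lab)
  show "roots (Lambda k) = {germ (Lambda k) k {..<k}}" by (rule roots_Lambda)
  show "scs_normal S \<longleftrightarrow> scs_isomorphic S (Lambda k)"
    unfolding k' by (rule S.scs_normal_iff_iso_Lambda)
  show "\<exists>\<phi>. bij_betw \<phi> (Yinf S) (rank_labels k) \<and>
      (\<forall>z\<in>Yinf S. \<forall>z'\<in>Yinf S. scs_le S z z' \<longleftrightarrow> label_le (\<phi> z) (\<phi> z'))"
    unfolding k' by (rule S.ex_order_iso)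
next
  fix S :: "'a scs" assume S: "is_scs S" "scs_saturated S" "scs_normal S"
  interpret S: normal_scs S by unfold_locales (rule S)+
  show "\<exists>!\<L>. layer_decomposition S \<L>" by (rule S.ex1_layer_decomposition)
next
  fix S :: "'a scs" and S' :: "'b scs"
  assume S: "is_scs S" "scs_saturated S" "scs_normal S" "is_scs S'" "scs_saturated S'" "scs_normal S'"
  show "scs_isomorphic S S' \<longleftrightarrow>
      (\<forall>k. {L \<in> layers S. scs_isomorphic L (Lambda k)} \<approx> {L \<in> layers S'. scs_isomorphic L (Lambda k)})"
    by (rule normal_scs_iso_iff; unfold_locales) (rule S)+
next
  fix S :: "'a scs" assume S: "is_scs S" "scs_saturated S"
  obtain N0 :: "'a ext_elem scs" and \<iota>0 where T: "tight_extension S N0 \<iota>0"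
    using ex_tight_extension[OF S(1)] by (elim exE)
  show "\<exists>(N :: 'a ext_elem scs) \<iota>. normal_extension S N \<iota>"
    using T unfolding tight_extension_def by blast
  show "\<exists>(N :: 'a ext_elem scs) \<iota>. minimal_normal_extension S N \<iota>"
    using T minimal_normal_extension_iff_tight[OF S(1)] by blast
  \<comment> \<open>Here \<open>N'\<close> lives on an arbitrary type, whereas minimality quantifies
    over one type of competitors; tightness bridges the gap.\<close>
  show "\<exists>g. scs_embedding g N N' \<and> (\<forall>n. \<forall>x\<in>lev S n. g n (\<iota> n x) = \<iota>' n x)"
    if "minimal_normal_extension S N \<iota>" "normal_extension S N' \<iota>'"
    for N :: "'c scs" and \<iota> and N' :: "'d scs" and \<iota>'
    using tight_extension_universal[OF S(1)] that minimal_normal_extension_iff_tight[OF S(1)] by blast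
  show "\<exists>g. is_scs_iso g N N' \<and> (\<forall>n. \<forall>x\<in>lev S n. g n (\<iota> n x) = \<iota>' n x)"
    if "minimal_normal_extension S N \<iota>" "minimal_normal_extension S N' \<iota>'"
    for N :: "'c scs" and \<iota> and N' :: "'d scs" and \<iota>'
    by (rule tight_extension_iso[OF S(1)])
      (use that in \<open>simp_all add: minimal_normal_extension_iff_tight[OF S(1)]\<close>)
next
  fix S :: "'a scs" and N :: "'c scs" and \<iota>
  assume S: "is_scs S" "scs_saturated S" "minimal_normal_extension S N \<iota>"
  interpret tight_ext S N \<iota> by (rule tight_extI[OF S])
  show "\<forall>L\<in>layers N. \<exists>k. scs_isomorphic L (Lambda k) \<and>
      layer_labels S \<iota> L \<noteq> {} \<and> finite (layer_labels S \<iota> L) \<and>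
      layer_labels S \<iota> L \<subseteq> rank_labels k \<and>
      (\<forall>u\<in>layer_labels S \<iota> L. \<forall>v\<in>layer_labels S \<iota> L. u \<noteq> v \<longrightarrow> \<not> label_le u v)"
    using layer_labels_antichain by (rule ballI)
next
  fix S :: "'a scs" and N :: "'c scs" and \<iota> and S' :: "'b scs" and N' :: "'d scs" and \<iota>'
  assume S: "is_scs S" "scs_saturated S" "minimal_normal_extension S N \<iota>"
    and S': "is_scs S'" "scs_saturated S'" "minimal_normal_extension S' N' \<iota>'"
  show "scs_isomorphic S S' \<longleftrightarrow>
      (\<exists>\<phi>. bij_betw \<phi> (layers N) (layers N') \<and>
        (\<forall>L\<in>layers N.
          (\<forall>k. scs_isomorphic L (Lambda k) \<longleftrightarrow> scs_isomorphic (\<phi> L) (Lambda k)) \<and>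
          layer_labels S' \<iota>' (\<phi> L) = layer_labels S \<iota> L))"
    by (rule tight_ext_iso_iff[OF tight_extI[OF S] tight_extI[OF S']])
qed

end
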